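(* Let $p>1$ (finite), $\alpha>-1$, $t=\frac{\alpha+n}{p}$, and let $\beta\in\mathbb N_0$ satisfy $\beta>\max\left(\frac{\alpha+n}{p}-1,\frac{\alpha}{p}\right)$. For $f\in A^\infty_{t}(\mathbb B)$ set $$t_1(f)=\operatorname{dist}_{A^\infty_t}(f,A^p_\alpha)=\inf_{u\in A^p_\alpha}\|f-u\|_{A^\infty_t},$$ $$t_2(f)=\inf\left\{\epsilon>0:\int_{\mathbb B}\left(\int_{U_{\epsilon,t}(f)}|Q_\beta(x,y)|(1-|y|)^{\beta-t}dy\right)^p(1-|x|)^\alpha dx<\infty\right\}.$$ Then $t_1(f)\asymp t_2(f)$, i.e. there are constants $0<c\le C<\infty$ independent of $f$ such that $c\,t_2(f)\le t_1(f)\le C\,t_2(f)$ for all $f\in A^\infty_t(\mathbb B)$.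
   Context: Let $n\ge 2$, let $\mathbb B$ be the open unit ball of $\mathbb R^n$, $\mathbb S=\partial\mathbb B$; write $x=rx'$ with $r=|x|$, $x'\in\mathbb S$. $dx'$ is the rotation-invariant surface measure on $\mathbb S$ and $dx=r^{n-1}dr\,dx'$ is Lebesgue measure on $\mathbb B$ (up to a fixed normalization). $h(\mathbb B)$ is the space of harmonic functions on $\mathbb B$. For $0<p<\infty$ and $\alpha>-1$, $A^p_\alpha=A^p_\alpha(\mathbb B)$ is the space of $f\in h(\mathbb B)$ with $\|f\|_{A^p_\alpha}=\left(\int_{\mathbb B}|f(x)|^p(1-|x|)^\alpha dx\right)^{1/p}<\infty$. $A^\infty_t=A^\infty_t(\mathbb B)$ is the space of $f\in h(\mathbb B)$ with $\|f\|_{A^\infty_t}=\sup_{x\in\mathbb B}|f(x)|(1-|x|)^t<\infty$. One has $A^p_\alpha\subset A^\infty_{(\alpha+n)/p}$ continuously. For $\epsilon>0$, $t>0$, $f\in h(\mathbb B)$: $U_{\epsilon,t}(f)=\{x\in\mathbb B:|f(x)|(1-|x|)^t\ge\epsilon\}$. The Bergman kernel is $$Q_\beta(x,y)=2\sum_{k=0}^\infty\frac{\Gamma(\beta+1+k+n/2)}{\Gamma(\beta+1)\Gamma(k+n/2)}r^k\rho^kZ^{(k)}_{x'}(y'),\qquad x=rx',\ y=\rho y'\in\mathbb B,$$ where $Z^{(k)}_{x'}(y')=\sum_{j=1}^{d_k}Y_j^{(k)}(x')\overline{Y_j^{(k)}(y')}$ is the zonal harmonic of order $k$ and $\{Y_j^{(k)}\}_{1\le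 j\le d_k}$ is an orthonormal basis, in $L^2(\mathbb S,dx')$, of the space of spherical harmonics of order $k$. *)

theory Defs
  imports "HOL-Analysis.Analysis"
begin

text \<open>
  Twice continuously differentiable on \<open>S\<close> (meant for open \<open>S\<close>) with vanishing Laplacian;
  \<open>f'\<close> and \<open>f''\<close> are the first and second Frechet derivatives, and the sum is the trace of \<open>f''\<close>.
\<close>
definition harmonic_on :: "('a::euclidean_space \<Rightarrow> 'b::real_normed_vector) \<Rightarrow> 'a set \<Rightarrow> bool" where
  "harmonic_on f S \<longleftrightarrow>
     (\<exists>(f' :: 'a \<Rightarrow> 'a \<Rightarrow>\<^sub>L 'b) (f'' :: 'a \<Rightarrow> 'a \<Rightarrow>\<^sub>L 'a \<Rightarrow>\<^sub>L 'b).
        (\<forall>x\<in>S. (f has_derivative blinfun_apply (f' x)) (at x)) \<and>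
        (\<forall>x\<in>S. (f' has_derivative blinfun_apply (f'' x)) (at x)) \<and>
        continuous_on S f'' \<and>
        (\<forall>x\<in>S. (\<Sum>b\<in>Basis. blinfun_apply (blinfun_apply (f'' x) b) b) = 0))"

text \<open>Real powers of extended nonnegative numbers, for exponents \<open>s > 0\<close>.\<close>
definition ennpowr :: "ennreal \<Rightarrow> real \<Rightarrow> ennreal" where
  "ennpowr a s = (if a = \<infinity> then \<infinity> else ennreal (enn2real a powr s))"

text \<open>
  Functions on the unit ball are represented by functions on the whole space whose values outside
  the ball are irrelevant. Norms, and everything built from them, take values in \<open>[0, \<infinity>]\<close>, so that
  no finiteness is presupposed.
\<close>
definition bergman_norm :: "real \<Rightarrow> real \<Rightarrow> ('a::euclidean_space \<Rightarrow> complex) \<Rightarrow> ennreal" where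
  "bergman_norm p \<alpha> f =
     ennpowr (\<integral>\<^sup>+x\<in>ball 0 1. ennreal (norm (f x) powr p * (1 - norm x) powr \<alpha>) \<partial>lborel) (1 / p)"

definition bergman_space :: "real \<Rightarrow> real \<Rightarrow> ('a::euclidean_space \<Rightarrow> complex) set" where
  "bergman_space p \<alpha> = {f. harmonic_on f (ball 0 1) \<and> bergman_norm p \<alpha> f < \<infinity>}"

definition growth_norm :: "real \<Rightarrow> ('a::euclidean_space \<Rightarrow> complex) \<Rightarrow> ennreal" where
  "growth_norm t f = (SUP x\<in>ball 0 1. ennreal (norm (f x) * (1 - norm x) powr t))"

definition growth_space :: "real \<Rightarrow> ('a::euclidean_space \<Rightarrow> complex) set" where
  "growth_space t = {f. harmonic_on f (ball 0 1) \<and> growth_norm t f < \<infinity>}"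

definition superlevel :: "real \<Rightarrow> real \<Rightarrow> ('a::euclidean_space \<Rightarrow> complex) \<Rightarrow> 'a set" where
  "superlevel \<epsilon> t f = {x \<in> ball 0 1. norm (f x) * (1 - norm x) powr t \<ge> \<epsilon>}"

text \<open>
  Surface measure on the unit sphere, as a Borel measure on the whole space carried by the sphere:
  the measure of \<open>A\<close> is \<open>n\<close> times the volume of the cone \<open>{r x | x \<in> A, 0 < r < 1}\<close>, which is the
  normalization for which Lebesgue measure is \<open>r^(n-1) dr dx'\<close>. (\<open>sgn x = x / |x|\<close>; the
  origin is a null set.)
\<close>
definition sphere_measure :: "'a::euclidean_space measure" where
  "sphere_measure =
     scale_measure (of_nat DIM('a)) (distr (restrict_space lborel (ball 0 1)) borel sgn)"

text \<open>
  Spherical harmonics of order \<open>k\<close>: restrictions to the unit sphere (extended by \<open>0\<close>, so that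
  equality of functions is equality on the sphere) of homogeneous harmonic polynomials of degree \<open>k\<close>.
\<close>
definition spherical_harmonics :: "nat \<Rightarrow> ('a::euclidean_space \<Rightarrow> complex) set" where
  "spherical_harmonics k =
     {Y. \<exists>q :: 'a \<Rightarrow> complex. polynomial_function q \<and> (\<forall>c x. q (c *\<^sub>R x) = of_real c ^ k * q x) \<and>
           harmonic_on q UNIV \<and> Y = (\<lambda>x. if norm x = 1 then q x else 0)}"

definition spherical_onb :: "nat \<Rightarrow> ('a::euclidean_space \<Rightarrow> complex) set \<Rightarrow> bool" where
  "spherical_onb k B \<longleftrightarrow>
     finite B \<and> B \<subseteq> spherical_harmonics k \<and>
     (\<forall>Y\<in>B. \<forall>Y'\<in>B. (LINT x|sphere_measure. Y x * cnj (Y' x)) = (if Y = Y' then 1 else 0)) \<and>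
     (\<forall>F\<in>spherical_harmonics k. \<exists>c. F = (\<lambda>x. \<Sum>Y\<in>B. c Y * Y x))"

text \<open>The sum does not depend on which orthonormal basis is chosen.\<close>
definition zonal_harmonic :: "nat \<Rightarrow> 'a::euclidean_space \<Rightarrow> 'a \<Rightarrow> complex" where
  "zonal_harmonic k x' y' = (\<Sum>Y\<in>(SOME B. spherical_onb k B). Y x' * cnj (Y y'))"

text \<open>
  The direction \<open>x'\<close> in \<open>x = r x'\<close>. At the origin any unit vector will do: there only
  the term \<open>k = 0\<close> of the kernel survives, and it is constant in the directions.
\<close>
definition direction :: "'a::euclidean_space \<Rightarrow> 'a" where
  "direction x = (if x = 0 then SOME u. norm u = 1 else sgn x)"

definition bergman_kernel :: "real \<Rightarrow> 'a::euclidean_space \<Rightarrow> 'a \<Rightarrow> complex" where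
  "bergman_kernel \<beta> x y =
     2 * (\<Sum>k. of_real (Gamma (\<beta> + 1 + real k + real DIM('a) / 2) /
                        (Gamma (\<beta> + 1) * Gamma (real k + real DIM('a) / 2)) *
                        norm x ^ k * norm y ^ k) *
               zonal_harmonic k (direction x) (direction y))"

definition dist_to_bergman :: "real \<Rightarrow> real \<Rightarrow> real \<Rightarrow> ('a::euclidean_space \<Rightarrow> complex) \<Rightarrow> ennreal" where
  "dist_to_bergman t p \<alpha> f = (INF u\<in>bergman_space p \<alpha>. growth_norm t (\<lambda>x. f x - u x))"

definition superlevel_integral ::
    "real \<Rightarrow> real \<Rightarrow> real \<Rightarrow> real \<Rightarrow> real \<Rightarrow> ('a::euclidean_space \<Rightarrow> complex) \<Rightarrow> ennreal" where
  "superlevel_integral \<beta> t p \<alpha> \<epsilon> f =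
     (\<integral>\<^sup>+x\<in>ball 0 1.
        ennpowr (\<integral>\<^sup>+y\<in>superlevel \<epsilon> t f.
                   ennreal (norm (bergman_kernel \<beta> x y) * (1 - norm y) powr (\<beta> - t)) \<partial>lborel) p
        * ennreal ((1 - norm x) powr \<alpha>) \<partial>lborel)"

definition critical_level ::
    "real \<Rightarrow> real \<Rightarrow> real \<Rightarrow> real \<Rightarrow> ('a::euclidean_space \<Rightarrow> complex) \<Rightarrow> ennreal" where
  "critical_level \<beta> t p \<alpha> f =
     Inf {ennreal \<epsilon> | \<epsilon>. \<epsilon> > 0 \<and> superlevel_integral \<beta> t p \<alpha> \<epsilon> f < \<infinity>}"

end

theory Submission
  imports Defs "HOL-Complex_Analysis.Complex_Analysis"
begin

text \<open>
  For natural \<open>\<beta>\<close> the kernel \<open>Q(x, y)\<close> is, up to a constant, the radial differential operator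
  \<open>\<Prod>j\<le>\<beta>. (n/2 + j + R d/dR)\<close> applied to the Poisson kernel \<open>P(R x', y')\<close> at \<open>R = |x||y|\<close>.
  Since \<open>P\<close> extends holomorphically in \<open>R\<close>, Cauchy's inequality gives
  \<open>|Q(x, y)| \<le> C P(R x', y') / (1 - R)^(\<beta>+1)\<close>, and as \<open>P\<close> has constant mass on spheres,
  \<open>\<integral>|Q(x, y)| (1 - |y|)^s dy \<le> C (1 - |x|)^(s-\<beta>)\<close> for \<open>-1 < s < \<beta>\<close>.

  Upper bound: if \<open>\<epsilon>\<close> is admissible for \<open>t_2\<close>, split the reproducing formula
  \<open>f(x) = \<integral>Q(x, y) f(y) (1 - |y|^2)^\<beta> dy\<close> at the superlevel set. The part over the superlevel
  set lies in the Bergman space, and the rest is at most \<open>C \<epsilon> (1 - |x|)^(-t)\<close>.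

  Lower bound, with \<open>c = 1\<close>: if \<open>|f - u| (1 - |x|)^t \<le> g < \<epsilon>\<close>, then
  \<open>|u| (1 - |x|)^t \<ge> \<epsilon> - g\<close> on the superlevel set, and \<open>u \<mapsto> \<integral>|Q(x, y)| |u(y)| (1 - |y|)^\<beta> dy\<close>
  is bounded on the weighted \<open>L^p\<close> space by the Schur test.
\<close>

section \<open>Harmonic functions\<close>

text \<open>The kernel is defined through an arbitrarily chosen orthonormal basis, so it has to be
  tied to the Poisson kernel. Comparing coefficients in the Poisson formula does this: the degree-k
  coefficient of the Poisson kernel, divided by the area of the sphere, reproduces every spherical
  harmonic of order k, and this yields both the existence of a finite basis and the value of the
  zonal sum. The factor 2 and the Gamma quotient in the kernel are the reciprocals of the integrals
  of r^(2k) (1 - r^2)^\<beta> against r^(n-1) dr, which is why the reproducing formula carries the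
  weight (1 - |y|^2)^\<beta>; passing to (1 - |y|)^\<beta> costs a factor 2^\<beta>. On the
  superlevel set the growth bound replaces |f(y)| (1 - |y|)^\<beta> by a multiple of (1 -
  |y|)^(\<beta>-t), the weight in t_2, so an admissible \<epsilon> provides an L^p majorant. The
  condition \<beta> > t - 1 enters as \<beta> - t > -1, and t > 0 as \<beta> - t < \<beta>: together
  they are the range of the kernel estimate.\<close>

lemma sum_bilinear_coord:
  assumes "linear g"
  shows "g h = (\<Sum>b\<in>Basis. (h \<bullet> b) *\<^sub>R g (b::'a::euclidean_space))"
proof -
  have "g h = g (\<Sum>b\<in>Basis. (h \<bullet> b) *\<^sub>R b)" by (simp add: euclidean_representation)
  also have "\<dots> = (\<Sum>b\<in>Basis. (h \<bullet> b) *\<^sub>R g b)"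
    using assms by (simp add: linear_sum linear_cmul)
  finally show ?thesis .
qed

lemma sum_coord_Basis:
  assumes "d \<in> (Basis::'a::euclidean_space set)"
  shows "(\<Sum>b\<in>Basis. (d \<bullet> b) *\<^sub>R G b) = (G d :: 'b::real_vector)"
proof -
  have "(\<Sum>b\<in>Basis. (d \<bullet> b) *\<^sub>R G b) = (\<Sum>b\<in>Basis. if b = d then G b else 0)"
    by (intro sum.cong refl) (use assms in \<open>auto simp: inner_Basis\<close>)
  then show ?thesis using assms by simp
qed

section \<open>Harmonicity in coordinates\<close>

definition coord_blinfun :: "'a::euclidean_space \<Rightarrow> 'b::real_normed_vector \<Rightarrow> 'a \<Rightarrow>\<^sub>L 'b" where
  "coord_blinfun b v = blinfun_scaleR_left v o\<^sub>L blinfun_inner_left b"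

lemma coord_blinfun_apply [simp]: "blinfun_apply (coord_blinfun b v) h = (h \<bullet> b) *\<^sub>R v"
  by (simp add: coord_blinfun_def inner_commute)

lemma bounded_linear_coord_blinfun: "bounded_linear (coord_blinfun b :: 'b::real_normed_vector \<Rightarrow> 'a::euclidean_space \<Rightarrow>\<^sub>L 'b)"
proof (rule bounded_linear_intro[where K = "norm b"])
  show "norm (coord_blinfun b v) \<le> norm v * norm b" for v :: 'b
  proof (rule norm_blinfun_bound)
    fix h
    show "norm (blinfun_apply (coord_blinfun b v) h) \<le> norm v * norm b * norm h"
      using mult_left_mono[OF Cauchy_Schwarz_ineq2[of h b], of "norm v"] by (simp add: ac_simps)
  qed simp
qed (auto intro!: blinfun_eqI simp: blinfun.add_left scaleR_add_right blinfun.scaleR_left)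

text \<open>An unbundled form of \<open>harmonic_on\<close>: \<open>D b\<close> and
  \<open>E b c\<close> are the first and second partial derivatives, taken along \<open>b\<close>
  and then along \<open>c\<close>. Closure properties can be checked on these plain functions
  instead of on operator-valued derivatives.\<close>

definition harmonic_jet :: "('a::euclidean_space \<Rightarrow> 'b::real_normed_vector) \<Rightarrow>
    ('a \<Rightarrow> 'a \<Rightarrow> 'b) \<Rightarrow> ('a \<Rightarrow> 'a \<Rightarrow> 'a \<Rightarrow> 'b) \<Rightarrow> 'a set \<Rightarrow> bool" where
  "harmonic_jet f D E S \<longleftrightarrow>
     (\<forall>x\<in>S. (f has_derivative (\<lambda>h. \<Sum>b\<in>Basis. (h \<bullet> b) *\<^sub>R D b x)) (at x)) \<and>
     (\<forall>b\<in>Basis. \<forall>x\<in>S. (D b has_derivative (\<lambda>h. \<Sum>c\<in>Basis. (h \<bullet> c) *\<^sub>R E b c x)) (at x)) \<and>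
     (\<forall>b\<in>Basis. \<forall>c\<in>Basis. continuous_on S (E b c)) \<and>
     (\<forall>x\<in>S. (\<Sum>b\<in>Basis. E b b x) = 0)"

lemma harmonic_jetD:
  assumes "harmonic_jet f D E S"
  shows "x \<in> S \<Longrightarrow> (f has_derivative (\<lambda>h. \<Sum>b\<in>Basis. (h \<bullet> b) *\<^sub>R D b x)) (at x)"
    and "b \<in> Basis \<Longrightarrow> x \<in> S \<Longrightarrow>
       (D b has_derivative (\<lambda>h. \<Sum>c\<in>Basis. (h \<bullet> c) *\<^sub>R E b c x)) (at x)"
    and "b \<in> Basis \<Longrightarrow> c \<in> Basis \<Longrightarrow> continuous_on S (E b c)"
    and "x \<in> S \<Longrightarrow> (\<Sum>b\<in>Basis. E b b x) = 0"
  using assms by (auto simp: harmonic_jet_def)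

lemma harmonic_on_jet:
  fixes f :: "'a::euclidean_space \<Rightarrow> 'b::real_normed_vector"
  shows "harmonic_on f S \<longleftrightarrow> (\<exists>D E. harmonic_jet f D E S)"
    (is "?L \<longleftrightarrow> ?R")
proof
  assume ?L
  then obtain f' f'' where
    1: "\<And>x. x \<in> S \<Longrightarrow> (f has_derivative blinfun_apply (f' x)) (at x)" and
    2: "\<And>x. x \<in> S \<Longrightarrow> (f' has_derivative blinfun_apply (f'' x)) (at x)" and
    3: "continuous_on S f''" and
    4: "\<And>x. x \<in> S \<Longrightarrow> (\<Sum>b\<in>Basis. blinfun_apply (blinfun_apply (f'' x) b) b) = 0"
    unfolding harmonic_on_def by blast
  define D where "D = (\<lambda>b x. blinfun_apply (f' x) b)"
  \<comment> \<open>The second differentiation is along \<open>c\<close>, so \<open>c\<close> is the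
    argument that \<open>f''\<close> takes first.\<close>
  define E where "E = (\<lambda>b c x. blinfun_apply (blinfun_apply (f'' x) c) b)"
  show ?R
  proof (rule exI[of _ "D"], rule exI[of _ "E"], unfold harmonic_jet_def, intro conjI ballI)
    fix x assume "x \<in> S"
    have "blinfun_apply (f' x) = (\<lambda>h. \<Sum>b\<in>Basis. (h \<bullet> b) *\<^sub>R D b x)"
      unfolding D_def by (rule ext, rule sum_bilinear_coord)
        (rule bounded_linear.linear[OF blinfun.bounded_linear_right])
    with 1[OF \<open>x \<in> S\<close>] show "(f has_derivative (\<lambda>h. \<Sum>b\<in>Basis. (h \<bullet> b) *\<^sub>R D b x)) (at x)" by simp
    show "(\<Sum>b\<in>Basis. E b b x) = 0" using 4[OF \<open>x \<in> S\<close>] by (simp add: E_def)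
  next
    fix b x :: 'a assume "x \<in> S"
    have "(D b has_derivative (\<lambda>h. blinfun_apply (blinfun_apply (f'' x) h) b)) (at x)"
      unfolding D_def
      by (rule bounded_linear.has_derivative[OF blinfun.bounded_linear_left 2[OF \<open>x \<in> S\<close>]])
    moreover have "(\<lambda>h. blinfun_apply (blinfun_apply (f'' x) h) b) =
        (\<lambda>h. \<Sum>c\<in>Basis. (h \<bullet> c) *\<^sub>R E b c x)"
      unfolding E_def
    proof (rule ext, rule sum_bilinear_coord)
      show "linear (\<lambda>h. blinfun_apply (blinfun_apply (f'' x) h) b)"
        by (rule linearI) (auto simp: blinfun.add_right blinfun.add_left blinfun.scaleR_right blinfun.scaleR_left)
    qed
    ultimately show "(D b has_derivative (\<lambda>h. \<Sum>c\<in>Basis. (h \<bullet> c) *\<^sub>R E b c x)) (at x)" by simp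
  next
    fix b c :: 'a
    show "continuous_on S (E b c)" unfolding E_def
      by (intro continuous_intros 3)
  qed
next
  assume ?R
  then obtain D E where J: "harmonic_jet f D E S" by blast
  note 1 = harmonic_jetD(1)[OF J] and 2 = harmonic_jetD(2)[OF J]
    and 3 = harmonic_jetD(3)[OF J] and 4 = harmonic_jetD(4)[OF J]
  \<comment> \<open>Rank-one operators assemble the bundled derivatives. Each depends linearly on
    its partial derivative, so differentiability and continuity carry over.\<close>
  define f' where "f' = (\<lambda>x. \<Sum>b\<in>Basis. coord_blinfun b (D b x))"
  define f'' where "f'' = (\<lambda>x. \<Sum>b\<in>Basis. \<Sum>c\<in>Basis. coord_blinfun c (coord_blinfun b (E b c x)))"
  show ?L unfolding harmonic_on_def
  proof (rule exI[of _ "f'"], rule exI[of _ "f''"], intro conjI ballI)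
    fix x assume x: "x \<in> S"
    show "(f has_derivative blinfun_apply (f' x)) (at x)"
    proof -
      have "blinfun_apply (f' x) = (\<lambda>h. \<Sum>b\<in>Basis. (h \<bullet> b) *\<^sub>R D b x)"
        by (rule ext) (simp add: f'_def blinfun.sum_left)
      then show ?thesis using 1[OF x] by simp
    qed
    have der: "(f' has_derivative (\<lambda>h. \<Sum>b\<in>Basis. coord_blinfun b (\<Sum>c\<in>Basis. (h \<bullet> c) *\<^sub>R E b c x))) (at x)"
      unfolding f'_def
      by (intro has_derivative_sum bounded_linear.has_derivative[OF bounded_linear_coord_blinfun] 2 x)
    have ap: "blinfun_apply (blinfun_apply (f'' x) h) k =
        (\<Sum>b\<in>Basis. (k \<bullet> b) *\<^sub>R (\<Sum>c\<in>Basis. (h \<bullet> c) *\<^sub>R E b c x))" for h k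
    proof -
      have "blinfun_apply (blinfun_apply (f'' x) h) k =
          (\<Sum>b\<in>Basis. \<Sum>c\<in>Basis. (h \<bullet> c) *\<^sub>R (k \<bullet> b) *\<^sub>R E b c x)"
        by (simp only: f''_def blinfun.sum_left blinfun.scaleR_left coord_blinfun_apply)
      then show ?thesis by (simp add: scaleR_sum_right mult.commute)
    qed
    have "(\<lambda>h. \<Sum>b\<in>Basis. coord_blinfun b (\<Sum>c\<in>Basis. (h \<bullet> c) *\<^sub>R E b c x)) = blinfun_apply (f'' x)"
      by (rule ext, rule blinfun_eqI) (simp only: ap blinfun.sum_left coord_blinfun_apply)
    with der show "(f' has_derivative blinfun_apply (f'' x)) (at x)" by simp
    have "(\<Sum>d\<in>Basis. blinfun_apply (blinfun_apply (f'' x) d) d) = (\<Sum>d\<in>Basis. E d d x)"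
      by (intro sum.cong refl) (simp only: ap sum_coord_Basis)
    then show "(\<Sum>d\<in>Basis. blinfun_apply (blinfun_apply (f'' x) d) d) = 0" using 4[OF x] by simp
  next
    show "continuous_on S f''" unfolding f''_def
      by (intro continuous_intros bounded_linear.continuous_on[OF bounded_linear_coord_blinfun] 3)
  qed
qed

section \<open>Closure properties of harmonic functions\<close>

lemma harmonic_on_subset: "harmonic_on f S \<Longrightarrow> T \<subseteq> S \<Longrightarrow> harmonic_on f T"
  unfolding harmonic_on_def
  by (elim exE conjE, intro exI conjI ballI) (auto intro: continuous_on_subset)

lemma harmonic_on_imp_continuous_on: "harmonic_on f S \<Longrightarrow> continuous_on S f"
  unfolding harmonic_on_def
  by (meson continuous_at_imp_continuous_on has_derivative_continuous)

lemma harmonic_on_cong: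
  assumes "harmonic_on f S" "open S" "\<And>x. x \<in> S \<Longrightarrow> f x = g x"
  shows "harmonic_on g S"
proof -
  obtain f' f'' where "\<forall>x\<in>S. (f has_derivative blinfun_apply (f' x)) (at x)"
    "\<forall>x\<in>S. (f' has_derivative blinfun_apply (f'' x)) (at x)" "continuous_on S f''"
    "\<forall>x\<in>S. (\<Sum>b\<in>Basis. blinfun_apply (blinfun_apply (f'' x) b) b) = 0"
    using assms(1) unfolding harmonic_on_def by blast
  moreover have "\<forall>x\<in>S. (g has_derivative blinfun_apply (f' x)) (at x)"
  proof
    fix x assume "x \<in> S"
    with calculation(1) show "(g has_derivative blinfun_apply (f' x)) (at x)"
      by (intro has_derivative_transform_within_open[OF _ assms(2) _ assms(3)]) auto
  qed
  ultimately show ?thesis unfolding harmonic_on_def by blast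
qed

lemma harmonic_on_add:
  fixes f g :: "'a::euclidean_space \<Rightarrow> 'b::real_normed_vector"
  assumes "harmonic_on f S" "harmonic_on g S"
  shows "harmonic_on (\<lambda>x. f x + g x) S"
proof -
  obtain D E where Jf: "harmonic_jet f D E S"
    using assms(1) unfolding harmonic_on_jet by blast
  note f = harmonic_jetD[OF Jf]
  obtain D' E' where Jg: "harmonic_jet g D' E' S"
    using assms(2) unfolding harmonic_on_jet by blast
  note g = harmonic_jetD[OF Jg]
  show ?thesis unfolding harmonic_on_jet
  proof (rule exI[of _ "\<lambda>b x. D b x + D' b x"], rule exI[of _ "\<lambda>b c x. E b c x + E' b c x"], unfold harmonic_jet_def, intro conjI ballI)
    fix x assume x: "x \<in> S"
    show "((\<lambda>x. f x + g x) has_derivative (\<lambda>h. \<Sum>b\<in>Basis. (h \<bullet> b) *\<^sub>R (D b x + D' b x))) (at x)"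
      using has_derivative_add[OF f(1)[OF x] g(1)[OF x]]
      by (simp add: scaleR_add_right sum.distrib)
    show "(\<Sum>b\<in>Basis. E b b x + E' b b x) = 0" using f(4)[OF x] g(4)[OF x] by (simp add: sum.distrib)
  next
    fix x b :: 'a assume x: "x \<in> S" and b: "b \<in> Basis"
    show "((\<lambda>x. D b x + D' b x) has_derivative (\<lambda>h. \<Sum>c\<in>Basis. (h \<bullet> c) *\<^sub>R (E b c x + E' b c x))) (at x)"
      using has_derivative_add[OF f(2)[OF b x] g(2)[OF b x]]
      by (simp add: scaleR_add_right sum.distrib)
  next
    fix b c :: 'a assume "b \<in> Basis" "c \<in> Basis"
    then show "continuous_on S (\<lambda>x. E b c x + E' b c x)" by (intro continuous_on_add f(3) g(3))
  qed
qed

lemma harmonic_on_linear_image: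
  fixes f :: "'a::euclidean_space \<Rightarrow> 'b::real_normed_vector" and L :: "'b \<Rightarrow> 'c::real_normed_vector"
  assumes L: "bounded_linear L" and "harmonic_on f S"
  shows "harmonic_on (\<lambda>x. L (f x)) S"
proof -
  interpret bounded_linear L by fact
  obtain D E where Jf: "harmonic_jet f D E S"
    using assms(2) unfolding harmonic_on_jet by blast
  note f = harmonic_jetD[OF Jf]
  show ?thesis unfolding harmonic_on_jet
  proof (rule exI[of _ "\<lambda>b x. L (D b x)"], rule exI[of _ "\<lambda>b c x. L (E b c x)"], unfold harmonic_jet_def, intro conjI ballI)
    fix x assume x: "x \<in> S"
    show "((\<lambda>x. L (f x)) has_derivative (\<lambda>h. \<Sum>b\<in>Basis. (h \<bullet> b) *\<^sub>R L (D b x))) (at x)"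
      using has_derivative[OF f(1)[OF x]] by (simp add: sum scaleR)
    show "(\<Sum>b\<in>Basis. L (E b b x)) = 0" using f(4)[OF x] by (metis sum zero)
  next
    fix x b :: 'a assume x: "x \<in> S" and b: "b \<in> Basis"
    show "((\<lambda>x. L (D b x)) has_derivative (\<lambda>h. \<Sum>c\<in>Basis. (h \<bullet> c) *\<^sub>R L (E b c x))) (at x)"
      using has_derivative[OF f(2)[OF b x]] by (simp add: sum scaleR)
  next
    fix b c :: 'a assume "b \<in> Basis" "c \<in> Basis"
    then show "continuous_on S (\<lambda>x. L (E b c x))" by (intro continuous_on f(3))
  qed
qed

lemma harmonic_on_dilation:
  fixes f :: "'a::euclidean_space \<Rightarrow> 'b::real_normed_vector"
  assumes "harmonic_on f S" "\<And>x. x \<in> T \<Longrightarrow> s *\<^sub>R x \<in> S"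
  shows "harmonic_on (\<lambda>x. f (s *\<^sub>R x)) T"
proof -
  obtain D E where Jf: "harmonic_jet f D E S"
    using assms(1) unfolding harmonic_on_jet by blast
  note f = harmonic_jetD[OF Jf]
  have chain: "((\<lambda>x. g (s *\<^sub>R x)) has_derivative (\<lambda>h. \<Sum>b\<in>Basis. (h \<bullet> b) *\<^sub>R (s *\<^sub>R G b))) (at x)"
    if "(g has_derivative (\<lambda>h. \<Sum>b\<in>Basis. (h \<bullet> b) *\<^sub>R G b)) (at (s *\<^sub>R x))"
    for g :: "'a \<Rightarrow> 'b" and G and x
  proof -
    have "((\<lambda>x. s *\<^sub>R x) has_derivative (\<lambda>x. s *\<^sub>R x)) (at x)"
      by (intro derivative_eq_intros) auto
    from has_derivative_compose[OF this that]
    show ?thesis by (simp add: mult.commute)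
  qed
  show ?thesis unfolding harmonic_on_jet
  proof (rule exI[of _ "\<lambda>b x. s *\<^sub>R D b (s *\<^sub>R x)"], rule exI[of _ "\<lambda>b c x. s *\<^sub>R s *\<^sub>R E b c (s *\<^sub>R x)"], unfold harmonic_jet_def, intro conjI ballI)
    fix x assume x: "x \<in> T"
    show "((\<lambda>x. f (s *\<^sub>R x)) has_derivative (\<lambda>h. \<Sum>b\<in>Basis. (h \<bullet> b) *\<^sub>R (s *\<^sub>R D b (s *\<^sub>R x)))) (at x)"
      by (rule chain, rule f(1), rule assms(2)[OF x])
    show "(\<Sum>b\<in>Basis. s *\<^sub>R s *\<^sub>R E b b (s *\<^sub>R x)) = 0"
      using f(4)[OF assms(2)[OF x]] by (metis scaleR_sum_right scaleR_zero_right)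
  next
    fix x b :: 'a assume x: "x \<in> T" and b: "b \<in> Basis"
    have "((\<lambda>x. D b (s *\<^sub>R x)) has_derivative (\<lambda>h. \<Sum>c\<in>Basis. (h \<bullet> c) *\<^sub>R (s *\<^sub>R E b c (s *\<^sub>R x)))) (at x)"
      by (rule chain, rule f(2)[OF b assms(2)[OF x]])
    from has_derivative_scaleR_right[OF this, of s]
    show "((\<lambda>x. s *\<^sub>R D b (s *\<^sub>R x)) has_derivative (\<lambda>h. \<Sum>c\<in>Basis. (h \<bullet> c) *\<^sub>R (s *\<^sub>R s *\<^sub>R E b c (s *\<^sub>R x)))) (at x)"
      by (simp add: scaleR_sum_right mult_ac)
  next
    fix b c :: 'a assume "b \<in> Basis" "c \<in> Basis"
    then have "continuous_on S (E b c)" by (rule f(3))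
    then have "continuous_on T (\<lambda>x. E b c (s *\<^sub>R x))"
      by (rule continuous_on_compose2) (use assms(2) in \<open>auto intro!: continuous_intros\<close>)
    then show "continuous_on T (\<lambda>x. s *\<^sub>R s *\<^sub>R E b c (s *\<^sub>R x))"
      by (intro continuous_on_scaleR continuous_on_const)
  qed
qed

definition blin_deriv :: "('a::real_normed_vector \<Rightarrow> 'b::real_normed_vector) \<Rightarrow> 'a \<Rightarrow> 'a \<Rightarrow>\<^sub>L 'b" where
  "blin_deriv f x = Blinfun (frechet_derivative f (at x))"

lemma blin_deriv_eq: "(f has_derivative blinfun_apply D) (at x) \<Longrightarrow> blin_deriv f x = D"
  unfolding blin_deriv_def using frechet_derivative_at by (metis blinfun_apply_inverse)

text \<open>Frechet derivatives are unique, so the derivatives supplied by different neighbourhoods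
  all agree with the canonical choice \<open>blin_deriv\<close>, and they glue.\<close>

lemma harmonic_on_local:
  assumes "\<And>x. x \<in> S \<Longrightarrow> \<exists>T. open T \<and> x \<in> T \<and> harmonic_on f T"
  shows "harmonic_on f S"
proof -
  define f' where "f' = blin_deriv f"
  define f'' where "f'' = blin_deriv f'"
  have main: "(f has_derivative blinfun_apply (f' x)) (at x) \<and> (f' has_derivative blinfun_apply (f'' x)) (at x)
     \<and> isCont f'' x \<and> (\<Sum>b\<in>Basis. blinfun_apply (blinfun_apply (f'' x) b) b) = 0" if "x \<in> S" for x
  proof -
    obtain T where T: "open T" "x \<in> T" "harmonic_on f T" using assms[OF \<open>x \<in> S\<close>] by blast
    obtain F' F'' where F: "\<And>x. x \<in> T \<Longrightarrow> (f has_derivative blinfun_apply (F' x)) (at x)"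
      "\<And>x. x \<in> T \<Longrightarrow> (F' has_derivative blinfun_apply (F'' x)) (at x)"
      "continuous_on T F''"
      "\<And>x. x \<in> T \<Longrightarrow> (\<Sum>b\<in>Basis. blinfun_apply (blinfun_apply (F'' x) b) b) = 0"
      using T(3) unfolding harmonic_on_def by blast
    have 1: "f' y = F' y" if "y \<in> T" for y unfolding f'_def using F(1)[OF that] by (rule blin_deriv_eq)
    have 2: "(f' has_derivative blinfun_apply (F'' y)) (at y)" if "y \<in> T" for y
      by (rule has_derivative_transform_within_open[OF F(2)[OF that] T(1) that]) (simp add: 1)
    have 3: "f'' y = F'' y" if "y \<in> T" for y unfolding f''_def using 2[OF that] by (rule blin_deriv_eq)
    have "continuous_on T f''" using F(3) 3 by (simp cong: continuous_on_cong)
    then have "isCont f'' x" using T by (simp add: continuous_on_eq_continuous_at)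
    with T F 1 2 3 show ?thesis by simp
  qed
  show ?thesis unfolding harmonic_on_def
    by (intro exI[of _ f'] exI[of _ f'']) (use main in \<open>auto intro: continuous_at_imp_continuous_on\<close>)
qed

lemma harmonic_on_ball_exhaust:
  fixes f :: "'a::euclidean_space \<Rightarrow> 'b::real_normed_vector"
  assumes "\<And>s. 0 < s \<Longrightarrow> s < 1 \<Longrightarrow> harmonic_on f (ball 0 s)"
  shows "harmonic_on f (ball 0 1)"
proof (rule harmonic_on_local)
  fix x :: 'a assume "x \<in> ball 0 1"
  then have "0 < (1 + norm x) / 2" "(1 + norm x) / 2 < 1" "x \<in> ball 0 ((1 + norm x) / 2)"
    by (auto simp: add_pos_nonneg)
  then show "\<exists>T. open T \<and> x \<in> T \<and> harmonic_on f T" using assms open_ball by blast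
qed

section \<open>The maximum principle\<close>

lemma second_derivative_local_max:
  fixes g :: "real \<Rightarrow> real"
  assumes d: "\<delta> > 0" and g: "\<And>s. \<bar>s\<bar> < \<delta> \<Longrightarrow> (g has_real_derivative g' s) (at s)"
    and g': "(g' has_real_derivative l) (at 0)"
    and max: "\<And>s. \<bar>s\<bar> < \<delta> \<Longrightarrow> g s \<le> g 0"
  shows "l \<le> 0"
proof (rule ccontr)
  assume "\<not> l \<le> 0"
  have z: "g' 0 = 0" using g[of 0] d max by (intro DERIV_local_max[of g _ 0 \<delta>]) auto
  \<comment> \<open>\<open>g'\<close> vanishes at the maximum, so a positive \<open>l\<close> makes
    it positive just to the right of 0, and \<open>g\<close> would rise above its maximum.\<close>
  obtain e where e: "e > 0" "\<And>h. 0 < h \<Longrightarrow> h < e \<Longrightarrow> g' 0 < g' (0 + h)"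
    using DERIV_pos_inc_right[OF g'] \<open>\<not> l \<le> 0\<close> by auto
  define s where "s = min (\<delta>/2) (e/2)"
  have s: "0 < s" "s < \<delta>" "s < e" using d e by (auto simp: s_def)
  obtain \<xi> where "0 < \<xi>" "\<xi> < s" "g s - g 0 = (s - 0) * g' \<xi>"
    using MVT2[of 0 s g g'] s g by (metis abs_of_nonneg less_eq_real_def order_le_less_trans)
  moreover have "g' \<xi> > 0" using e(2)[of \<xi>] calculation s z by auto
  ultimately have "g s > g 0" using s by (metis diff_gt_0_iff_gt diff_zero mult_pos_pos)
  with max[of s] s show False by auto
qed

text \<open>Adding \<epsilon>|x|^2 makes the Laplacian strictly positive. At an interior maximum
  every pure second derivative is nonpositive, so the perturbed function can only peak on the
  sphere.\<close>

lemma harmonic_max_principle_real: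
  fixes w :: "'a::euclidean_space \<Rightarrow> real"
  assumes h: "harmonic_on w (ball 0 1)" and c: "continuous_on (cball 0 1) w"
    and m: "\<And>x. norm x = 1 \<Longrightarrow> w x \<le> m" and x0: "x0 \<in> cball 0 1"
  shows "w x0 \<le> m"
proof (rule ccontr)
  assume "\<not> w x0 \<le> m"
  obtain D E where Jf: "harmonic_jet w D E (ball 0 1)"
    using h unfolding harmonic_on_jet by blast
  note f = harmonic_jetD[OF Jf]
  \<comment> \<open>Half the excess: on the sphere the perturbation adds only \<epsilon>, so the
    boundary values stay below \<open>w x0\<close>.\<close>
  define \<epsilon> where "\<epsilon> = (w x0 - m) / 2"
  have \<epsilon>: "\<epsilon> > 0" "w x0 > m + \<epsilon>" using \<open>\<not> w x0 \<le> m\<close> by (auto simp: \<epsilon>_def field_simps)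
  define v where "v = (\<lambda>x. w x + \<epsilon> * (x \<bullet> x))"
  have "continuous_on (cball 0 1) v" unfolding v_def by (intro continuous_intros c)
  then obtain y where y: "y \<in> cball 0 1" "\<And>z. z \<in> cball 0 1 \<Longrightarrow> v z \<le> v y"
    using continuous_attains_sup[of "cball 0 1 :: 'a set" v] by auto
  have "v y \<ge> w x0" using y(2)[OF x0] \<epsilon> by (simp add: v_def) (smt (verit) inner_ge_zero mult_nonneg_nonneg)
  have "norm y \<noteq> 1"
  proof
    assume "norm y = 1"
    then have "v y \<le> m + \<epsilon>" using m[of y] \<epsilon> by (simp add: v_def power2_norm_eq_inner[symmetric])
    with \<open>v y \<ge> w x0\<close> \<epsilon> show False by simp
  qed
  then have yb: "y \<in> ball 0 1" using y by (auto simp: dist_norm)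
  have "E b b y + 2 * \<epsilon> \<le> 0" if b: "b \<in> Basis" for b
  proof (rule second_derivative_local_max[where \<delta> = "1 - norm y" and g = "\<lambda>s. v (y + s *\<^sub>R b)"])
    have inb: "y + s *\<^sub>R b \<in> ball 0 1" if "\<bar>s\<bar> < 1 - norm y" for s
      using that norm_triangle_ineq[of y "s *\<^sub>R b"] b by auto
    show "1 - norm y > 0" using yb by simp
    have line: "((\<lambda>s. y + s *\<^sub>R b) has_derivative (\<lambda>h. h *\<^sub>R b)) (at s)" for s
      by (auto intro!: derivative_eq_intros)
    have coord: "(\<Sum>c\<in>Basis. ((h *\<^sub>R b) \<bullet> c) *\<^sub>R G c) = h * G b" for h and G :: "'a \<Rightarrow> real"
      using sum_coord_Basis[OF b, of G] by (simp add: mult.assoc flip: sum_distrib_left)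
    show "((\<lambda>s. v (y + s *\<^sub>R b)) has_real_derivative (D b (y + s *\<^sub>R b) + 2 * \<epsilon> * ((y \<bullet> b) + s))) (at s)"
      if "\<bar>s\<bar> < 1 - norm y" for s
    proof -
      have w': "((\<lambda>s. w (y + s *\<^sub>R b)) has_real_derivative D b (y + s *\<^sub>R b)) (at s)"
        using has_derivative_compose[OF line f(1)[OF inb[OF that]]] unfolding coord
        by (simp add: has_field_derivative_def mult.commute[of _ "D b _"])
      have q': "((\<lambda>s. \<epsilon> * (y \<bullet> y + 2 * s * (y \<bullet> b) + s * s)) has_real_derivative
          2 * \<epsilon> * ((y \<bullet> b) + s)) (at s)"
        by (auto intro!: derivative_eq_intros simp: algebra_simps)
      have eq: "(\<lambda>s. v (y + s *\<^sub>R b)) =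
          (\<lambda>s. w (y + s *\<^sub>R b) + \<epsilon> * (y \<bullet> y + 2 * s * (y \<bullet> b) + s * s))"
        unfolding v_def using b
        by (simp add: inner_add_left inner_add_right inner_commute[of b y] algebra_simps)
      show ?thesis unfolding eq by (rule DERIV_add[OF w' q'])
    qed
    have "((\<lambda>s. D b (y + s *\<^sub>R b)) has_real_derivative E b b y) (at 0)"
      using has_derivative_compose[OF line f(2)[OF b], of 0] yb unfolding coord
      by (simp add: has_field_derivative_def mult.commute[of _ "E b _ _"])
    then show "((\<lambda>s. D b (y + s *\<^sub>R b) + 2 * \<epsilon> * ((y \<bullet> b) + s)) has_real_derivative (E b b y + 2 * \<epsilon>)) (at 0)"
      by (auto intro!: derivative_eq_intros)
    show "v (y + s *\<^sub>R b) \<le> v (y + 0 *\<^sub>R b)" if "\<bar>s\<bar> < 1 - norm y" for s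
      using y(2)[of "y + s *\<^sub>R b"] inb[OF that] by auto
  qed
  then have "(\<Sum>b\<in>(Basis::'a set). E b b y + 2 * \<epsilon>) \<le> 0" by (rule sum_nonpos)
  then have "2 * \<epsilon> * DIM('a) \<le> 0" using f(4)[OF yb] by (simp add: sum.distrib)
  with \<epsilon> show False by (simp add: mult_le_0_iff)
qed

lemma harmonic_max_principle:
  fixes u :: "'a::euclidean_space \<Rightarrow> complex"
  assumes h: "harmonic_on u (ball 0 1)" and c: "continuous_on (cball 0 1) u"
    and m: "\<And>x. norm x = 1 \<Longrightarrow> norm (u x) \<le> m" and x0: "x0 \<in> cball 0 1"
  shows "norm (u x0) \<le> m"
proof (cases "u x0 = 0")
  case True
  \<comment> \<open>The bound at a single point of the sphere already gives 0 \<le> m.\<close>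
  obtain b :: 'a where "norm b = 1" using vector_choose_size[of 1] by auto
  with m[of b] True show ?thesis by (metis norm_ge_zero norm_zero order_trans)
next
  case False
  \<comment> \<open>A unimodular factor rotates \<open>u x0\<close> onto its modulus, which reduces
    the claim to a real part.\<close>
  define a where "a = cnj (u x0) / norm (u x0)"
  have a: "norm a = 1" using False by (simp add: a_def norm_divide)
  have L: "bounded_linear (\<lambda>z. Re (a * z))"
    by (intro bounded_linear_compose[OF bounded_linear_Re bounded_linear_mult_right])
  have "Re (a * u x0) \<le> m"
  proof (rule harmonic_max_principle_real[where w = "\<lambda>x. Re (a * u x)"])
    show "harmonic_on (\<lambda>x. Re (a * u x)) (ball 0 1)" by (rule harmonic_on_linear_image[OF L h])
    show "continuous_on (cball 0 1) (\<lambda>x. Re (a * u x))" by (intro continuous_intros c)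
    show "Re (a * u x) \<le> m" if "norm x = 1" for x
      using complex_Re_le_cmod[of "a * u x"] a m[OF that] by (simp add: norm_mult)
  qed (fact x0)
  moreover have "a * u x0 = norm (u x0)"
    using complex_norm_square[of "u x0"] False
    by (simp add: a_def field_simps power2_eq_square)
  ultimately show ?thesis by simp
qed

section \<open>Surface measure and polar coordinates\<close>

text \<open>Reflections serve in place of general rotations: the one along \<open>x - y\<close>
  exchanges two points of equal norm. For \<open>v = 0\<close> division by zero makes it the
  identity.\<close>

definition hyper_refl :: "'a::euclidean_space \<Rightarrow> 'a \<Rightarrow> 'a" where
  "hyper_refl v z = z - (2 * (z \<bullet> v) / (v \<bullet> v)) *\<^sub>R v"

lemma linear_hyper_refl: "linear (hyper_refl v)"
proof (rule linearI)
  show "hyper_refl v (x + y) = hyper_refl v x + hyper_refl v y" for x y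
    by (simp add: hyper_refl_def inner_add_left distrib_left add_divide_distrib scaleR_add_left)
  show "hyper_refl v (r *\<^sub>R x) = r *\<^sub>R hyper_refl v x" for r x
    by (simp add: hyper_refl_def scaleR_diff_right mult.left_commute)
qed

lemma inner_hyper_refl: "hyper_refl v y \<bullet> hyper_refl v z = y \<bullet> z"
proof -
  define a b where "a = 2 * (y \<bullet> v) / (v \<bullet> v)" and "b = 2 * (z \<bullet> v) / (v \<bullet> v)"
  have ab: "a * (v \<bullet> v) = 2 * (y \<bullet> v)" "b * (v \<bullet> v) = 2 * (z \<bullet> v)" by (auto simp: a_def b_def)
  have "hyper_refl v y \<bullet> hyper_refl v z = y \<bullet> z - b * (y \<bullet> v) - a * (z \<bullet> v) + a * (b * (v \<bullet> v))"
    unfolding hyper_refl_def a_def[symmetric] b_def[symmetric]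
    by (simp add: inner_diff_left inner_diff_right inner_commute[of v z] right_diff_distrib)
  also have "a * (b * (v \<bullet> v)) = 2 * a * (z \<bullet> v)" by (simp add: ab)
  also have "b * (y \<bullet> v) = a * (z \<bullet> v)" by (simp add: a_def b_def)
  finally show ?thesis by simp
qed

lemma hyper_refl_invol [simp]: "hyper_refl v (hyper_refl v z) = z"
proof -
  have "hyper_refl v v = (if v = 0 then v else - v)"
    by (simp add: hyper_refl_def scaleR_2)
  then have "(hyper_refl v z) \<bullet> v = (if v = 0 then 0 else - (z \<bullet> v))"
    using inner_hyper_refl[of v z v] by (auto split: if_splits)
  then show ?thesis unfolding hyper_refl_def[of v "hyper_refl v z"] by (simp add: hyper_refl_def[of v z])
qed

lemma norm_hyper_refl [simp]: "norm (hyper_refl v z) = norm z"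
  by (simp add: norm_eq_sqrt_inner inner_hyper_refl)

lemma hyper_refl_swap:
  assumes "norm x = norm y"
  shows "hyper_refl (x - y) x = y"
proof (cases "x = y")
  case False
  have "x \<bullet> x = y \<bullet> y" using assms by (simp add: norm_eq_sqrt_inner)
  then have eq: "2 * (x \<bullet> (x - y)) = (x - y) \<bullet> (x - y)"
    by (simp add: inner_diff_left inner_diff_right inner_commute)
  have "(x - y) \<bullet> (x - y) \<noteq> 0" using False by simp
  then have "2 * (x \<bullet> (x - y)) / ((x - y) \<bullet> (x - y)) = 1" unfolding eq by (rule divide_self)
  then have "hyper_refl (x - y) x = x - 1 *\<^sub>R (x - y)" by (simp only: hyper_refl_def)
  then show ?thesis by simp
qed (simp add: hyper_refl_def)

lemma borel_measurable_hyper_refl [measurable]: "hyper_refl v \<in> borel_measurable borel"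
  unfolding hyper_refl_def [abs_def] by measurable

lemma hyper_refl_sgn: "sgn (hyper_refl v x) = hyper_refl v (sgn x)"
  by (simp add: sgn_div_norm linear_cmul[OF linear_hyper_refl])

lemma nn_integral_lborel_translate:
  fixes f :: "'a::euclidean_space \<Rightarrow> ennreal"
  assumes [measurable]: "f \<in> borel_measurable borel"
  shows "(\<integral>\<^sup>+x. f (c + x) \<partial>lborel) = (\<integral>\<^sup>+x. f x \<partial>lborel)"
  by (subst lborel_distr_plus[symmetric, of c], subst nn_integral_distr) auto

text \<open>
  Lebesgue measure is, up to a factor, the only translation invariant measure, so its image under a
  reflection is determined by the measure of the unit ball.
\<close>
lemma lborel_distr_hyper_refl: "distr lborel borel (hyper_refl v) = (lborel :: 'a::euclidean_space measure)"
proof (rule measure_eqI)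
  fix A assume "A \<in> sets (distr lborel borel (hyper_refl v))"
  then have A [measurable]: "A \<in> sets borel" by simp
  let ?T = "hyper_refl v" and ?B = "ball 0 1 :: 'a set"
  have B [measurable]: "?B \<in> sets borel" by simp
  let ?\<mu> = "emeasure (distr lborel borel ?T) A"
  have \<mu>: "?\<mu> = (\<integral>\<^sup>+x. indicator A (?T x) \<partial>lborel)"
    by (subst nn_integral_indicator[symmetric], simp, subst nn_integral_distr) auto
  have in1: "(\<integral>\<^sup>+x. indicator A (?T x + y) \<partial>lborel) = ?\<mu>" for y
  proof -
    have "?T x + y = ?T (?T y + x)" for x
      by (simp add: linear_add[OF linear_hyper_refl] add.commute)
    then have "(\<integral>\<^sup>+x. indicator A (?T x + y) \<partial>lborel) = (\<integral>\<^sup>+x. indicator A (?T (?T y + x)) \<partial>lborel)"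
      by simp
    also have "\<dots> = ?\<mu>" unfolding \<mu> by (rule nn_integral_lborel_translate) measurable
    finally show ?thesis .
  qed
  have in2: "(\<integral>\<^sup>+x. indicator ?B (y - ?T x) \<partial>lborel) = emeasure lborel ?B" for y
  proof -
    have "indicator ?B (y - ?T x) = (indicator ?B (- ?T y + x) :: ennreal)" for x
    proof -
      have "norm (y - ?T x) = norm (?T (?T y - x))"
        using linear_diff[OF linear_hyper_refl, of v "?T y" x] by simp
      then have "norm (y - ?T x) = norm (- ?T y + x)" by (simp add: norm_minus_commute)
      then show ?thesis by (auto simp: indicator_def)
    qed
    then have "(\<integral>\<^sup>+x. indicator ?B (y - ?T x) \<partial>lborel) = (\<integral>\<^sup>+x. indicator ?B (- ?T y + x) \<partial>lborel)"
      by simp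
    also have "\<dots> = (\<integral>\<^sup>+x. indicator ?B x \<partial>lborel)" by (rule nn_integral_lborel_translate) measurable
    finally show ?thesis by simp
  qed
  \<comment> \<open>The same double integral is evaluated twice. For fixed \<open>y\<close> the
    inner integral is \<open>?\<mu>\<close> by translation invariance; after Fubini and a shift of
    \<open>y\<close> by \<open>?T x\<close>, the factor \<open>indicator A y\<close> splits off and
    the volume of the ball remains.\<close>
  have "?\<mu> * emeasure lborel ?B = (\<integral>\<^sup>+y. \<integral>\<^sup>+x. indicator ?B y * indicator A (?T x + y) \<partial>lborel \<partial>lborel)"
    by (subst nn_integral_cmult, measurable) (simp add: in1 nn_integral_multc mult.commute)
  also have "\<dots> = (\<integral>\<^sup>+x. \<integral>\<^sup>+y. indicator ?B y * indicator A (?T x + y) \<partial>lborel \<partial>lborel)"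
    by (rule lborel_pair.Fubini') measurable
  also have "\<dots> = (\<integral>\<^sup>+x. \<integral>\<^sup>+y. indicator ?B (y - ?T x) * indicator A y \<partial>lborel \<partial>lborel)"
  proof (rule nn_integral_cong)
    fix x
    have "(\<integral>\<^sup>+y. indicator ?B (y - ?T x) * indicator A y \<partial>lborel) =
        (\<integral>\<^sup>+y. indicator ?B ((?T x + y) - ?T x) * indicator A (?T x + y) \<partial>lborel)"
      by (rule nn_integral_lborel_translate[symmetric]) measurable
    then show "(\<integral>\<^sup>+y. indicator ?B y * indicator A (?T x + y) \<partial>lborel) =
        (\<integral>\<^sup>+y. indicator ?B (y - ?T x) * indicator A y \<partial>lborel)" by simp
  qed
  also have "\<dots> = (\<integral>\<^sup>+y. \<integral>\<^sup>+x. indicator ?B (y - ?T x) * indicator A y \<partial>lborel \<partial>lborel)"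
    by (rule lborel_pair.Fubini') measurable
  also have "\<dots> = (\<integral>\<^sup>+y. emeasure lborel ?B * indicator A y \<partial>lborel)"
    by (rule nn_integral_cong, subst nn_integral_multc, measurable) (simp only: in2)
  also have "\<dots> = emeasure lborel ?B * emeasure lborel A"
    by (rule nn_integral_cmult_indicator) (use A in simp)
  finally have eq: "?\<mu> * emeasure lborel ?B = emeasure lborel ?B * emeasure lborel A" .
  have "emeasure lborel ?B \<noteq> 0" "emeasure lborel ?B \<noteq> \<infinity>"
    using content_ball_pos[of 1 "0::'a"] emeasure_lborel_ball_finite[of "0::'a" 1]
    by (auto simp: measure_def)
  with eq show "?\<mu> = emeasure lborel A"
    by (simp add: ennreal_mult_cancel_left mult.commute[of _ "emeasure lborel ?B"])
qed simp

lemma sets_sphere_measure [simp, measurable_cong]: "sets (sphere_measure :: 'a::euclidean_space measure) = sets borel"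
  by (simp add: sphere_measure_def)

lemma space_sphere_measure [simp]: "space (sphere_measure :: 'a::euclidean_space measure) = UNIV"
  by (simp add: sphere_measure_def space_scale_measure)

lemma emeasure_sphere_measure:
  assumes [measurable]: "A \<in> sets (borel :: 'a::euclidean_space measure)"
  shows "emeasure (sphere_measure :: 'a::euclidean_space measure) A = of_nat DIM('a) * emeasure lborel {x \<in> ball 0 1. sgn x \<in> A}"
proof -
  have m: "sgn \<in> restrict_space lborel (ball 0 1) \<rightarrow>\<^sub>M (borel :: 'a measure)"
    by (intro measurable_restrict_space1) simp
  have "emeasure (distr (restrict_space lborel (ball 0 1)) borel sgn) A =
      emeasure (restrict_space lborel (ball 0 1)) {x \<in> ball 0 1. sgn x \<in> A}"
    by (subst emeasure_distr[OF m]) (auto simp: space_restrict_space intro!: arg_cong2[where f=emeasure])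
  also have "\<dots> = emeasure lborel {x \<in> ball 0 1. sgn x \<in> A}"
    by (subst emeasure_restrict_space) auto
  finally show ?thesis by (simp add: sphere_measure_def)
qed

lemma finite_measure_sphere_measure: "finite_measure (sphere_measure :: 'a::euclidean_space measure)"
proof
  have "emeasure (sphere_measure :: 'a::euclidean_space measure) UNIV = of_nat DIM('a) * emeasure lborel (ball (0::'a) 1)"
    by (subst emeasure_sphere_measure) (simp_all add: ball_def)
  then show "emeasure (sphere_measure :: 'a::euclidean_space measure) (space (sphere_measure :: 'a measure)) \<noteq> \<infinity>"
    using emeasure_lborel_ball_finite[of "0::'a" 1]
    by (auto simp: ennreal_mult_eq_top_iff)
qed

lemma AE_sphere_measure: "AE x in (sphere_measure :: 'a::euclidean_space measure). norm x = 1"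
proof (rule AE_I')
  have "emeasure (sphere_measure :: 'a::euclidean_space measure) {x. norm x \<noteq> 1} = of_nat DIM('a) * emeasure lborel {x\<in>ball (0::'a) 1. norm (sgn x) \<noteq> 1}"
    by (subst emeasure_sphere_measure) auto
  also have "{x\<in>ball (0::'a) 1. norm (sgn x) \<noteq> 1} = {0}" by (auto simp: norm_sgn)
  finally show "{x. norm x \<noteq> 1} \<in> null_sets (sphere_measure :: 'a::euclidean_space measure)" by (intro null_setsI) auto
qed auto

text \<open>\<open>sgn\<close> commutes with the reflection and the ball is invariant, so the
  invariance of Lebesgue measure passes to cones.\<close>

lemma sphere_measure_distr_hyper_refl: "distr (sphere_measure :: 'a::euclidean_space measure) borel (hyper_refl v) = (sphere_measure :: 'a measure)"
proof (rule measure_eqI)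
  fix A assume "A \<in> sets (distr (sphere_measure :: 'a::euclidean_space measure) borel (hyper_refl v))"
  then have [measurable]: "A \<in> sets borel" by simp
  have "emeasure (distr (sphere_measure :: 'a::euclidean_space measure) borel (hyper_refl v)) A = emeasure (sphere_measure :: 'a measure) (hyper_refl v -` A)"
    by (subst emeasure_distr) auto
  also have "\<dots> = of_nat DIM('a) * emeasure lborel {x \<in> ball 0 1. hyper_refl v (sgn x) \<in> A}"
    using measurable_sets_borel[OF borel_measurable_hyper_refl, of A v]
    by (subst emeasure_sphere_measure) auto
  also have "emeasure lborel {x \<in> ball 0 1. hyper_refl v (sgn x) \<in> A} =
      emeasure (distr lborel borel (hyper_refl v)) {x \<in> ball 0 1. sgn x \<in> A}"
    by (subst emeasure_distr) (auto simp: hyper_refl_sgn intro!: arg_cong2[where f=emeasure])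
  also have "of_nat DIM('a) * \<dots> = emeasure (sphere_measure :: 'a::euclidean_space measure) A"
    by (simp add: lborel_distr_hyper_refl emeasure_sphere_measure)
  finally show "emeasure (distr (sphere_measure :: 'a::euclidean_space measure) borel (hyper_refl v)) A = emeasure (sphere_measure :: 'a measure) A" .
qed simp

section \<open>Polar coordinates\<close>

definition radial_measure :: "nat \<Rightarrow> real measure" where
  "radial_measure n = density lborel (\<lambda>r. ennreal (r ^ (n - 1)) * indicator {0..1} r)"

lemma sets_radial_measure [simp, measurable_cong]: "sets (radial_measure n) = sets borel"
  by (simp add: radial_measure_def)

lemma space_radial_measure [simp]: "space (radial_measure n) = UNIV"
  by (simp add: radial_measure_def)

lemma emeasure_radial_measure:
  assumes n: "n \<ge> 1"
  shows "emeasure (radial_measure n) {a<..} = ennreal ((1 - min 1 (max 0 a) ^ n) / n)"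
proof -
  define a' where "a' = min 1 (max 0 a)"
  have a': "0 \<le> a'" "a' \<le> 1" by (auto simp: a'_def)
  have "emeasure (radial_measure n) {a<..} =
      (\<integral>\<^sup>+r. ennreal (r ^ (n - 1)) * indicator {0..1} r * indicator {a<..} r \<partial>lborel)"
    unfolding radial_measure_def by (subst emeasure_density) auto
  also have "\<dots> = (\<integral>\<^sup>+r. ennreal (r ^ (n - 1)) * indicator {a'..1} r \<partial>lborel)"
  proof (rule nn_integral_cong_AE)
    have "AE r in lborel. r \<noteq> a' \<and> r \<noteq> (1::real)"
      using AE_lborel_singleton[of a'] AE_lborel_singleton[of "1::real"] by auto
    then show "AE r in lborel. ennreal (r ^ (n - 1)) * indicator {0..1} r * indicator {a<..} r =
        ennreal (r ^ (n - 1)) * indicator {a'..1} r"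
      by eventually_elim (auto simp: a'_def indicator_def min_def max_def split: if_splits)
  qed
  also have "\<dots> = ennreal (1 ^ n / n - a' ^ n / n)"
    using n a' by (intro nn_integral_FTC_Icc) (auto intro!: derivative_eq_intros simp: field_simps)
  finally show ?thesis by (simp add: a'_def diff_divide_distrib)
qed

lemma finite_measure_radial_measure:
  assumes "n \<ge> 1" shows "finite_measure (radial_measure n)"
proof
  have "emeasure (radial_measure n) UNIV \<le> emeasure (radial_measure n) {-1<..} + emeasure (radial_measure n) {..-1}"
    by (rule order_trans[OF _ emeasure_subadditive]) (auto intro!: emeasure_mono)
  also have "emeasure (radial_measure n) {..-1} = nn_integral lborel (\<lambda>r::real. 0)"
    unfolding radial_measure_def
    by (subst emeasure_density, simp, simp, intro nn_integral_cong) (auto simp: indicator_def)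
  finally show "emeasure (radial_measure n) (space (radial_measure n)) \<noteq> \<infinity>"
    using emeasure_radial_measure[OF assms, of "-1"] by (auto simp: top_unique)
qed

text \<open>\<open>sgn\<close> is constant on rays, so a truncated cone is a dilate of the full one
  up to a null sphere.\<close>

lemma emeasure_cone_dilate:
  fixes B :: "'a::euclidean_space set"
  assumes a: "0 < a" and B [measurable]: "B \<in> sets borel"
  shows "emeasure lborel {x. norm x \<le> a \<and> sgn x \<in> B} =
    ennreal (a ^ DIM('a)) * emeasure lborel {x \<in> ball 0 1. sgn x \<in> B}"
proof -
  let ?X = "{x::'a. norm x \<le> a \<and> sgn x \<in> B}"
  have m: "?X \<in> sets borel" by measurable
  have "emeasure lborel ?X = emeasure (density (distr lborel borel (\<lambda>x::'a. 0 + a *\<^sub>R x)) (\<lambda>_. \<bar>a\<bar>^DIM('a))) ?X"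
    using lborel_affine[of a "0::'a"] a by simp
  also have "\<dots> = ennreal (a ^ DIM('a)) * emeasure lborel {x::'a. a *\<^sub>R x \<in> ?X}"
    using a m by (subst emeasure_density_const) (auto simp: emeasure_distr vimage_def)
  also have "{x::'a. a *\<^sub>R x \<in> ?X} = {x. norm x \<le> 1 \<and> sgn x \<in> B}"
    using a by (auto simp: sgn_scaleR)
  also have "emeasure lborel {x::'a. norm x \<le> 1 \<and> sgn x \<in> B} = emeasure lborel {x \<in> ball 0 1. sgn x \<in> B}"
  proof (rule emeasure_eq_AE)
    have "sphere (0::'a) 1 \<in> null_sets lborel"
      using negligible_sphere[of "0::'a" 1] by (auto simp: negligible_iff_null_sets null_sets_def)
    from AE_not_in[OF this]
    show "AE x in lborel. x \<in> {x::'a. norm x \<le> 1 \<and> sgn x \<in> B} \<longleftrightarrow> x \<in> {x \<in> ball 0 1. sgn x \<in> B}"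
      by eventually_elim auto
  qed measurable
  finally show ?thesis .
qed

text \<open>For a fixed set \<open>B\<close> of directions, the distribution of the norm on the cone
  over \<open>B\<close> is a multiple of \<open>radial_measure\<close>. It suffices to compare the
  tails \<open>{a<..}\<close>, which the scaling of cones computes.\<close>

theorem polar_measure:
  "radial_measure DIM('a) \<Otimes>\<^sub>M (sphere_measure :: 'a::euclidean_space measure) =
    distr (restrict_space lborel (ball 0 1)) (borel \<Otimes>\<^sub>M borel) (\<lambda>x::'a::euclidean_space. (norm x, sgn x))"
    (is "?R \<Otimes>\<^sub>M _ = ?M")
proof (rule pair_measure_eqI)
  let ?n = "DIM('a)"
  have n: "?n \<ge> 1" by (simp add: Suc_leI)
  interpret R: finite_measure ?R by (rule finite_measure_radial_measure[OF n])
  interpret S: finite_measure "sphere_measure :: 'a measure" by (rule finite_measure_sphere_measure)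
  show "sigma_finite_measure ?R" "sigma_finite_measure (sphere_measure :: 'a::euclidean_space measure)" by unfold_locales
  show "sets (?R \<Otimes>\<^sub>M (sphere_measure :: 'a::euclidean_space measure)) = sets ?M" by (simp cong: sets_pair_measure_cong)
  fix A B assume "A \<in> sets ?R" "B \<in> sets (sphere_measure :: 'a::euclidean_space measure)"
  then have A: "A \<in> sets borel" and B [measurable]: "B \<in> sets borel" by auto
  let ?C = "{x \<in> ball 0 1. sgn x \<in> B}"
  have m: "(\<lambda>x::'a. (norm x, sgn x)) \<in> restrict_space lborel (ball 0 1) \<rightarrow>\<^sub>M borel \<Otimes>\<^sub>M borel"
    by (intro measurable_restrict_space1) simp
  have prod: "emeasure ?M (A \<times> B) = emeasure lborel {x \<in> ?C. norm x \<in> A}" if [measurable]: "A \<in> sets borel" for A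
  proof -
    have "emeasure ?M (A \<times> B) = emeasure (restrict_space lborel (ball 0 1)) {x \<in> ?C. norm x \<in> A}"
      by (subst emeasure_distr[OF m]) (auto simp: space_restrict_space intro!: arg_cong2[where f=emeasure])
    also have "\<dots> = emeasure lborel {x \<in> ?C. norm x \<in> A}"
      by (subst emeasure_restrict_space) auto
    finally show ?thesis .
  qed
  define \<nu> where "\<nu> = distr (restrict_space lborel ?C) borel (norm :: 'a \<Rightarrow> real)"
  have \<nu>: "emeasure \<nu> A = emeasure lborel {x \<in> ?C. norm x \<in> A}" if [measurable]: "A \<in> sets borel" for A
  proof -
    have "norm \<in> restrict_space lborel ?C \<rightarrow>\<^sub>M borel" by (intro measurable_restrict_space1) simp
    then have "emeasure \<nu> A = emeasure (restrict_space lborel ?C) {x \<in> ?C. norm x \<in> A}"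
      unfolding \<nu>_def
      by (subst emeasure_distr) (auto simp: space_restrict_space intro!: arg_cong2[where f=emeasure])
    also have "\<dots> = emeasure lborel {x \<in> ?C. norm x \<in> A}"
      by (subst emeasure_restrict_space) auto
    finally show ?thesis .
  qed
  have Cfin: "emeasure lborel X < \<infinity>" if "X \<subseteq> ball (0::'a) 1" for X
    using emeasure_mono[OF that, of lborel] emeasure_lborel_ball_finite[of "0::'a" 1]
    by (simp add: order.strict_trans1)
  have "emeasure lborel ?C < \<infinity>" by (rule Cfin) auto
  then obtain c where c: "emeasure lborel ?C = ennreal c" "c \<ge> 0"
    by (cases "emeasure lborel ?C") auto
  have "\<nu> = scale_measure (emeasure (sphere_measure :: 'a::euclidean_space measure) B) ?R"
  proof (rule measure_eqI_lessThan)
    show "emeasure \<nu> {x<..} < \<infinity>" for x by (subst \<nu>, simp, rule Cfin) auto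
    fix a :: real
    \<comment> \<open>Clamping to [0, 1] covers every real \<open>a\<close>: only a null set is
      removed for a \<le> 0, and everything for a \<ge> 1.\<close>
    define a' where "a' = min 1 (max 0 a)"
    have a': "0 \<le> a'" "a' \<le> 1" by (auto simp: a'_def)
    have X: "emeasure lborel {x \<in> ?C. norm x \<le> a'} = ennreal (a' ^ ?n * c)"
    proof -
      \<comment> \<open>The dilation lemma fits 0 < a' < 1 only: at 0 the set is at most a point,
        and at 1 the open ball has to be used instead of the closed one.\<close>
      consider "a' = 0" | "0 < a'" "a' < 1" | "a' = 1" using a' by linarith
      then show ?thesis
      proof cases
        case 1
        have "emeasure lborel {x \<in> ?C. norm x \<le> a'} \<le> emeasure lborel {0::'a}"
          by (rule emeasure_mono) (auto simp: 1)
        with 1 n show ?thesis by (simp add: power_0_left)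
      next
        case 2
        have "{x \<in> ?C. norm x \<le> a'} = {x. norm x \<le> a' \<and> sgn x \<in> B}" using 2 by auto
        then show ?thesis using emeasure_cone_dilate[OF 2(1) B] c 2 by (simp add: ennreal_mult)
      next
        case 3
        then have "{x \<in> ?C. norm x \<le> a'} = ?C" by auto
        with c 3 show ?thesis by simp
      qed
    qed
    have "emeasure \<nu> {a<..} = emeasure lborel ({x \<in> ?C. norm x > a})"
      by (subst \<nu>) (auto intro!: arg_cong2[where f=emeasure])
    also have "\<dots> = emeasure lborel (?C - {x \<in> ?C. norm x \<le> a'})"
    proof (rule emeasure_eq_AE)
      show "AE x in lborel. x \<in> {x \<in> ?C. norm x > a} \<longleftrightarrow> x \<in> ?C - {x \<in> ?C. norm x \<le> a'}"
        using AE_lborel_singleton[of "0::'a"]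
      proof eventually_elim
        case (elim x)
        then show ?case using norm_ge_zero[of x] by (auto simp: a'_def min_def max_def not_le intro: less_le_trans[OF _ norm_ge_zero] split: if_splits)
      qed
    qed measurable
    also have "\<dots> = ennreal c - ennreal (a' ^ ?n * c)"
    proof (subst emeasure_Diff)
      show "emeasure lborel {x \<in> ?C. norm x \<le> a'} \<noteq> \<infinity>" unfolding X by simp
      show "emeasure lborel ?C - emeasure lborel {x \<in> ?C. norm x \<le> a'} = ennreal c - ennreal (a' ^ ?n * c)"
        unfolding X c ..
    qed (measurable, auto)
    also have "\<dots> = emeasure (scale_measure (emeasure (sphere_measure :: 'a::euclidean_space measure) B) ?R) {a<..}"
    proof -
      have "ennreal c - ennreal (a' ^ ?n * c) = ennreal (c - a' ^ ?n * c)"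
        by (rule ennreal_minus) (use c a' in simp)
      also have "c - a' ^ ?n * c = (real ?n * c) * ((1 - a' ^ ?n) / ?n)" using n by (simp add: field_simps)
      also have "ennreal \<dots> = (ennreal (real ?n) * ennreal c) * ennreal ((1 - a' ^ ?n) / ?n)"
      proof -
        have "0 \<le> (1 - a' ^ ?n) / ?n" using a' by (simp add: power_le_one)
        then show ?thesis using c by (simp only: ennreal_mult of_nat_0_le_iff mult_nonneg_nonneg)
      qed
      also have "\<dots> = emeasure (scale_measure (emeasure (sphere_measure :: 'a measure) B) ?R) {a<..}"
        by (simp only: emeasure_scale_measure emeasure_radial_measure[OF n] emeasure_sphere_measure[OF B]
            c a'_def ennreal_of_nat_eq_real_of_nat)
      finally show ?thesis .
    qed
    finally show "emeasure \<nu> {a<..} = emeasure (scale_measure (emeasure (sphere_measure :: 'a::euclidean_space measure) B) ?R) {a<..}" .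
  qed (simp_all add: \<nu>_def)
  then show "emeasure ?R A * emeasure (sphere_measure :: 'a::euclidean_space measure) B = emeasure ?M (A \<times> B)"
    using prod[OF A] \<nu>[OF A] by (simp add: mult.commute)
qed

section \<open>The Poisson integral\<close>

text \<open>The sphere itself is the underlying space here, so continuity on the sphere alone yields
  measurability and integrability.\<close>

definition sph :: "'a::euclidean_space measure" where
  "sph = restrict_space sphere_measure (sphere 0 1)"

definition sph_area :: "'a::euclidean_space itself \<Rightarrow> real" where
  "sph_area _ = measure (sph :: 'a measure) (sphere 0 1)"

lemma space_sph [simp]: "space (sph :: 'a::euclidean_space measure) = sphere 0 1"
  by (simp add: sph_def space_restrict_space)

lemma sets_sph: "sets (sph :: 'a::euclidean_space measure) = sets (restrict_space borel (sphere 0 1))"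
  by (simp add: sph_def sets_restrict_space)

lemma finite_measure_sph: "finite_measure (sph :: 'a::euclidean_space measure)"
  unfolding sph_def by (intro finite_measure_restrict_space finite_measure_sphere_measure) simp

interpretation sph: finite_measure "sph :: 'a::euclidean_space measure"
  by (rule finite_measure_sph)

lemma nn_integral_sphere_measure:
  "(\<integral>\<^sup>+z. f z \<partial>sphere_measure) = (\<integral>\<^sup>+z. f z \<partial>(sph :: 'a::euclidean_space measure))"
proof -
  have "(\<integral>\<^sup>+z. f z \<partial>(sph :: 'a measure)) = (\<integral>\<^sup>+z. f z * indicator (sphere 0 1) z \<partial>sphere_measure)"
    unfolding sph_def by (rule nn_integral_restrict_space) simp
  also have "\<dots> = (\<integral>\<^sup>+z. f z \<partial>sphere_measure)"
    by (rule nn_integral_cong_AE) (use AE_sphere_measure[where 'a='a] in eventually_elim, simp)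
  finally show ?thesis ..
qed

lemma integral_sphere_measure:
  fixes f :: "'a::euclidean_space \<Rightarrow> 'b::{banach, second_countable_topology}"
  assumes [measurable]: "f \<in> borel_measurable borel"
  shows "(LINT z|sphere_measure. f z) = (LINT z|sph. f z)"
proof -
  have "(LINT z|sph. f z) = (LINT z|sphere_measure. indicator (sphere 0 1) z *\<^sub>R f z)"
    unfolding sph_def by (rule integral_restrict_space) simp
  also have "\<dots> = (LINT z|sphere_measure. f z)"
  proof (rule integral_cong_AE)
    have "sphere (0::'a) 1 \<in> sets borel" by simp
    then show "(\<lambda>z. indicator (sphere 0 1) z *\<^sub>R f z) \<in> borel_measurable sphere_measure" by measurable
    show "AE z in sphere_measure. indicator (sphere 0 1) z *\<^sub>R f z = f z"
      using AE_sphere_measure[where 'a='a] by eventually_elim simp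
  qed measurable
  finally show ?thesis ..
qed

lemma sph_area_pos: "sph_area TYPE('a::euclidean_space) > 0"
proof -
  have "emeasure (sph :: 'a measure) (sphere 0 1) = (\<integral>\<^sup>+z. 1 \<partial>(sph :: 'a measure))" by simp
  also have "\<dots> = (\<integral>\<^sup>+z. 1 \<partial>(sphere_measure :: 'a measure))" by (rule nn_integral_sphere_measure[symmetric])
  also have "\<dots> = emeasure (sphere_measure :: 'a measure) UNIV" by simp
  also have "\<dots> = of_nat DIM('a) * emeasure lborel (ball (0::'a) 1)"
    by (subst emeasure_sphere_measure) (simp_all add: ball_def)
  also have "\<dots> \<noteq> 0"
    using content_ball_pos[of 1 "0::'a"] by (auto simp: measure_def)
  finally show ?thesis
    by (simp add: sph_area_def sph.emeasure_eq_measure zero_less_measure_iff)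
qed

lemma borel_measurable_sph_continuous:
  "continuous_on (sphere 0 1) g \<Longrightarrow> g \<in> borel_measurable (sph :: 'a::euclidean_space measure)"
  by (subst measurable_cong_sets[OF sets_sph refl]) (rule borel_measurable_continuous_on_restrict)

lemma integrable_sph_continuous:
  fixes g :: "'a::euclidean_space \<Rightarrow> 'b::{banach, second_countable_topology}"
  assumes "continuous_on (sphere 0 1) g"
  shows "integrable sph g"
proof -
  have "compact (g ` sphere 0 1)" using assms by (intro compact_continuous_image) auto
  then obtain B where B: "\<And>z. z \<in> sphere 0 1 \<Longrightarrow> norm (g z) \<le> B"
    using compact_imp_bounded[of "g ` sphere 0 1"] unfolding bounded_iff by (metis imageI)
  show ?thesis
    by (rule sph.integrable_const_bound[of _ B])
      (use B borel_measurable_sph_continuous[OF assms] in auto)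
qed

lemma norm_integral_sph_le:
  fixes g :: "'a::euclidean_space \<Rightarrow> 'b::{banach, second_countable_topology}"
  assumes g: "continuous_on (sphere 0 1) g" and le: "\<And>z. z \<in> sphere 0 1 \<Longrightarrow> norm (g z) \<le> B"
  shows "norm (LINT z|sph. g z) \<le> B * sph_area TYPE('a)"
proof -
  have "norm (LINT z|sph. g z) \<le> (LINT z|sph. norm (g z))" by (rule integral_norm_bound)
  also have "\<dots> \<le> (LINT z|(sph :: 'a measure). B)"
    using le by (intro integral_mono integrable_norm integrable_sph_continuous[OF g]) auto
  finally show ?thesis by (simp add: sph_area_def mult.commute)
qed

section \<open>Parameter integrals over the sphere\<close>

lemma continuous_on_slice:
  assumes "continuous_on (S \<times> T) (\<lambda>(x, z). g x z)" "x \<in> S"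
  shows "continuous_on T (g x)"
proof -
  have "continuous_on T (\<lambda>z. (\<lambda>(x, z). g x z) (x, z))"
    by (rule continuous_on_compose2[OF assms(1)]) (use assms(2) in \<open>auto intro!: continuous_intros\<close>)
  then show ?thesis by simp
qed

text \<open>Compactness of the sphere makes the continuity in \<open>x\<close> uniform in
  \<open>z\<close>.\<close>

lemma continuous_on_integral_sph:
  fixes g :: "'a::euclidean_space \<Rightarrow> 'a \<Rightarrow> complex"
  assumes g: "continuous_on (S \<times> sphere 0 1) (\<lambda>(x, z). g x z)"
  shows "continuous_on S (\<lambda>x. LINT z|sph. g x z)"
proof (rule continuous_onI)
  fix x0 :: 'a and e :: real assume x0: "x0 \<in> S" and e: "0 < e"
  let ?w = "sph_area TYPE('a)"
  have "e / ?w > 0" using e sph_area_pos[where 'a='a] by simp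
  from continuous_on_prod_compactE[OF g compact_sphere x0 this]
  obtain X where X: "x0 \<in> X" "open X"
    and le: "\<And>x z. x \<in> X \<inter> S \<Longrightarrow> z \<in> sphere 0 1 \<Longrightarrow> dist (g x z) (g x0 z) \<le> e / ?w"
    by (metis case_prod_conv)
  obtain d where d: "d > 0" "ball x0 d \<subseteq> X" using X openE by blast
  have "dist (LINT z|sph. g x z) (LINT z|sph. g x0 z) \<le> e" if x: "x \<in> S" "dist x x0 < d" for x
  proof -
    have c: "continuous_on (sphere 0 1) (g x)" "continuous_on (sphere 0 1) (g x0)"
      using continuous_on_slice[OF g] x x0 by auto
    have "x \<in> X \<inter> S" using d x by (auto simp: dist_commute)
    then have "norm (LINT z|sph. g x z - g x0 z) \<le> e / ?w * ?w"
      using le by (intro norm_integral_sph_le continuous_intros c) (auto simp: dist_norm)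
    then show ?thesis
      using sph_area_pos[where 'a='a] c by (simp add: dist_norm integrable_sph_continuous)
  qed
  then show "\<exists>d>0. \<forall>x'\<in>S. dist x' x0 < d \<longrightarrow> dist (LINT z|sph. g x' z) (LINT z|sph. g x0 z) \<le> e"
    using d by blast
qed

text \<open>By the mean value inequality the remainder of the linearisation is at most a small
  multiple of |x - x0|, uniformly in \<open>z\<close> by compactness, so it survives
  integration.\<close>

lemma has_derivative_integral_sph:
  fixes g :: "'a::euclidean_space \<Rightarrow> 'a \<Rightarrow> complex"
  assumes S: "open S" "x0 \<in> S"
    and g: "continuous_on (S \<times> sphere 0 1) (\<lambda>(x, z). g x z)"
    and D: "\<And>b. b \<in> Basis \<Longrightarrow> continuous_on (S \<times> sphere 0 1) (\<lambda>(x, z). D b x z)"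
    and der: "\<And>x z. x \<in> S \<Longrightarrow> z \<in> sphere 0 1 \<Longrightarrow>
        ((\<lambda>x. g x z) has_derivative (\<lambda>h. \<Sum>b\<in>Basis. (h \<bullet> b) *\<^sub>R D b x z)) (at x)"
  shows "((\<lambda>x. LINT z|sph. g x z) has_derivative
           (\<lambda>h. \<Sum>b\<in>Basis. (h \<bullet> b) *\<^sub>R (LINT z|sph. D b x0 z))) (at x0)"
  unfolding has_derivative_at_alt
proof (intro conjI allI impI)
  show "bounded_linear (\<lambda>h. \<Sum>b\<in>Basis. (h \<bullet> b) *\<^sub>R (LINT z|sph. D b x0 z))"
    by (intro bounded_linear_sum bounded_linear_scaleR_const bounded_linear_inner_left)
  fix e :: real assume e: "0 < e"
  let ?w = "sph_area TYPE('a)"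
  let ?n = "real DIM('a)"
  \<comment> \<open>Each of the \<open>?n\<close> partial derivatives may vary by \<eta>, and
    integration multiplies by the mass \<open>?w\<close>; together this gives
    \<open>e\<close>.\<close>
  define \<eta> where "\<eta> = e / (?w * ?n)"
  have \<eta>: "\<eta> > 0" using e sph_area_pos[where 'a='a] by (simp add: \<eta>_def)
  have "\<exists>d>0. \<forall>x z. dist x x0 < d \<longrightarrow> x \<in> S \<longrightarrow> z \<in> sphere 0 1 \<longrightarrow> norm (D b x z - D b x0 z) \<le> \<eta>"
    if "b \<in> Basis" for b
  proof -
    from continuous_on_prod_compactE[OF D[OF that] compact_sphere S(2) \<eta>]
    obtain X where X: "x0 \<in> X" "open X"
      and le: "\<And>x z. x \<in> X \<inter> S \<Longrightarrow> z \<in> sphere 0 1 \<Longrightarrow> dist (D b x z) (D b x0 z) \<le> \<eta>"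
      by (metis case_prod_conv)
    obtain d where "d > 0" "ball x0 d \<subseteq> X" using X openE by blast
    then show ?thesis using le by (intro exI[of _ d]) (auto simp: dist_norm norm_minus_commute subset_iff)
  qed
  then obtain d where d: "\<And>b. b \<in> Basis \<Longrightarrow> d b > 0"
    "\<And>b x z. b \<in> Basis \<Longrightarrow> dist x x0 < d b \<Longrightarrow> x \<in> S \<Longrightarrow> z \<in> sphere 0 1 \<Longrightarrow> norm (D b x z - D b x0 z) \<le> \<eta>"
    by metis
  obtain d0 where d0: "d0 > 0" "ball x0 d0 \<subseteq> S" using S openE by blast
  define \<delta> where "\<delta> = min d0 (Min (d ` Basis))"
  have \<delta>: "\<delta> > 0" "\<delta> \<le> d0" "\<And>b. b \<in> Basis \<Longrightarrow> \<delta> \<le> d b"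
    using d0 d(1) by (auto simp: \<delta>_def intro: min.coboundedI2)
  have inS: "y \<in> S" if "y \<in> ball x0 \<delta>" for y
    using that \<delta>(2) d0(2) by (meson mem_ball order_less_le_trans subsetD)
  have "norm ((LINT z|sph. g x z) - (LINT z|sph. g x0 z) -
      (\<Sum>b\<in>Basis. ((x - x0) \<bullet> b) *\<^sub>R (LINT z|sph. D b x0 z))) \<le> e * norm (x - x0)"
    if x: "norm (x - x0) < \<delta>" for x
  proof -
    have xS: "x \<in> S" using x by (intro inS) (simp add: dist_norm norm_minus_commute)
    let ?R = "\<lambda>z. g x z - g x0 z - (\<Sum>b\<in>Basis. ((x - x0) \<bullet> b) *\<^sub>R D b x0 z)"
    have c: "continuous_on (sphere 0 1) (g x)" "continuous_on (sphere 0 1) (g x0)"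
      using continuous_on_slice[OF g] xS S by auto
    have cD: "continuous_on (sphere 0 1) (D b x0)" if "b \<in> Basis" for b
      using continuous_on_slice[OF D[OF that] S(2)] .
    have bound: "norm (?R z) \<le> norm (x - x0) * (?n * \<eta>)" if z: "z \<in> sphere 0 1" for z
    proof (rule differentiable_bound_linearization[where S = "ball x0 \<delta>" and f = "\<lambda>x. g x z"
          and f' = "\<lambda>x h. \<Sum>b\<in>Basis. (h \<bullet> b) *\<^sub>R D b x z"])
      show "x0 + t *\<^sub>R (x - x0) \<in> ball x0 \<delta>" if "t \<in> {0..1}" for t
        using that x mult_left_le_one_le[of "norm (x - x0)" t]
        by (auto simp: dist_norm intro: order.strict_trans1)
      show "((\<lambda>x. g x z) has_derivative (\<lambda>h. \<Sum>b\<in>Basis. (h \<bullet> b) *\<^sub>R D b y z)) (at y within ball x0 \<delta>)"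
        if "y \<in> ball x0 \<delta>" for y
        by (rule has_derivative_at_withinI, rule der[OF inS[OF that] z])
      show "x0 \<in> ball x0 \<delta>" using \<delta> by simp
      show "onorm ((\<lambda>h. \<Sum>b\<in>Basis. (h \<bullet> b) *\<^sub>R D b y z) - (\<lambda>h. \<Sum>b\<in>Basis. (h \<bullet> b) *\<^sub>R D b x0 z)) \<le> ?n * \<eta>"
        if y: "y \<in> ball x0 \<delta>" for y
        unfolding fun_diff_def
      proof (rule onorm_le)
        fix h
        have "norm ((\<Sum>b\<in>Basis. (h \<bullet> b) *\<^sub>R D b y z) - (\<Sum>b\<in>Basis. (h \<bullet> b) *\<^sub>R D b x0 z)) =
            norm (\<Sum>b\<in>Basis. (h \<bullet> b) *\<^sub>R (D b y z - D b x0 z))"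
          by (simp add: sum_subtractf scaleR_diff_right)
        also have "\<dots> \<le> (\<Sum>b\<in>(Basis::'a set). norm h * \<eta>)"
        proof (rule sum_norm_le)
          fix b :: 'a assume b: "b \<in> Basis"
          have "norm (D b y z - D b x0 z) \<le> \<eta>"
            using d(2)[OF b _ inS[OF y] z] y \<delta>(3)[OF b] by (auto simp: dist_commute)
          then show "norm ((h \<bullet> b) *\<^sub>R (D b y z - D b x0 z)) \<le> norm h * \<eta>"
            using Basis_le_norm[OF b, of h] by (auto intro!: mult_mono)
        qed
        finally show "norm ((\<Sum>b\<in>Basis. (h \<bullet> b) *\<^sub>R D b y z) - (\<Sum>b\<in>Basis. (h \<bullet> b) *\<^sub>R D b x0 z)) \<le> ?n * \<eta> * norm h"
          by (simp add: mult_ac)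
      qed
    qed
    have int: "integrable sph (g x)" "integrable sph (g x0)"
      "\<And>b. b \<in> Basis \<Longrightarrow> integrable sph (\<lambda>z. ((x - x0) \<bullet> b) *\<^sub>R D b x0 z)"
      by (rule integrable_sph_continuous, rule c)+
        (rule integrable_sph_continuous, rule continuous_on_scaleR[OF continuous_on_const cD])
    have "(LINT z|sph. ?R z) = (LINT z|sph. g x z) - (LINT z|sph. g x0 z) -
        (LINT z|sph. (\<Sum>b\<in>Basis. ((x - x0) \<bullet> b) *\<^sub>R D b x0 z))"
    proof -
      have s: "integrable sph (\<lambda>z. \<Sum>b\<in>Basis. ((x - x0) \<bullet> b) *\<^sub>R D b x0 z)"
        by (rule Bochner_Integration.integrable_sum) (rule int(3))
      show ?thesis
        using Bochner_Integration.integral_diff[OF Bochner_Integration.integrable_diff[OF int(1,2)] s]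
          Bochner_Integration.integral_diff[OF int(1,2)] by (simp only:)
    qed
    also have "(LINT z|sph. (\<Sum>b\<in>Basis. ((x - x0) \<bullet> b) *\<^sub>R D b x0 z)) =
        (\<Sum>b\<in>Basis. LINT z|sph. ((x - x0) \<bullet> b) *\<^sub>R D b x0 z)"
      by (rule Bochner_Integration.integral_sum) (rule int(3))
    also have "\<dots> = (\<Sum>b\<in>Basis. ((x - x0) \<bullet> b) *\<^sub>R (LINT z|sph. D b x0 z))"
      by (simp only: integral_scaleR_right)
    finally have "(LINT z|sph. ?R z) = (LINT z|sph. g x z) - (LINT z|sph. g x0 z) -
        (\<Sum>b\<in>Basis. ((x - x0) \<bullet> b) *\<^sub>R (LINT z|sph. D b x0 z))" .
    moreover have "norm (LINT z|sph. ?R z) \<le> (norm (x - x0) * (?n * \<eta>)) * ?w"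
      using bound by (intro norm_integral_sph_le continuous_intros c cD) auto
    moreover have "(norm (x - x0) * (?n * \<eta>)) * ?w = e * norm (x - x0)"
      using sph_area_pos[where 'a='a] by (simp add: \<eta>_def)
    ultimately show ?thesis by simp
  qed
  then show "\<exists>d>0. \<forall>x. norm (x - x0) < d \<longrightarrow>
      norm ((LINT z|sph. g x z) - (LINT z|sph. g x0 z) -
      (\<Sum>b\<in>Basis. ((x - x0) \<bullet> b) *\<^sub>R (LINT z|sph. D b x0 z))) \<le> e * norm (x - x0)"
    using \<delta>(1) by blast
qed

text \<open>The Poisson kernel (1 - |x|^2) / |x - z|^n without division by the area, so that its
  mass over the sphere is \<open>sph_area\<close>. A power of the squared distance is easier to
  differentiate than one of the norm.\<close>

definition poisson :: "'a::euclidean_space \<Rightarrow> 'a \<Rightarrow> real" where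
  "poisson x z = (1 - x \<bullet> x) * ((x - z) \<bullet> (x - z)) powr (- (real DIM('a) / 2))"

text \<open>The partial derivative of the Poisson kernel along \<open>b\<close>;
  \<open>poisson2\<close> differentiates it once more along \<open>c\<close>.\<close>

definition poisson1 :: "'a::euclidean_space \<Rightarrow> 'a \<Rightarrow> 'a \<Rightarrow> real" where
  "poisson1 b x z = (let l = real DIM('a) / 2; v = (x - z) \<bullet> (x - z) in
     - 2 * (x \<bullet> b) * v powr (- l) - 2 * l * (1 - x \<bullet> x) * ((x - z) \<bullet> b) * v powr (- l - 1))"

definition poisson2 :: "'a::euclidean_space \<Rightarrow> 'a \<Rightarrow> 'a \<Rightarrow> 'a \<Rightarrow> real" where
  "poisson2 b c x z = (let l = real DIM('a) / 2; v = (x - z) \<bullet> (x - z) in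
     - 2 * (c \<bullet> b) * v powr (- l)
     + 4 * l * ((x \<bullet> b) * ((x - z) \<bullet> c) + (x \<bullet> c) * ((x - z) \<bullet> b)) * v powr (- l - 1)
     - 2 * l * (1 - x \<bullet> x) * (c \<bullet> b) * v powr (- l - 1)
     + 4 * l * (l + 1) * (1 - x \<bullet> x) * ((x - z) \<bullet> b) * ((x - z) \<bullet> c) * v powr (- l - 2))"

lemma has_derivative_powr_dist:
  fixes x z :: "'a::euclidean_space"
  assumes "x \<noteq> z"
  shows "((\<lambda>x. ((x - z) \<bullet> (x - z)) powr r) has_derivative
    (\<lambda>h. (2 * ((x - z) \<bullet> h)) * (r * ((x - z) \<bullet> (x - z)) powr (r - 1)))) (at x)"
proof (rule DERIV_compose_FDERIV[where f = "\<lambda>v. v powr r" and g = "\<lambda>x. (x - z) \<bullet> (x - z)"])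
  have "((\<lambda>v. v powr r) has_real_derivative r * v powr (r - 1)) (at v)" if "v > 0" for v
    using has_real_derivative_powr[OF that] .
  then show "((\<lambda>v. v powr r) has_real_derivative r * ((x - z) \<bullet> (x - z)) powr (r - 1)) (at ((x - z) \<bullet> (x - z)))"
    using assms by simp
  show "((\<lambda>x. (x - z) \<bullet> (x - z)) has_derivative (\<lambda>h. 2 * ((x - z) \<bullet> h))) (at x)"
    by (auto intro!: derivative_eq_intros simp: inner_commute)
qed

lemma has_derivative_coordI:
  fixes f :: "'a::euclidean_space \<Rightarrow> 'b::real_normed_vector"
  assumes "(f has_derivative G) (at x)" "\<And>b. b \<in> Basis \<Longrightarrow> G b = D b"
  shows "(f has_derivative (\<lambda>h. \<Sum>b\<in>Basis. (h \<bullet> b) *\<^sub>R D b)) (at x)"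
proof -
  have "G = (\<lambda>h. \<Sum>b\<in>Basis. (h \<bullet> b) *\<^sub>R G b)"
    using sum_bilinear_coord[OF has_derivative_linear[OF assms(1)]] by (rule ext)
  also have "\<dots> = (\<lambda>h. \<Sum>b\<in>Basis. (h \<bullet> b) *\<^sub>R D b)"
    by (intro ext sum.cong refl) (simp add: assms(2))
  finally show ?thesis using assms(1) by simp
qed

lemma has_derivative_poisson:
  fixes x z :: "'a::euclidean_space"
  assumes "x \<noteq> z"
  shows "((\<lambda>x. poisson x z) has_derivative (\<lambda>h. \<Sum>b\<in>Basis. (h \<bullet> b) *\<^sub>R poisson1 b x z)) (at x)"
proof (rule has_derivative_coordI)
  let ?l = "real DIM('a) / 2"
  let ?v = "(x - z) \<bullet> (x - z)"
  have "((\<lambda>x. 1 - x \<bullet> x) has_derivative (\<lambda>h. - 2 * (x \<bullet> h))) (at x)"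
    by (auto intro!: derivative_eq_intros simp: inner_commute)
  from has_derivative_mult[OF this has_derivative_powr_dist[OF assms, of "- ?l"]]
  show "((\<lambda>x. poisson x z) has_derivative
     (\<lambda>h. (1 - x \<bullet> x) * (2 * ((x - z) \<bullet> h) * (- ?l * ?v powr (- ?l - 1))) + - 2 * (x \<bullet> h) * ?v powr (- ?l))) (at x)"
    unfolding poisson_def .
  show "(1 - x \<bullet> x) * (2 * ((x - z) \<bullet> b) * (- ?l * ?v powr (- ?l - 1))) + - 2 * (x \<bullet> b) * ?v powr (- ?l) = poisson1 b x z" for b
    by (simp add: poisson1_def Let_def)
qed

lemma has_derivative_poisson1:
  fixes x z :: "'a::euclidean_space"
  assumes "x \<noteq> z"
  shows "((\<lambda>x. poisson1 b x z) has_derivative (\<lambda>h. \<Sum>c\<in>Basis. (h \<bullet> c) *\<^sub>R poisson2 b c x z)) (at x)"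
proof (rule has_derivative_coordI)
  define l where "l = real DIM('a) / 2"
  define V where "V r = ((x - z) \<bullet> (x - z)) powr r" for r
  have p: "((\<lambda>x. 1 - x \<bullet> x) has_derivative (\<lambda>h. - 2 * (x \<bullet> h))) (at x)"
    by (auto intro!: derivative_eq_intros simp: inner_commute)
  have q: "((\<lambda>x. x \<bullet> b) has_derivative (\<lambda>h. h \<bullet> b)) (at x)"
    by (auto intro!: derivative_eq_intros)
  have r: "((\<lambda>x. (x - z) \<bullet> b) has_derivative (\<lambda>h. h \<bullet> b)) (at x)"
    by (auto intro!: derivative_eq_intros)
  note V' = has_derivative_powr_dist[OF assms, folded V_def]
  have 1: "((\<lambda>x. - 2 * (x \<bullet> b)) has_derivative (\<lambda>h. - 2 * (h \<bullet> b))) (at x)"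
    by (rule has_derivative_mult_right[OF q])
  have 2: "((\<lambda>x. 2 * l * (1 - x \<bullet> x)) has_derivative (\<lambda>h. 2 * l * (- 2 * (x \<bullet> h)))) (at x)"
    by (rule has_derivative_mult_right[OF p])
  note d = has_derivative_diff[OF has_derivative_mult[OF 1 V'[of "- l"]]
    has_derivative_mult[OF has_derivative_mult[OF 2 r] V'[of "- l - 1"]]]
  define G where "G = (\<lambda>h. (- 2 * (x \<bullet> b) * (2 * ((x - z) \<bullet> h) * (- l * V (- l - 1))) + - 2 * (h \<bullet> b) * V (- l)) -
     (2 * l * (1 - x \<bullet> x) * ((x - z) \<bullet> b) * (2 * ((x - z) \<bullet> h) * ((- l - 1) * V (- l - 1 - 1))) +
      (2 * l * (1 - x \<bullet> x) * (h \<bullet> b) + 2 * l * (- 2 * (x \<bullet> h)) * ((x - z) \<bullet> b)) * V (- l - 1)))"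
  have "(\<lambda>x. poisson1 b x z) = (\<lambda>x. - 2 * (x \<bullet> b) * ((x - z) \<bullet> (x - z)) powr (- l) -
      2 * l * (1 - x \<bullet> x) * ((x - z) \<bullet> b) * ((x - z) \<bullet> (x - z)) powr (- l - 1))"
    by (simp add: poisson1_def l_def Let_def)
  then show "((\<lambda>x. poisson1 b x z) has_derivative G) (at x)"
    using d unfolding G_def V_def by simp
  fix c :: 'a
  have "V (- l - 1 - 1) = V (- l - 2)" by (rule arg_cong[where f=V]) simp
  then show "G c = poisson2 b c x z"
    unfolding G_def poisson2_def Let_def l_def[symmetric] V_def[symmetric]
    by (simp add: algebra_simps)
qed

text \<open>Once the powers of |x - z|^2 are factored out, what remains is 2 x.(x - z) + (1 - |x|^2)
  - |x - z|^2 = 1 - |z|^2, which vanishes on the sphere.\<close>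

lemma poisson2_trace:
  fixes x z :: "'a::euclidean_space"
  assumes z: "norm z = 1" and "x \<noteq> z"
  shows "(\<Sum>b\<in>Basis. poisson2 b b x z) = 0"
proof -
  define l where "l = real DIM('a) / 2"
  define v where "v = (x - z) \<bullet> (x - z)"
  define u where "u = 1 - x \<bullet> x"
  \<comment> \<open>The lowest power of \<open>v\<close> that occurs; the other two are
    \<open>v\<close> and \<open>v * v\<close> times it, so the trace becomes a polynomial
    identity.\<close>
  define W where "W = v powr (- l - 2)"
  have v: "v > 0" using assms by (simp add: v_def)
  have W1: "v powr (- l - 1) = v * W" and W0: "v powr (- l) = v * (v * W)"
  proof -
    have "v powr (- l - 1) = v powr (1 + (- l - 2))" by (rule arg_cong[where f="\<lambda>r. v powr r"]) simp
    then show 1: "v powr (- l - 1) = v * W" using v by (simp only: powr_add W_def) simp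
    have "v powr (- l) = v powr (1 + (- l - 1))" by (rule arg_cong[where f="\<lambda>r. v powr r"]) simp
    then show "v powr (- l) = v * (v * W)" using v by (simp only: powr_add 1) simp
  qed
  have nn: "(\<Sum>b\<in>(Basis::'a set). b \<bullet> b) = 2 * l" by (simp add: l_def)
  have xx: "(\<Sum>b\<in>Basis. (x \<bullet> b) * ((x - z) \<bullet> b)) = x \<bullet> (x - z)"
    "(\<Sum>b\<in>Basis. ((x - z) \<bullet> b) * ((x - z) \<bullet> b)) = v"
    by (simp_all add: euclidean_inner[of x "x - z"] v_def euclidean_inner[of "x - z" "x - z"])
  have "(\<Sum>b\<in>Basis. poisson2 b b x z) = (\<Sum>b\<in>(Basis::'a set).
      (- 2 * v * v * W - 2 * l * u * v * W) * (b \<bullet> b) + 8 * l * v * W * ((x \<bullet> b) * ((x - z) \<bullet> b))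
      + 4 * l * (l + 1) * u * W * (((x - z) \<bullet> b) * ((x - z) \<bullet> b)))"
    unfolding poisson2_def Let_def l_def[symmetric] v_def[symmetric] u_def[symmetric] W_def[symmetric] W1 W0
    by (intro sum.cong refl) (simp add: algebra_simps)
  also have "\<dots> = (- 2 * v * v * W - 2 * l * u * v * W) * (2 * l) + 8 * l * v * W * (x \<bullet> (x - z))
      + 4 * l * (l + 1) * u * W * v"
    by (simp only: sum.distrib sum_distrib_left[symmetric] nn xx)
  also have "\<dots> = 4 * l * v * W * (2 * (x \<bullet> (x - z)) + u - v)" by (simp add: algebra_simps)
  also have "2 * (x \<bullet> (x - z)) + u - v = 0"
  proof -
    have "z \<bullet> z = 1" using z by (simp flip: power2_norm_eq_inner)
    then show ?thesis
      by (simp add: u_def v_def inner_diff_left inner_diff_right inner_commute[of z x])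
  qed
  finally show ?thesis by simp
qed

lemma continuous_on_poisson_aux:
  assumes "\<And>x z. (x, z) \<in> S \<Longrightarrow> x \<noteq> z"
  shows "continuous_on S (\<lambda>(x, z). poisson x z)"
    "continuous_on S (\<lambda>(x, z). poisson1 b x z)"
    "continuous_on S (\<lambda>(x, z). poisson2 b c x z)"
  unfolding poisson_def poisson1_def poisson2_def Let_def case_prod_beta
  by (intro continuous_intros; use assms in fastforce)+

lemma poisson_nonneg: "x \<in> cball 0 1 \<Longrightarrow> poisson x z \<ge> 0"
  by (auto simp: poisson_def power2_norm_eq_inner[symmetric] power_le_one intro!: mult_nonneg_nonneg)

theorem harmonic_on_poisson_integral:
  fixes \<phi> :: "'a::euclidean_space \<Rightarrow> complex"
  assumes \<phi>: "continuous_on (sphere 0 1) \<phi>"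
  shows "harmonic_on (\<lambda>x. LINT z|sph. poisson x z * \<phi> z) (ball 0 1)"
proof -
  let ?S = "ball 0 1 :: 'a set"
  let ?T = "?S \<times> sphere 0 1"
  have neq: "x \<noteq> z" if "(x, z) \<in> ?T" for x z using that by auto
  have neq': "x \<noteq> z" if "x \<in> ?S" "z \<in> sphere 0 1" for x z using that by auto
  have \<phi>': "continuous_on ?T (\<lambda>(x, z). \<phi> z)"
    unfolding case_prod_beta by (rule continuous_on_compose2[OF \<phi>]) (auto intro!: continuous_intros)
  have c: "continuous_on ?T (\<lambda>(x, z). complex_of_real (q x z) * \<phi> z)"
    if "continuous_on ?T (\<lambda>(x, z). q x z)" for q
    using continuous_on_mult[OF continuous_on_of_real[OF that] \<phi>'] by (simp add: case_prod_beta)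
  have c0: "continuous_on ?T (\<lambda>(x, z). complex_of_real (poisson x z) * \<phi> z)"
    by (rule c, rule continuous_on_poisson_aux(1), rule neq)
  have c1: "continuous_on ?T (\<lambda>(x, z). complex_of_real (poisson1 b x z) * \<phi> z)" for b
    by (rule c, rule continuous_on_poisson_aux(2), rule neq)
  have c2: "continuous_on ?T (\<lambda>(x, z). complex_of_real (poisson2 b c x z) * \<phi> z)" for b c
    by (rule c, rule continuous_on_poisson_aux(3), rule neq)
  have d: "((\<lambda>x. complex_of_real (q x) * \<phi> z) has_derivative
      (\<lambda>h. \<Sum>b\<in>Basis. (h \<bullet> b) *\<^sub>R (complex_of_real (D b) * \<phi> z))) (at x)"
    if "(q has_derivative (\<lambda>h. \<Sum>b\<in>Basis. (h \<bullet> b) *\<^sub>R D b)) (at x)" for q :: "'a \<Rightarrow> real" and D x z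
  proof -
    have "bounded_linear (\<lambda>r. complex_of_real r * \<phi> z)"
      by (intro bounded_linear_compose[OF bounded_linear_mult_left bounded_linear_of_real])
    from bounded_linear.has_derivative[OF this that]
    show ?thesis by (simp add: sum_distrib_right scaleR_conv_of_real mult.assoc)
  qed
  show ?thesis unfolding harmonic_on_jet
  proof (rule exI[of _ "\<lambda>b x. LINT z|sph. poisson1 b x z * \<phi> z"],
      rule exI[of _ "\<lambda>b c x. LINT z|sph. poisson2 b c x z * \<phi> z"], unfold harmonic_jet_def, intro conjI ballI)
    fix x assume x: "x \<in> ?S"
    show "((\<lambda>x. LINT z|sph. poisson x z * \<phi> z) has_derivative
        (\<lambda>h. \<Sum>b\<in>Basis. (h \<bullet> b) *\<^sub>R (LINT z|sph. poisson1 b x z * \<phi> z))) (at x)"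
      by (rule has_derivative_integral_sph[OF open_ball x c0 c1]) (rule d, rule has_derivative_poisson, rule neq', assumption, assumption)
    have s: "continuous_on (sphere 0 1) (\<lambda>z. poisson2 b b x z * \<phi> z)" for b
      by (rule continuous_on_slice[OF c2 x])
    have "(\<Sum>b\<in>Basis. LINT z|sph. poisson2 b b x z * \<phi> z) = (LINT z|sph. (\<Sum>b\<in>Basis. poisson2 b b x z * \<phi> z))"
      by (rule Bochner_Integration.integral_sum[symmetric]) (rule integrable_sph_continuous[OF s])
    also have "\<dots> = (LINT z|(sph :: 'a measure). 0)"
    proof (rule Bochner_Integration.integral_cong[OF refl])
      fix z assume "z \<in> space (sph :: 'a measure)"
      then have "(\<Sum>b\<in>Basis. poisson2 b b x z) = 0" using x by (intro poisson2_trace) auto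
      then show "(\<Sum>b\<in>Basis. poisson2 b b x z * \<phi> z) = 0"
        by (simp flip: sum_distrib_right of_real_sum)
    qed
    finally show "(\<Sum>b\<in>Basis. LINT z|sph. poisson2 b b x z * \<phi> z) = 0" by simp
  next
    fix b x :: 'a assume x: "x \<in> ?S"
    show "((\<lambda>x. LINT z|sph. poisson1 b x z * \<phi> z) has_derivative
        (\<lambda>h. \<Sum>c\<in>Basis. (h \<bullet> c) *\<^sub>R (LINT z|sph. poisson2 b c x z * \<phi> z))) (at x)"
      by (rule has_derivative_integral_sph[OF open_ball x c1 c2]) (rule d, rule has_derivative_poisson1, rule neq', assumption, assumption)
  next
    fix b c :: 'a
    show "continuous_on ?S (\<lambda>x. LINT z|sph. poisson2 b c x z * \<phi> z)"
      by (rule continuous_on_integral_sph[OF c2])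
  qed
qed

section \<open>Mass of the Poisson kernel and the Poisson formula\<close>

lemma continuous_on_poisson_slice:
  "norm x < 1 \<Longrightarrow> continuous_on (sphere 0 1) (poisson (x :: 'a::euclidean_space))"
  by (rule continuous_on_slice[where g = poisson and S = "ball 0 1"], rule continuous_on_poisson_aux(1)) auto

lemma poisson_0: "norm z = 1 \<Longrightarrow> poisson 0 z = 1"
  by (simp add: poisson_def flip: power2_norm_eq_inner)

lemma poisson_hyper_refl: "poisson (hyper_refl v x) (hyper_refl v z) = poisson x z"
proof -
  have "hyper_refl v x - hyper_refl v z = hyper_refl v (x - z)"
    by (simp add: linear_diff[OF linear_hyper_refl])
  then show ?thesis by (simp add: poisson_def inner_hyper_refl)
qed

text \<open>The reflection exchanging \<open>x\<close> and \<open>y\<close> preserves both the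
  kernel and the surface measure.\<close>

lemma integral_poisson_rotate:
  fixes x y :: "'a::euclidean_space"
  assumes "norm x = norm y"
  shows "(LINT z|sph. poisson x z) = (LINT z|sph. poisson y z)"
proof -
  define T where "T = hyper_refl (x - y)"
  have [measurable]: "T \<in> borel_measurable borel" by (simp add: T_def)
  have m [measurable]: "poisson u \<in> borel_measurable borel" for u :: 'a
    unfolding poisson_def [abs_def] by measurable
  have y: "y = T x" unfolding T_def using hyper_refl_swap[OF assms] by simp
  have "(LINT z|sph. poisson y z) = (LINT z|distr sphere_measure borel T. poisson y z)"
    by (simp add: T_def sphere_measure_distr_hyper_refl integral_sphere_measure m)
  also have "\<dots> = (LINT z|sphere_measure. poisson y (T z))"
    by (rule integral_distr) measurable
  also have "\<dots> = (LINT z|sphere_measure. poisson x z)"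
    by (rule Bochner_Integration.integral_cong[OF refl], subst y) (simp only: T_def poisson_hyper_refl)
  finally show ?thesis by (simp add: integral_sphere_measure m)
qed

text \<open>
  The mass of the Poisson kernel is a radial harmonic function. By the maximum principle such a
  function is constant.
\<close>
lemma integral_poisson:
  fixes x :: "'a::euclidean_space"
  assumes x: "norm x < 1"
  shows "(LINT z|sph. poisson x z) = sph_area TYPE('a)"
proof -
  define w where "w = (\<lambda>x::'a. LINT z|sph. poisson x z)"
  have w0: "w 0 = sph_area TYPE('a)"
  proof -
    have "w 0 = (LINT z|(sph :: 'a measure). 1)"
      unfolding w_def by (rule Bochner_Integration.integral_cong) (auto simp: poisson_0)
    then show ?thesis by (simp add: sph_area_def)
  qed
  have hc: "harmonic_on (\<lambda>x::'a. LINT z|sph. complex_of_real (poisson x z) * 1) (ball 0 1)"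
    by (rule harmonic_on_poisson_integral) (rule continuous_on_const)
  have "Re (LINT z|sph. complex_of_real (poisson x z) * 1) = w x" for x
    by (simp add: w_def)
  with harmonic_on_linear_image[OF bounded_linear_Re hc]
  have h: "harmonic_on w (ball 0 1)" by simp
  show ?thesis
  proof (cases "x = 0")
    case False
    define r where "r = norm x"
    have r: "0 < r" "r < 1" using x False by (auto simp: r_def)
    have rin: "r *\<^sub>R y \<in> ball 0 1" if "y \<in> cball 0 1" for y :: 'a
    proof -
      have "r * norm y \<le> r" using that r by (intro mult_left_le) auto
      then have "r * norm y < 1" using r by linarith
      then show ?thesis using r by simp
    qed
    \<comment> \<open>Rescaling turns the sphere through \<open>x\<close> into the unit sphere,
      where \<open>w\<close> is constant. The maximum principle for this function and for its
      negative then identifies that constant with the value at the centre.\<close>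
    have hr: "harmonic_on (\<lambda>y. w (r *\<^sub>R y)) (ball 0 1)"
      by (rule harmonic_on_dilation[OF h]) (rule rin, simp)
    have cr: "continuous_on (cball 0 1) (\<lambda>y. w (r *\<^sub>R y))"
      by (rule continuous_on_compose2[OF harmonic_on_imp_continuous_on[OF h]])
        (use rin in \<open>auto intro!: continuous_intros\<close>)
    have s: "w (r *\<^sub>R y) = w x" if "norm y = 1" for y
      unfolding w_def by (rule integral_poisson_rotate) (use that r in \<open>auto simp: r_def\<close>)
    have "w (r *\<^sub>R 0) \<le> w x"
      by (rule harmonic_max_principle_real[OF hr cr]) (simp_all add: s)
    moreover have "- w (r *\<^sub>R 0) \<le> - w x"
      by (rule harmonic_max_principle_real[OF harmonic_on_linear_image[OF bounded_linear_minus[OF bounded_linear_ident] hr]])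
        (auto intro!: continuous_on_minus cr simp: s)
    ultimately show ?thesis using w0 by (simp add: w_def)
  qed (use w0 in \<open>simp add: w_def\<close>)
qed

lemma scaleR_in_ball:
  assumes "0 \<le> s" "s < 1" "x \<in> cball (0 :: 'a::real_normed_vector) 1"
  shows "s *\<^sub>R x \<in> ball 0 1"
proof -
  have "s * norm x \<le> s" using assms by (intro mult_left_le) auto
  then have "s * norm x < 1" using assms by linarith
  then show ?thesis using assms by simp
qed

text \<open>
  The Poisson integral has boundary values \<open>u\<close>, uniformly, so by the maximum principle
  it agrees with \<open>u\<close> inside.
\<close>
theorem poisson_formula:
  fixes u :: "'a::euclidean_space \<Rightarrow> complex"
  assumes h: "harmonic_on u (ball 0 1)" and c: "continuous_on (cball 0 1) u" and x: "norm x < 1"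
  shows "(LINT z|sph. poisson x z * u z) = sph_area TYPE('a) * u x"
proof -
  let ?w = "sph_area TYPE('a)" and ?n = "real DIM('a) / 2"
  have w: "?w > 0" by (rule sph_area_pos)
  have cs: "continuous_on (sphere 0 1) u" using c by (rule continuous_on_subset) auto
  define P where "P = (\<lambda>x. (LINT z|sph. poisson x z * u z) - ?w * u x)"
  have hP: "harmonic_on P (ball 0 1)"
  proof -
    have "harmonic_on (\<lambda>x. - (?w * u x)) (ball 0 1)"
      by (rule harmonic_on_linear_image[OF _ h]) (intro bounded_linear_minus bounded_linear_mult_right)
    from harmonic_on_add[OF harmonic_on_poisson_integral[OF cs] this] show ?thesis
      by (simp add: P_def)
  qed
  obtain M where M: "\<And>y. y \<in> cball 0 1 \<Longrightarrow> norm (u y) \<le> M"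
    using compact_imp_bounded[OF compact_continuous_image[OF c compact_cball]]
    unfolding bounded_iff by (metis imageI)
  have M0: "M \<ge> 0" using M[of 0] norm_ge_zero[of "u 0"] by (simp del: norm_ge_zero)
  have bd: "\<exists>r0<1. \<forall>y. norm y < 1 \<longrightarrow> r0 < norm y \<longrightarrow> norm (P y) \<le> \<eta> * ?w" if \<eta>: "\<eta> > 0" for \<eta>
  proof -
    have "uniformly_continuous_on (cball 0 1) u" by (rule compact_uniformly_continuous[OF c compact_cball])
    then obtain \<delta> where \<delta>: "\<delta> > 0"
      "\<And>a b. a \<in> cball 0 1 \<Longrightarrow> b \<in> cball 0 1 \<Longrightarrow> dist b a < \<delta> \<Longrightarrow> dist (u b) (u a) < \<eta> / 2"
      unfolding uniformly_continuous_on_def using \<eta> by (meson half_gt_zero)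
    \<comment> \<open>For z at distance at least \<delta> from y the kernel is at most (1 - |y|^2)
      \<delta>^(-n), and |u z - u y| is at most 2 M. The added 1 keeps \<open>K\<close>
      positive.\<close>
    define K where "K = 2 * M * (\<delta>\<^sup>2) powr (- ?n) + 1"
    have K: "K > 0" using M0 by (simp add: K_def add_nonneg_pos)
    \<comment> \<open>Beyond this radius 2 (1 - |y|) K is at most \<eta>/2.\<close>
    define r0 where "r0 = 1 - \<eta> / (4 * K)"
    have "norm (P y) \<le> \<eta> * ?w" if y: "norm y < 1" "r0 < norm y" for y
    proof -
      have cp: "continuous_on (sphere 0 1) (poisson y)" by (rule continuous_on_poisson_slice[OF y(1)])
      have cq: "continuous_on (sphere 0 1) (\<lambda>z. complex_of_real (poisson y z) * (u z - u y))"
        by (intro continuous_intros cp cs)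
      have ci: "continuous_on (sphere 0 1) (\<lambda>z. complex_of_real (poisson y z) * u z)"
        "continuous_on (sphere 0 1) (\<lambda>z. complex_of_real (poisson y z) * u y)"
        by (intro continuous_intros cp cs)+
      have "(LINT z|sph. complex_of_real (poisson y z) * (u z - u y)) =
          (LINT z|sph. complex_of_real (poisson y z) * u z) - (LINT z|sph. complex_of_real (poisson y z) * u y)"
        by (simp only: right_diff_distrib
            Bochner_Integration.integral_diff[OF integrable_sph_continuous[OF ci(1)] integrable_sph_continuous[OF ci(2)]])
      also have "(LINT z|sph. complex_of_real (poisson y z) * u y) = ?w * u y"
        by (simp add: integral_poisson[OF y(1)])
      finally have "P y = (LINT z|sph. complex_of_real (poisson y z) * (u z - u y))"
        by (simp add: P_def)
      then have "norm (P y) \<le> (LINT z|sph. norm (complex_of_real (poisson y z) * (u z - u y)))"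
        by (simp only: integral_norm_bound)
      also have "\<dots> \<le> (LINT z|sph. \<eta> / 2 * poisson y z + \<eta> / 2)"
      proof (rule integral_mono)
        show "integrable sph (\<lambda>z. norm (complex_of_real (poisson y z) * (u z - u y)))"
          by (intro integrable_norm integrable_sph_continuous cq)
        show "integrable sph (\<lambda>z. \<eta> / 2 * poisson y z + \<eta> / 2)"
          by (intro integrable_sph_continuous continuous_intros cp)
        fix z assume "z \<in> space (sph :: 'a measure)"
        then have z: "z \<in> cball 0 1" "norm z = 1" by auto
        have p0: "poisson y z \<ge> 0" using y by (intro poisson_nonneg) simp
        show "norm (complex_of_real (poisson y z) * (u z - u y)) \<le> \<eta> / 2 * poisson y z + \<eta> / 2"
        proof (cases "dist z y < \<delta>")
          case True
          then have "norm (u z - u y) \<le> \<eta> / 2" using \<delta>(2)[of y z] z y by (simp add: dist_norm)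
          then have "poisson y z * norm (u z - u y) \<le> poisson y z * (\<eta> / 2)"
            using p0 by (rule mult_left_mono)
          then show ?thesis using p0 \<eta> by (simp add: norm_mult mult.commute)
        next
          case False
          have "norm (u z - u y) \<le> 2 * M"
            using norm_triangle_ineq4[of "u z" "u y"] M[of z] M[of y] z y by simp
          moreover have "poisson y z \<le> (1 - (norm y)\<^sup>2) * (\<delta>\<^sup>2) powr (- ?n)"
          proof -
            have "\<delta>\<^sup>2 \<le> (y - z) \<bullet> (y - z)"
              using False \<delta>(1) by (simp add: dist_norm norm_minus_commute flip: power2_norm_eq_inner)
            then have "((y - z) \<bullet> (y - z)) powr (- ?n) \<le> (\<delta>\<^sup>2) powr (- ?n)"
              using \<delta>(1) by (intro powr_mono2') auto
            then show ?thesis using y unfolding poisson_def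
              by (auto simp: power2_norm_eq_inner[symmetric] power_le_one intro!: mult_left_mono)
          qed
          ultimately have "poisson y z * norm (u z - u y) \<le> ((1 - (norm y)\<^sup>2) * (\<delta>\<^sup>2) powr (- ?n)) * (2 * M)"
            using p0 M0 by (intro mult_mono) (auto simp: y power_le_one less_imp_le)
          also have "\<dots> \<le> (1 - (norm y)\<^sup>2) * K"
            using y by (auto simp: K_def power_le_one algebra_simps)
          also have "\<dots> \<le> (2 * (1 - norm y)) * K"
          proof (rule mult_right_mono)
            have "(1 - norm y)\<^sup>2 \<ge> 0" by simp
            then show "1 - (norm y)\<^sup>2 \<le> 2 * (1 - norm y)" by (simp add: power2_eq_square algebra_simps)
          qed (use K in simp)
          also have "\<dots> \<le> (2 * (\<eta> / (4 * K))) * K"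
            using y K by (intro mult_right_mono) (auto simp: r0_def)
          also have "\<dots> = \<eta> / 2" using K by simp
          finally have "poisson y z * norm (u z - u y) \<le> \<eta> / 2" .
          moreover have "0 \<le> \<eta> / 2 * poisson y z" using p0 \<eta> by simp
          moreover have "norm (complex_of_real (poisson y z) * (u z - u y)) = poisson y z * norm (u z - u y)"
            using p0 by (simp add: norm_mult)
          ultimately show ?thesis by linarith
        qed
      qed
      also have "\<dots> = \<eta> / 2 * (LINT z|sph. poisson y z) + \<eta> / 2 * ?w"
        using integrable_sph_continuous[OF cp] by (simp add: sph_area_def)
      also have "\<dots> = \<eta> * ?w" by (simp add: integral_poisson[OF y(1)])
      finally show ?thesis .
    qed
    moreover have "r0 < 1" using \<eta> K by (simp add: r0_def)
    ultimately show ?thesis by blast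
  qed
  have le: "norm (P x) \<le> \<eta> * ?w" if \<eta>: "\<eta> > 0" for \<eta>
  proof -
    obtain r0 where r0: "r0 < 1" "\<And>y. norm y < 1 \<Longrightarrow> r0 < norm y \<Longrightarrow> norm (P y) \<le> \<eta> * ?w"
      using bd[OF \<eta>] by blast
    \<comment> \<open>\<open>P\<close> is controlled near the sphere but not known to extend
      continuously to it, so the maximum principle is applied on a slightly smaller ball containing
      \<open>x\<close>.\<close>
    obtain r where r: "max (norm x) (max 0 r0) < r" "r < 1"
      using dense[of "max (norm x) (max 0 r0)" 1] x r0 by auto
    have r': "0 < r" "norm x < r" "r0 < r" using r by auto
    have inb: "r *\<^sub>R y \<in> ball 0 1" if "y \<in> cball 0 1" for y :: 'a
      using that r r' by (intro scaleR_in_ball) auto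
    have "norm (P (r *\<^sub>R (x /\<^sub>R r))) \<le> \<eta> * ?w"
    proof (rule harmonic_max_principle[where u = "\<lambda>y. P (r *\<^sub>R y)"])
      show "harmonic_on (\<lambda>y. P (r *\<^sub>R y)) (ball 0 1)"
        by (rule harmonic_on_dilation[OF hP]) (rule inb, simp)
      show "continuous_on (cball 0 1) (\<lambda>y. P (r *\<^sub>R y))"
        by (rule continuous_on_compose2[OF harmonic_on_imp_continuous_on[OF hP]])
          (use inb in \<open>auto intro!: continuous_intros\<close>)
      show "norm (P (r *\<^sub>R y)) \<le> \<eta> * ?w" if "norm y = 1" for y
        using that r r' by (intro r0(2)) auto
      show "x /\<^sub>R r \<in> cball 0 1" using r' by (simp add: inverse_eq_divide divide_le_eq)
    qed
    then show ?thesis using r' by simp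
  qed
  have "norm (P x) \<le> 0"
  proof (rule field_le_epsilon)
    fix e :: real assume "e > 0"
    then show "norm (P x) \<le> 0 + e" using le[of "e / ?w"] w by simp
  qed
  then show ?thesis by (simp add: P_def)
qed

text \<open>A function harmonic in the open ball need not extend to the sphere, but its dilates
  do.\<close>

corollary poisson_formula_dilate:
  fixes f :: "'a::euclidean_space \<Rightarrow> complex"
  assumes h: "harmonic_on f (ball 0 1)" and s: "0 \<le> s" "s < 1" and x: "norm x < 1"
  shows "(LINT z|sph. poisson x z * f (s *\<^sub>R z)) = sph_area TYPE('a) * f (s *\<^sub>R x)"
proof (rule poisson_formula[OF _ _ x])
  have inb: "s *\<^sub>R y \<in> ball 0 1" if "y \<in> cball 0 1" for y :: 'a
    using that s by (intro scaleR_in_ball)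
  show "harmonic_on (\<lambda>y. f (s *\<^sub>R y)) (ball 0 1)"
    by (rule harmonic_on_dilation[OF h]) (rule inb, simp)
  show "continuous_on (cball 0 1) (\<lambda>y. f (s *\<^sub>R y))"
    by (rule continuous_on_compose2[OF harmonic_on_imp_continuous_on[OF h]])
      (use inb in \<open>auto intro!: continuous_intros\<close>)
qed

text \<open>On the ball of radius \<open>s\<close> the function is the Poisson integral of its own
  values on the bounding sphere. The criterion gives harmonicity of kernel integrals from continuity
  and Fubini, without differentiating the kernel.\<close>

lemma harmonic_onI_poisson:
  fixes f :: "'a::euclidean_space \<Rightarrow> complex"
  assumes c: "continuous_on (ball 0 1) f"
    and P: "\<And>s x. 0 < s \<Longrightarrow> s < 1 \<Longrightarrow> norm x < 1 \<Longrightarrow>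
       (LINT z|sph. poisson x z * f (s *\<^sub>R z)) = sph_area TYPE('a) * f (s *\<^sub>R x)"
  shows "harmonic_on f (ball 0 1)"
proof (rule harmonic_on_ball_exhaust)
  fix s :: real assume s: "0 < s" "s < 1"
  let ?w = "sph_area TYPE('a)"
  have w: "?w > 0" by (rule sph_area_pos)
  have "continuous_on (sphere 0 1) (\<lambda>z. f (s *\<^sub>R z))"
    by (rule continuous_on_compose2[OF c]) (use s in \<open>auto intro!: continuous_intros\<close>)
  from harmonic_on_poisson_integral[OF this]
  have "harmonic_on (\<lambda>x. LINT z|sph. poisson x z * f (s *\<^sub>R z)) (ball 0 1)" .
  from harmonic_on_linear_image[OF bounded_linear_mult_right[of "complex_of_real (1 / ?w)"] this]
  have "harmonic_on (\<lambda>x. complex_of_real (1 / ?w) * (LINT z|sph. poisson x z * f (s *\<^sub>R z))) (ball 0 1)" .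
  from harmonic_on_dilation[OF this, of "ball 0 s" "1 / s"]
  have "harmonic_on (\<lambda>x. complex_of_real (1 / ?w) * (LINT z|sph. poisson ((1 / s) *\<^sub>R x) z * f (s *\<^sub>R z))) (ball 0 s)"
    using s by simp
  then show "harmonic_on f (ball 0 s)"
    by (rule harmonic_on_cong) (use s w in \<open>auto simp: P\<close>)
qed

section \<open>The generating function of the zonal harmonics\<close>

text \<open>Gegenbauer polynomials of index \<open>l\<close> in homogenised form: the coefficients
  of (1 - 2 s r + N r^2)^(-l) as a power series in r, given by their three-term recurrence.\<close>

fun gegen :: "real \<Rightarrow> real \<Rightarrow> real \<Rightarrow> nat \<Rightarrow> real" where
  "gegen l s N 0 = 1"
| "gegen l s N (Suc 0) = 2 * l * s"
| "gegen l s N (Suc (Suc k)) =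
     (2 * s * (real k + 1 + l) * gegen l s N (Suc k) - (real k + 2 * l) * N * gegen l s N k) / (real k + 2)"

text \<open>
  For unit vectors \<open>x\<close>, \<open>z\<close> and \<open>l = n/2\<close>, these are the coefficients of the
  Poisson kernel as a power series in the radius; in general \<open>s = x \<bullet> z\<close> and
  \<open>N = |x|^2\<close>, which makes them homogeneous polynomials in \<open>x\<close>.
\<close>
definition zon :: "real \<Rightarrow> real \<Rightarrow> real \<Rightarrow> nat \<Rightarrow> real" where
  "zon l s N k = gegen l s N k - (if k < 2 then 0 else N * gegen l s N (k - 2))"

text \<open>The recurrence is homogeneous when \<open>s\<close> has degree one and \<open>N\<close>
  degree two.\<close>

lemma gegen_dilate: "gegen l (c * s) (c\<^sup>2 * N) k = c ^ k * gegen l s N k"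
  by (induction l s N k rule: gegen.induct)
    (simp_all add: divide_simps, simp_all add: algebra_simps power2_eq_square)

lemma zon_dilate: "zon l (c * s) (c\<^sup>2 * N) k = c ^ k * zon l s N k"
proof (cases "k < 2")
  case False
  then have "c ^ k = c\<^sup>2 * c ^ (k - 2)" by (metis le_add_diff_inverse not_less power_add)
  with False show ?thesis by (simp add: zon_def gegen_dilate right_diff_distrib)
qed (simp add: zon_def gegen_dilate)

text \<open>For unit vectors x, y with inner product \<open>s\<close> this is |R x - y|^2, with the
  radius R replaced by the complex variable \<open>z\<close>.\<close>

definition gen_quad :: "real \<Rightarrow> complex \<Rightarrow> complex" where
  "gen_quad s z = 1 - 2 * of_real s * z + z\<^sup>2"

lemma gen_quad_of_real: "gen_quad s (of_real r) = of_real (1 - 2 * s * r + r\<^sup>2)"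
  by (simp add: gen_quad_def)

text \<open>This keeps the principal power holomorphic on the disc. For z = a + ib the imaginary
  part 2 b (a - s) vanishes only if b = 0, where the value is (a - s)^2 + 1 - s^2, or if a = s,
  where it is 1 - |z|^2; both are positive in the disc.\<close>

lemma gen_quad_nonpos:
  assumes "\<bar>s\<bar> \<le> 1" "norm z < 1"
  shows "gen_quad s z \<notin> \<real>\<^sub>\<le>\<^sub>0"
proof
  assume "gen_quad s z \<in> \<real>\<^sub>\<le>\<^sub>0"
  then have "Im (gen_quad s z) = 0" "Re (gen_quad s z) \<le> 0" by (auto elim!: nonpos_Reals_cases)
  moreover define a b where "a = Re z" and "b = Im z"
  ultimately have "2 * b * (a - s) = 0" and re: "1 - 2 * s * a + a\<^sup>2 - b\<^sup>2 \<le> 0"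
    by (auto simp: gen_quad_def power2_eq_square algebra_simps)
  then have "b = 0 \<or> a = s" by auto
  have "(norm z)\<^sup>2 < 1" using assms(2) by (simp add: power_less_one_iff abs_square_less_1)
  then have ab: "a\<^sup>2 + b\<^sup>2 < 1" by (simp add: cmod_power2 a_def b_def)
  have s: "s\<^sup>2 \<le> 1" using assms(1) by (simp add: abs_square_le_1)
  from \<open>b = 0 \<or> a = s\<close> show False
  proof
    assume b: "b = 0"
    have "(a - s)\<^sup>2 + (1 - s\<^sup>2) \<le> 0" using re b by (simp add: power2_eq_square algebra_simps)
    then have "(a - s)\<^sup>2 = 0" using s zero_le_power2[of "a - s"] by linarith
    then have "a = s" by simp
    with re b ab show False by (simp add: power2_eq_square algebra_simps)
  next
    assume "a = s"
    with re ab show False by (simp add: power2_eq_square algebra_simps)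
  qed
qed

text \<open>With s = cos \<theta> the roots are exp(i \<theta>) and its conjugate.\<close>

lemma gen_quad_factor:
  assumes "\<bar>s\<bar> \<le> 1"
  obtains w where "norm w = 1" "\<And>z. gen_quad s z = (z - w) * (z - cnj w)"
proof
  define w where "w = Complex s (sqrt (1 - s\<^sup>2))"
  have s: "s\<^sup>2 \<le> 1" using assms by (simp add: abs_square_le_1)
  then show "norm w = 1" by (simp add: w_def complex_norm)
  have sum: "2 * complex_of_real s = w + cnj w" by (simp add: w_def complex_eq_iff)
  have prod: "1 = w * cnj w" using s by (simp add: w_def complex_eq_iff flip: power2_eq_square)
  show "gen_quad s z = (z - w) * (z - cnj w)" for z
  proof -
    have "gen_quad s z = w * cnj w - (w + cnj w) * z + z\<^sup>2"
      by (simp only: gen_quad_def sum prod[symmetric])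
    then show ?thesis by (simp add: algebra_simps power2_eq_square)
  qed
qed

definition gen_G :: "real \<Rightarrow> real \<Rightarrow> complex \<Rightarrow> complex" where
  "gen_G l s z = gen_quad s z powr (of_real (- l))"

text \<open>For l = n/2, the Poisson kernel of two unit vectors with inner product \<open>s\<close>,
  as a holomorphic function of the radius.\<close>

definition gen_F :: "real \<Rightarrow> real \<Rightarrow> complex \<Rightarrow> complex" where
  "gen_F l s z = (1 - z\<^sup>2) * gen_G l s z"

lemma has_field_derivative_gen_G:
  assumes "\<bar>s\<bar> \<le> 1" "norm z < 1"
  shows "(gen_G l s has_field_derivative
    of_real (- l) * gen_quad s z powr (of_real (- l) - 1) * (2 * z - 2 * of_real s)) (at z)"
proof -
  have "((\<lambda>w. w powr (of_real (- l))) has_field_derivative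
      of_real (- l) * gen_quad s z powr (of_real (- l) - 1)) (at (gen_quad s z))"
    by (rule has_field_derivative_powr[OF gen_quad_nonpos[OF assms]])
  moreover have "(gen_quad s has_field_derivative (2 * z - 2 * of_real s)) (at z)"
    unfolding gen_quad_def [abs_def] by (auto intro!: derivative_eq_intros)
  ultimately show ?thesis unfolding gen_G_def [abs_def] by (rule DERIV_chain2)
qed

lemma holomorphic_gen_G:
  assumes "\<bar>s\<bar> \<le> 1" shows "gen_G l s holomorphic_on ball 0 1"
  unfolding holomorphic_on_def field_differentiable_def
  using has_field_derivative_at_within[OF has_field_derivative_gen_G[OF assms]] by (metis mem_ball_0)

lemma holomorphic_gen_F:
  assumes "\<bar>s\<bar> \<le> 1" shows "gen_F l s holomorphic_on ball 0 1"
  unfolding gen_F_def [abs_def] by (intro holomorphic_intros holomorphic_gen_G assms)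

text \<open>The power satisfies (1 - 2 s z + z^2) G' = 2 l (s - z) G, and comparing coefficients in
  this equation yields the recurrence of \<open>gegen\<close>.\<close>

lemma gen_G_fps:
  assumes s: "\<bar>s\<bar> \<le> 1"
  shows "gen_G l s has_fps_expansion Abs_fps (\<lambda>k. of_real (gegen l s 1 k))"
proof -
  define F where "F = fps_expansion (gen_G l s) 0"
  have F: "gen_G l s has_fps_expansion F" unfolding F_def
    by (rule has_fps_expansion_fps_expansion[OF open_ball _ holomorphic_gen_G[OF s]]) simp
  define q :: "complex fps" where "q = 1 - fps_const (2 * of_real s) * fps_X + fps_X ^ 2"
  define r where "r = fps_const (2 * of_real l * of_real s) - fps_const (2 * of_real l) * (fps_X :: complex fps)"
  have 1: "(\<lambda>z. deriv (gen_G l s) z * (1 - 2 * of_real s * z + z ^ 2)) has_fps_expansion fps_deriv F * q"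
    unfolding q_def by (intro fps_expansion_intros F)
  have 2: "(\<lambda>z. (2 * of_real l * of_real s - 2 * of_real l * z) * gen_G l s z) has_fps_expansion r * F"
    unfolding r_def by (intro fps_expansion_intros F)
  have "eventually (\<lambda>z. z \<in> ball (0::complex) 1) (nhds 0)" by (intro eventually_nhds_in_open) auto
  then have "eventually (\<lambda>z. deriv (gen_G l s) z * (1 - 2 * of_real s * z + z ^ 2) =
      (2 * of_real l * of_real s - 2 * of_real l * z) * gen_G l s z) (nhds 0)"
  proof eventually_elim
    case (elim z)
    then have z: "norm z < 1" by simp
    have q0: "gen_quad s z \<noteq> 0" using gen_quad_nonpos[OF s z] by auto
    define Q where "Q = gen_quad s z powr (of_real (- l) - 1)"
    have Q: "Q * gen_quad s z = gen_G l s z"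
      using q0 by (simp add: Q_def gen_G_def powr_diff)
    have "deriv (gen_G l s) z =
        of_real (- l) * Q * (2 * z - 2 * of_real s)"
      unfolding Q_def by (rule DERIV_imp_deriv[OF has_field_derivative_gen_G[OF s z]])
    then have "deriv (gen_G l s) z * gen_quad s z = of_real (- l) * (2 * z - 2 * of_real s) * (Q * gen_quad s z)"
      by (simp only: mult_ac)
    then have "deriv (gen_G l s) z * gen_quad s z = of_real (- l) * (2 * z - 2 * of_real s) * gen_G l s z"
      by (simp only: Q)
    then show ?case by (simp add: gen_quad_def algebra_simps)
  qed
  from iffD2[OF has_fps_expansion_cong[OF this refl] 2]
  have "fps_expansion (\<lambda>z. deriv (gen_G l s) z * (1 - 2 * of_real s * z + z ^ 2)) 0 = r * F"
    by (rule fps_expansion_eqI)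
  with fps_expansion_eqI[OF 1] have eq: "fps_deriv F * q = r * F" by simp
  have rec0: "fps_nth F (Suc 0) = 2 * of_real l * of_real s * fps_nth F 0"
    using arg_cong[OF eq, of "\<lambda>F. fps_nth F 0"] by (simp add: q_def r_def fps_mult_nth_0)
  have rec: "of_nat (k + 2) * fps_nth F (Suc (Suc k)) =
      2 * of_real s * (of_nat k + 1 + of_real l) * fps_nth F (Suc k) - (of_nat k + 2 * of_real l) * fps_nth F k" for k
  proof -
    have fst: "fps_nth (fps_deriv F * q) (Suc k) = of_nat (k + 2) * fps_nth F (Suc (Suc k))
       - 2 * of_real s * (of_nat (Suc k) * fps_nth F (Suc k)) + of_nat k * fps_nth F k"
    proof -
      have e: "fps_deriv F * q = fps_deriv F - fps_const (2 * of_real s) * (fps_X * fps_deriv F) + fps_X * (fps_X * fps_deriv F)"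
        by (simp add: q_def algebra_simps power2_eq_square)
      show ?thesis unfolding e by (cases k) (simp_all add: algebra_simps)
    qed
    have snd: "fps_nth (r * F) (Suc k) = 2 * of_real l * of_real s * fps_nth F (Suc k) - 2 * of_real l * fps_nth F k"
    proof -
      have "r * F = fps_const (2 * of_real l * of_real s) * F - fps_const (2 * of_real l) * (fps_X * F)"
        by (simp add: r_def algebra_simps)
      then show ?thesis by simp
    qed
    have "of_nat (k + 2) * fps_nth F (Suc (Suc k)) -
        (2 * of_real s * (of_nat k + 1 + of_real l) * fps_nth F (Suc k) - (of_nat k + 2 * of_real l) * fps_nth F k) =
        fps_nth (fps_deriv F * q) (Suc k) - fps_nth (r * F) (Suc k)"
      unfolding fst snd by (simp add: algebra_simps)
    then show ?thesis unfolding eq by simp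
  qed
  have F0: "fps_nth F 0 = 1"
  proof -
    have "fps_nth F 0 = gen_G l s 0" unfolding F_def fps_expansion_def by simp
    then show ?thesis by (simp add: gen_G_def gen_quad_def)
  qed
  have "fps_nth F k = of_real (gegen l s 1 k)" for k
  proof (induction k rule: less_induct)
    case (less k)
    consider "k = 0" | "k = 1" | j where "k = Suc (Suc j)" by (metis One_nat_def nat.exhaust)
    then show ?case
    proof cases
      case 3
      have n: "(of_nat (j + 2) :: complex) \<noteq> 0" by (metis of_nat_eq_0_iff add_2_eq_Suc' nat.distinct(1))
      have "fps_nth F k = (of_nat (j + 2) * fps_nth F (Suc (Suc j))) / of_nat (j + 2)" using n 3 by simp
      also have "\<dots> = of_real (gegen l s 1 k)"
        unfolding rec using less.IH[of j] less.IH[of "Suc j"] 3 by simp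
      finally show ?thesis .
    qed (auto simp: F0 rec0)
  qed
  then have "F = Abs_fps (\<lambda>k. of_real (gegen l s 1 k))" by (simp add: fps_eq_iff)
  with F show ?thesis by simp
qed

lemma gen_F_fps:
  assumes s: "\<bar>s\<bar> \<le> 1"
  shows "gen_F l s has_fps_expansion Abs_fps (\<lambda>k. of_real (zon l s 1 k))"
proof -
  have "gen_F l s has_fps_expansion (1 - fps_X ^ 2) * Abs_fps (\<lambda>k. of_real (gegen l s 1 k))"
    unfolding gen_F_def [abs_def] by (intro fps_expansion_intros gen_G_fps s)
  also have "(1 - fps_X ^ 2) * Abs_fps (\<lambda>k. of_real (gegen l s 1 k)) =
      (Abs_fps (\<lambda>k. of_real (zon l s 1 k)) :: complex fps)"
  proof (rule fps_ext)
    fix k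
    have "fps_nth (fps_X ^ 2 * Abs_fps (\<lambda>k. of_real (gegen l s 1 k))) k =
        (if k < 2 then 0 else of_real (gegen l s 1 (k - 2)) :: complex)"
      by (subst fps_X_power_mult_nth) simp
    then show "fps_nth ((1 - fps_X ^ 2) * Abs_fps (\<lambda>k. of_real (gegen l s 1 k))) k =
        fps_nth (Abs_fps (\<lambda>k. of_real (zon l s 1 k) :: complex)) k"
      by (simp add: left_diff_distrib zon_def)
  qed
  finally show ?thesis .
qed

text \<open>Each factor l + i + z d/dz multiplies the coefficient of z^k by k + l + i, so
  \<open>j\<close> factors produce a Pochhammer symbol. For j = \<beta> + 1 and l = n/2 it is the
  Gamma quotient of the Bergman kernel up to the constant Gamma(\<beta> + 1).\<close>

primrec euler_op :: "real \<Rightarrow> nat \<Rightarrow> (complex \<Rightarrow> complex) \<Rightarrow> complex \<Rightarrow> complex" where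
  "euler_op l 0 f = f"
| "euler_op l (Suc j) f = (\<lambda>z. of_real (l + real j) * euler_op l j f z + z * deriv (euler_op l j f) z)"

lemma holomorphic_euler_op:
  assumes "f holomorphic_on ball 0 1"
  shows "euler_op l j f holomorphic_on ball 0 1"
  by (induction j) (auto intro!: holomorphic_intros assms)

lemma euler_op_fps:
  assumes "f has_fps_expansion Abs_fps a"
  shows "euler_op l j f has_fps_expansion Abs_fps (\<lambda>k. of_real (pochhammer (real k + l) j) * a k)"
proof (induction j)
  case (Suc j)
  let ?A = "Abs_fps (\<lambda>k. of_real (pochhammer (real k + l) j) * a k)"
  have "euler_op l (Suc j) f has_fps_expansion fps_const (of_real (l + real j)) * ?A + fps_X * fps_deriv ?A"
    unfolding euler_op.simps by (intro fps_expansion_intros Suc)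
  also have "fps_const (of_real (l + real j)) * ?A + fps_X * fps_deriv ?A =
      Abs_fps (\<lambda>k. of_real (pochhammer (real k + l) (Suc j)) * a k)"
  proof (rule fps_ext)
    fix k show "fps_nth (fps_const (of_real (l + real j)) * ?A + fps_X * fps_deriv ?A) k =
        fps_nth (Abs_fps (\<lambda>k. of_real (pochhammer (real k + l) (Suc j)) * a k)) k"
      by (cases k) (simp_all add: pochhammer_Suc algebra_simps)
  qed
  finally show ?case .
qed (use assms in simp)

lemma euler_op_sums:
  assumes "f holomorphic_on ball 0 1" "f has_fps_expansion Abs_fps a" "norm z < 1"
  shows "(\<lambda>k. of_real (pochhammer (real k + l) j) * a k * z ^ k) sums euler_op l j f z"
proof -
  have "eball (0::complex) 1 = ball 0 1" by (metis eball_ereal one_ereal_def)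
  then have "euler_op l j f holomorphic_on eball 0 1" using holomorphic_euler_op[OF assms(1), of l j] by simp
  from has_fps_expansion_imp_sums_complex[OF euler_op_fps[OF assms(2)] this] show ?thesis
    using assms(3) by (simp add: one_ereal_def)
qed

text \<open>The series is an Euler operator applied to the geometric series, so it converges in the
  whole disc.\<close>

lemma summable_pochhammer_power:
  assumes "0 \<le> q" "q < 1"
  shows "summable (\<lambda>k. pochhammer (real k + l) j * q ^ k)"
proof -
  have "(\<lambda>z. 1 / (1 - z)) holomorphic_on ball (0::complex) 1"
    by (auto intro!: holomorphic_intros)
  moreover have "(\<lambda>z::complex. 1 / (1 - z)) has_fps_expansion Abs_fps (\<lambda>k. 1)"
  proof (rule has_fps_expansionI)
    have "eventually (\<lambda>z. z \<in> ball (0::complex) 1) (nhds 0)" by (intro eventually_nhds_in_open) auto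
    then show "eventually (\<lambda>z. (\<lambda>n. fps_nth (Abs_fps (\<lambda>k. 1)) n * z ^ n) sums (1 / (1 - z))) (nhds (0::complex))"
      by eventually_elim (use geometric_sums in auto)
  qed
  ultimately have "summable (\<lambda>k. of_real (pochhammer (real k + l) j) * 1 * (of_real q :: complex) ^ k)"
    using assms by (intro sums_summable[OF euler_op_sums]) auto
  then have "summable (\<lambda>k. complex_of_real (pochhammer (real k + l) j * q ^ k))" by simp
  then show ?thesis by (simp only: summable_complex_of_real)
qed

text \<open>A majorant, up to a constant, that is stable under Cauchy estimates: the factor 1 + z of
  the kernel is bounded by 2 and dropped. At a real radius R in [0, 1) it does not exceed the
  Poisson kernel.\<close>

definition gen_bound :: "real \<Rightarrow> real \<Rightarrow> complex \<Rightarrow> real" where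
  "gen_bound l s z = norm (1 - z) * norm (gen_quad s z) powr (- l)"

text \<open>Both roots lie on the unit circle, at distance at least 1 - |z| from \<open>z\<close>,
  so a move by half of that leaves each linear factor at least half its size.\<close>

lemma norm_gen_quad_half:
  assumes s: "\<bar>s\<bar> \<le> 1" and z: "norm z < 1" and x: "norm (x - z) \<le> (1 - norm z) / 2"
  shows "norm (gen_quad s z) / 4 \<le> norm (gen_quad s x)"
proof -
  have x2: "2 * norm (x - z) \<le> 1 - norm z" using x by simp
  have half: "norm (z - v) / 2 \<le> norm (x - v)" if "norm v = 1" for v
  proof -
    have "1 - norm z \<le> norm (z - v)" using norm_triangle_ineq2[of v z] that by (simp add: norm_minus_commute)
    moreover have "norm (z - v) \<le> norm (x - z) + norm (x - v)"
      using norm_triangle_ineq[of "z - x" "x - v"] by (simp add: norm_minus_commute)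
    ultimately show ?thesis using x2 by linarith
  qed
  obtain w where w: "norm w = 1" "\<And>z. gen_quad s z = (z - w) * (z - cnj w)"
    by (rule gen_quad_factor[OF s]) blast
  have "norm (z - w) / 2 * (norm (z - cnj w) / 2) \<le> norm (x - w) * norm (x - cnj w)"
    using w(1) by (intro mult_mono half) auto
  then show ?thesis by (simp add: w(2) norm_mult)
qed

text \<open>The 3/2 comes from |1 - x| \<le> |1 - z| + (1 - |z|)/2, the power of 4 from the quarter
  in \<open>norm_gen_quad_half\<close>.\<close>

lemma gen_bound_half:
  assumes l: "0 \<le> l" and s: "\<bar>s\<bar> \<le> 1" and z: "norm z < 1" and x: "norm (x - z) \<le> (1 - norm z) / 2"
  shows "gen_bound l s x \<le> 3 / 2 * 4 powr l * gen_bound l s z"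
proof -
  have x2: "2 * norm (x - z) \<le> 1 - norm z" using x by simp
  have "1 - norm z \<le> norm (1 - z)" using norm_triangle_ineq2[of 1 z] by simp
  moreover have "norm (1 - x) \<le> norm (1 - z) + norm (x - z)"
    using norm_triangle_ineq[of "1 - z" "z - x"] by (simp add: norm_minus_commute)
  ultimately have 1: "norm (1 - x) \<le> 3 / 2 * norm (1 - z)" using x2 by linarith
  have q: "norm (gen_quad s z) > 0" using gen_quad_nonpos[OF s z] by auto
  then have "norm (gen_quad s x) powr (- l) \<le> (norm (gen_quad s z) / 4) powr (- l)"
    using l norm_gen_quad_half[OF s z x] by (intro powr_mono2') auto
  also have "\<dots> = 4 powr l * norm (gen_quad s z) powr (- l)"
    using q by (simp add: powr_divide powr_minus field_simps)
  finally have 2: "norm (gen_quad s x) powr (- l) \<le> 4 powr l * norm (gen_quad s z) powr (- l)" .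
  have "gen_bound l s x \<le> (3 / 2 * norm (1 - z)) * (4 powr l * norm (gen_quad s z) powr (- l))"
    unfolding gen_bound_def by (intro mult_mono 1 2) auto
  then show ?thesis by (simp add: gen_bound_def mult_ac)
qed

lemma gen_bound_nonneg: "gen_bound l s z \<ge> 0"
  by (simp add: gen_bound_def)

text \<open>
  Cauchy's inequality on the disc of radius \<open>(1 - |z|)/2\<close>: there the bound changes only by a
  constant factor.
\<close>
lemma euler_op_gen_F_bound:
  assumes l: "0 \<le> l"
  shows "\<exists>C>0. \<forall>s z. \<bar>s\<bar> \<le> 1 \<longrightarrow> norm z < 1 \<longrightarrow>
           norm (euler_op l j (gen_F l s) z) \<le> C * gen_bound l s z / (1 - norm z) ^ j"
proof (induction j)
  case 0
  have "norm (gen_F l s z) \<le> 2 * gen_bound l s z" if "norm z < 1" for s z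
  proof -
    have "1 - z\<^sup>2 = (1 - z) * (1 + z)" by (simp add: power2_eq_square algebra_simps)
    then have "norm (1 - z\<^sup>2) = norm (1 - z) * norm (1 + z)" by (simp add: norm_mult)
    also have "\<dots> \<le> norm (1 - z) * 2"
      using norm_triangle_ineq[of 1 z] that by (intro mult_left_mono) auto
    finally have "norm (1 - z\<^sup>2) * norm (gen_quad s z) powr (- l) \<le> norm (1 - z) * 2 * norm (gen_quad s z) powr (- l)"
      by (rule mult_right_mono) simp
    then show ?thesis
      by (simp add: gen_F_def gen_G_def gen_bound_def norm_mult norm_powr_real_powr' mult_ac)
  qed
  then show ?case by (intro exI[of _ 2]) auto
next
  case (Suc j)
  then obtain C where C: "C > 0" "\<And>s z. \<bar>s\<bar> \<le> 1 \<Longrightarrow> norm z < 1 \<Longrightarrow>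
      norm (euler_op l j (gen_F l s) z) \<le> C * gen_bound l s z / (1 - norm z) ^ j" by blast
  \<comment> \<open>The growth of the majorant on the Cauchy circle, times 2^j because 1 - |x| is at
    least half of 1 - |z| there.\<close>
  define K where "K = 3 / 2 * 4 powr l * 2 ^ j"
  have K: "K > 0" by (simp add: K_def)
  \<comment> \<open>The first summand stems from multiplication by l + j, the second from the
    derivative, where Cauchy's radius (1 - |z|)/2 contributes the 2 and one more power in the
    denominator.\<close>
  have "norm (euler_op l (Suc j) (gen_F l s) z) \<le>
      ((l + j) * C + 2 * C * K) * gen_bound l s z / (1 - norm z) ^ Suc j"
    if s: "\<bar>s\<bar> \<le> 1" and z: "norm z < 1" for s z
  proof -
    let ?f = "euler_op l j (gen_F l s)" and ?B = "gen_bound l s z"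
    define r where "r = (1 - norm z) / 2"
    have r: "r > 0" using z by (simp add: r_def)
    have inb: "norm x < 1 \<and> r \<le> 1 - norm x" if "norm (x - z) \<le> r" for x
      using that norm_triangle_ineq2[of x z] z by (simp add: r_def field_simps)
    have hol: "?f holomorphic_on ball 0 1" by (intro holomorphic_euler_op holomorphic_gen_F s)
    have sub: "cball z r \<subseteq> ball 0 1" using inb by (auto simp: dist_norm norm_minus_commute)
    have "norm ((deriv ^^ 1) ?f z) \<le> fact 1 * (C * K * ?B / (1 - norm z) ^ j) / r ^ 1"
    proof (rule Cauchy_inequality)
      show "?f holomorphic_on ball z r" using hol sub by (meson ball_subset_cball holomorphic_on_subset subset_trans)
      show "continuous_on (cball z r) ?f"
        using hol sub by (meson continuous_on_subset holomorphic_on_imp_continuous_on)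
      show "r > 0" by (rule r)
      fix x assume "norm (z - x) = r"
      then have x: "norm (x - z) \<le> (1 - norm z) / 2" by (simp add: norm_minus_commute r_def)
      then have x1: "norm x < 1" "r \<le> 1 - norm x" using inb[of x] by (auto simp: r_def)
      have "norm (?f x) \<le> C * gen_bound l s x / (1 - norm x) ^ j" by (rule C(2)[OF s x1(1)])
      also have "\<dots> \<le> C * (3 / 2 * 4 powr l * ?B) / r ^ j"
        using C(1) r x1 by (intro frac_le mult_left_mono mult_nonneg_nonneg power_mono gen_bound_half[OF l s z x])
          (auto intro: gen_bound_nonneg)
      also have "\<dots> = C * K * ?B / (1 - norm z) ^ j"
        by (simp add: r_def K_def power_divide)
      finally show "norm (?f x) \<le> C * K * ?B / (1 - norm z) ^ j" .
    qed
    also have "\<dots> = 2 * C * K * ?B / (1 - norm z) ^ Suc j"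
      using r by (simp add: r_def field_simps)
    finally have d: "norm (deriv ?f z) \<le> 2 * C * K * ?B / (1 - norm z) ^ Suc j" by simp
    have "norm (?f z) \<le> C * ?B / (1 - norm z) ^ j" by (rule C(2)[OF s z])
    also have "\<dots> \<le> C * ?B / (1 - norm z) ^ Suc j"
      using C(1) z gen_bound_nonneg[of l s z] by (intro divide_left_mono mult_nonneg_nonneg mult_pos_pos)
        (auto simp: mult_left_le_one_le)
    finally have f: "norm (?f z) \<le> C * ?B / (1 - norm z) ^ Suc j" .
    have "norm (euler_op l (Suc j) (gen_F l s) z) \<le> norm (of_real (l + real j) * ?f z) + norm (z * deriv ?f z)"
      unfolding euler_op.simps by (rule norm_triangle_ineq)
    also have "\<dots> \<le> (l + j) * (C * ?B / (1 - norm z) ^ Suc j) + 1 * (2 * C * K * ?B / (1 - norm z) ^ Suc j)"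
    proof -
      have "norm (complex_of_real (l + real j)) = l + real j" using l unfolding norm_of_real by simp
      then show ?thesis unfolding norm_mult using l z by (intro add_mono mult_mono f d; simp)
    qed
    finally show ?thesis by (simp add: algebra_simps add_divide_distrib)
  qed
  moreover have "(l + j) * C + 2 * C * K > 0" using l C K by (intro add_nonneg_pos) auto
  ultimately show ?case by blast
qed

lemma gen_bound_le:
  assumes l: "0 \<le> l" and s: "\<bar>s\<bar> \<le> 1" and z: "norm z < 1"
  shows "gen_bound l s z \<le> 2 * ((1 - norm z)\<^sup>2) powr (- l)"
proof -
  obtain w where w: "norm w = 1" "\<And>z. gen_quad s z = (z - w) * (z - cnj w)"
    by (rule gen_quad_factor[OF s]) blast
  have "1 - norm z \<le> norm (z - v)" if "norm v = 1" for v
    using norm_triangle_ineq2[of v z] that by (simp add: norm_minus_commute)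
  then have "(1 - norm z) * (1 - norm z) \<le> norm (z - w) * norm (z - cnj w)"
    using w(1) z by (intro mult_mono) auto
  then have "(1 - norm z)\<^sup>2 \<le> norm (gen_quad s z)" by (simp add: w(2) norm_mult power2_eq_square)
  then have "norm (gen_quad s z) powr (- l) \<le> ((1 - norm z)\<^sup>2) powr (- l)"
    using l z by (intro powr_mono2') auto
  moreover have "norm (1 - z) \<le> 2" using norm_triangle_ineq4[of 1 z] z by simp
  ultimately show ?thesis unfolding gen_bound_def by (intro mult_mono) auto
qed

text \<open>Cauchy's inequality for \<open>gen_F\<close> on the circle of radius \<open>r\<close>.
  Uniformity in \<open>s\<close> is what permits termwise integration over the sphere.\<close>

lemma zon_bound:
  assumes l: "0 \<le> l" and r: "0 < r" "r < 1"
  shows "\<exists>M>0. \<forall>s k. \<bar>s\<bar> \<le> 1 \<longrightarrow> \<bar>zon l s 1 k\<bar> \<le> M / r ^ k"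
proof -
  obtain C where C: "C > 0" "\<And>s z. \<bar>s\<bar> \<le> 1 \<Longrightarrow> norm z < 1 \<Longrightarrow>
      norm (gen_F l s z) \<le> C * gen_bound l s z"
    using euler_op_gen_F_bound[OF l, of 0] by auto
  define M where "M = C * (2 * ((1 - r)\<^sup>2) powr (- l))"
  have "\<bar>zon l s 1 k\<bar> \<le> M / r ^ k" if s: "\<bar>s\<bar> \<le> 1" for s k
  proof -
    have hol: "gen_F l s holomorphic_on ball 0 1" by (rule holomorphic_gen_F[OF s])
    have "fps_expansion (gen_F l s) 0 = Abs_fps (\<lambda>k. of_real (zon l s 1 k))"
      by (rule fps_expansion_eqI[OF gen_F_fps[OF s]])
    from arg_cong[OF this, of "\<lambda>F. fps_nth F k"]
    have coeff: "(deriv ^^ k) (gen_F l s) 0 = fact k * of_real (zon l s 1 k)"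
      by (simp add: fps_expansion_def field_simps)
    have "norm ((deriv ^^ k) (gen_F l s) 0) \<le> fact k * M / r ^ k"
    proof (rule Cauchy_inequality)
      have sub: "cball 0 r \<subseteq> ball (0::complex) 1" using r by auto
      show "gen_F l s holomorphic_on ball 0 r"
        using hol sub by (meson ball_subset_cball holomorphic_on_subset subset_trans)
      show "continuous_on (cball 0 r) (gen_F l s)"
        using hol sub by (meson continuous_on_subset holomorphic_on_imp_continuous_on)
      show "r > 0" by (rule r)
      fix x :: complex assume "norm (0 - x) = r"
      then have x: "norm x = r" by simp
      have "norm (gen_F l s x) \<le> C * gen_bound l s x" using x r by (intro C(2)[OF s]) simp
      also have "\<dots> \<le> M" unfolding M_def using gen_bound_le[OF l s, of x] x r C(1) by (intro mult_left_mono) auto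
      finally show "norm (gen_F l s x) \<le> M" .
    qed
    then have "fact k * \<bar>zon l s 1 k\<bar> \<le> fact k * (M / r ^ k)" by (simp add: coeff norm_mult)
    from mult_left_le_imp_le[OF this] show ?thesis by simp
  qed
  moreover have "M > 0" using C r by (simp add: M_def)
  ultimately show ?thesis by blast
qed

lemma euler_op_gen_F_sums:
  assumes s: "\<bar>s\<bar> \<le> 1" and z: "norm z < 1"
  shows "(\<lambda>k. of_real (pochhammer (real k + l) j * zon l s 1 k) * z ^ k) sums euler_op l j (gen_F l s) z"
  using euler_op_sums[OF holomorphic_gen_F[OF s] gen_F_fps[OF s] z, of l j l] by simp

section \<open>Zonal and spherical harmonics\<close>

text \<open>\<open>j\<close> Euler factors applied to the Poisson kernel, restricted to real radii,
  where the coefficients make the values real. With l = n/2 and \<open>j = 0\<close> it is the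
  Poisson kernel itself.\<close>

definition kern :: "real \<Rightarrow> nat \<Rightarrow> real \<Rightarrow> real \<Rightarrow> real" where
  "kern l j s R = Re (euler_op l j (gen_F l s) (of_real R))"

lemma kern_sums:
  assumes "\<bar>s\<bar> \<le> 1" "0 \<le> R" "R < 1"
  shows "(\<lambda>k. pochhammer (real k + l) j * zon l s 1 k * R ^ k) sums kern l j s R"
  using sums_Re[OF euler_op_gen_F_sums[OF assms(1), of "of_real R" l j]] assms
  by (simp add: kern_def flip: of_real_power of_real_mult)

lemma kern_0:
  assumes "\<bar>s\<bar> \<le> 1" "0 \<le> R" "R < 1"
  shows "kern l 0 s R = (1 - R\<^sup>2) * (1 - 2 * s * R + R\<^sup>2) powr (- l)"
proof -
  have "0 < (1 - R)\<^sup>2" using assms by simp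
  also have "\<dots> \<le> 1 - 2 * s * R + R\<^sup>2"
    using mult_right_mono[of s 1 R] assms by (simp add: power2_eq_square algebra_simps)
  finally have "gen_F l s (of_real R) = of_real ((1 - R\<^sup>2) * (1 - 2 * s * R + R\<^sup>2) powr (- l))"
    unfolding gen_F_def gen_G_def gen_quad_of_real by (subst powr_of_real) simp_all
  then show ?thesis unfolding kern_def euler_op.simps by (metis Re_complex_of_real)
qed

lemma kern_bound:
  assumes l: "0 \<le> l"
  shows "\<exists>C>0. \<forall>s R. \<bar>s\<bar> \<le> 1 \<longrightarrow> 0 \<le> R \<longrightarrow> R < 1 \<longrightarrow>
    \<bar>kern l j s R\<bar> \<le> C * kern l 0 s R / (1 - R) ^ j"
proof -
  obtain C where C: "C > 0" "\<And>s z. \<bar>s\<bar> \<le> 1 \<Longrightarrow> norm z < 1 \<Longrightarrow>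
      norm (euler_op l j (gen_F l s) z) \<le> C * gen_bound l s z / (1 - norm z) ^ j"
    using euler_op_gen_F_bound[OF l, of j] by blast
  have "\<bar>kern l j s R\<bar> \<le> C * kern l 0 s R / (1 - R) ^ j" if s: "\<bar>s\<bar> \<le> 1" and R: "0 \<le> R" "R < 1" for s R
  proof -
    have q: "0 \<le> 1 - 2 * s * R + R\<^sup>2"
      using mult_right_mono[OF abs_le_D1[OF s] R(1)] zero_le_power2[of "1 - R"] by (simp add: power2_eq_square algebra_simps)
    have "1 - complex_of_real R = of_real (1 - R)" by simp
    then have "gen_bound l s (of_real R) = \<bar>1 - R\<bar> * \<bar>1 - 2 * s * R + R\<^sup>2\<bar> powr (- l)"
      by (simp only: gen_bound_def gen_quad_of_real norm_of_real)
    also have "\<dots> = (1 - R) * (1 - 2 * s * R + R\<^sup>2) powr (- l)" using q R by simp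
    also have "\<dots> \<le> (1 - R\<^sup>2) * (1 - 2 * s * R + R\<^sup>2) powr (- l)"
      using R by (intro mult_right_mono) (auto simp: power2_eq_square mult_left_le)
    finally have b: "gen_bound l s (of_real R) \<le> kern l 0 s R" by (simp only: kern_0[OF s R])
    have "\<bar>kern l j s R\<bar> \<le> norm (euler_op l j (gen_F l s) (of_real R))"
      unfolding kern_def by (rule abs_Re_le_cmod)
    also have "\<dots> \<le> C * gen_bound l s (of_real R) / (1 - R) ^ j" using C(2)[OF s, of "of_real R"] R by simp
    also have "\<dots> \<le> C * kern l 0 s R / (1 - R) ^ j"
      using C(1) R b by (intro divide_right_mono mult_left_mono) auto
    finally show ?thesis .
  qed
  with C(1) show ?thesis by blast
qed

lemma abs_inner_le_1: "norm x \<le> 1 \<Longrightarrow> norm y \<le> 1 \<Longrightarrow> \<bar>x \<bullet> y\<bar> \<le> 1"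
  by (meson Cauchy_Schwarz_ineq2 mult_le_one norm_ge_zero order_trans)

lemma poisson_eq_kern:
  fixes x z :: "'a::euclidean_space"
  assumes "norm x = 1" "norm z = 1" "0 \<le> R" "R < 1"
  shows "poisson (R *\<^sub>R x) z = kern (DIM('a) / 2) 0 (x \<bullet> z) R"
proof -
  have "x \<bullet> x = 1" "z \<bullet> z = 1" using assms by (simp_all flip: power2_norm_eq_inner)
  then have "(R *\<^sub>R x - z) \<bullet> (R *\<^sub>R x - z) = 1 - 2 * (x \<bullet> z) * R + R\<^sup>2"
    by (simp add: inner_diff_left inner_diff_right inner_commute[of z x] power2_eq_square algebra_simps)
  then show ?thesis
    using \<open>x \<bullet> x = 1\<close> assms by (simp add: poisson_def kern_0 abs_inner_le_1 power2_eq_square)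
qed

text \<open>Once the lower coefficients of the difference are gone, division by R^k exposes the next
  one as the limit at 0, and this limit can be taken along positive reals.\<close>

lemma real_power_series_unique:
  fixes a b :: "nat \<Rightarrow> complex"
  assumes \<delta>: "\<delta> > 0"
    and a: "\<And>R. 0 < R \<Longrightarrow> R < \<delta> \<Longrightarrow> (\<lambda>k. a k * of_real R ^ k) sums g R"
    and b: "\<And>R. 0 < R \<Longrightarrow> R < \<delta> \<Longrightarrow> (\<lambda>k. b k * of_real R ^ k) sums g R"
  shows "a k = b k"
proof -
  define c where "c = (\<lambda>k. a k - b k)"
  have c: "(\<lambda>k. c k * of_real R ^ k) sums 0" if "0 < R" "R < \<delta>" for R :: real
    using sums_diff[OF a[OF that] b[OF that]] by (simp add: c_def left_diff_distrib)
  have "c k = 0"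
  proof (induction k rule: less_induct)
    case (less k)
    define d where "d = (\<lambda>i. c (i + k))"
    have d: "(\<lambda>i. d i * of_real R ^ i) sums 0" if R: "0 < R" "R < \<delta>" for R :: real
    proof -
      have "(\<lambda>i. c (i + k) * of_real R ^ (i + k)) sums (0 - (\<Sum>i<k. c i * of_real R ^ i))"
        by (rule sums_split_initial_segment[OF c[OF R]])
      then have "(\<lambda>i. (d i * of_real R ^ i) * complex_of_real (R ^ k)) sums 0"
        using less.IH by (simp add: d_def power_add mult.assoc)
      from sums_divide[OF this, of "complex_of_real (R ^ k)"] R show ?thesis by simp
    qed
    define f where "f x = (\<Sum>i. d i * x ^ i)" for x
    have "(\<lambda>i. d i * x ^ i) sums f x" if "norm x < \<delta> / 2" for x :: complex
      unfolding f_def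
      by (rule summable_sums, rule powser_inside[OF sums_summable[OF d[of "\<delta> / 2"]]]) (use \<delta> that in auto)
    then have "(f \<longlongrightarrow> d 0) (at 0)" by (rule powser_limit_0[OF half_gt_zero[OF \<delta>]])
    \<comment> \<open>A sequence of radii in (0, \<delta>) tending to 0, along which the sum is
      known to vanish.\<close>
    moreover have "filterlim (\<lambda>n. complex_of_real (\<delta> / real (n + 3))) (at 0) sequentially"
    proof (rule filterlim_atI)
      have "(\<lambda>n. \<delta> / real (n + 3)) \<longlonglongrightarrow> 0" by real_asymp
      from tendsto_of_real[OF this, where 'a = complex] show "(\<lambda>n. complex_of_real (\<delta> / real (n + 3))) \<longlonglongrightarrow> 0" by simp
      have "complex_of_real (\<delta> / real (n + 3)) \<noteq> 0" for n
        unfolding of_real_eq_0_iff using \<delta> by simp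
      then show "\<forall>\<^sub>F n in sequentially. complex_of_real (\<delta> / real (n + 3)) \<noteq> 0"
        by (intro always_eventually allI)
    qed
    ultimately have "(\<lambda>n. f (complex_of_real (\<delta> / real (n + 3)))) \<longlonglongrightarrow> d 0"
      by (rule filterlim_compose)
    moreover have "f (complex_of_real (\<delta> / real (n + 3))) = 0" for n
      unfolding f_def by (rule sums_unique[symmetric], rule d) (use \<delta> in \<open>auto simp: field_simps intro!: add_nonneg_pos\<close>)
    ultimately show ?case by (simp add: d_def LIMSEQ_const_iff)
  qed
  then show ?thesis by (simp add: c_def)
qed

lemma zon_0 [simp]: "zon l s N 0 = 1"
  by (simp add: zon_def)

lemma continuous_on_gegen [continuous_intros]:
  assumes "continuous_on A f" "continuous_on A g"
  shows "continuous_on A (\<lambda>x. gegen l (f x) (g x) k)"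
  by (induction k rule: induct_nat_012) (auto intro!: continuous_intros assms)

lemma continuous_on_zon [continuous_intros]:
  assumes "continuous_on A f" "continuous_on A g"
  shows "continuous_on A (\<lambda>x. zon l (f x) (g x) k)"
  unfolding zon_def by (cases "k < 2") (auto intro!: continuous_intros assms)

lemma integral_kern_sums:
  fixes \<phi> :: "'a::euclidean_space \<Rightarrow> complex"
  assumes l: "0 \<le> l" and x: "norm x = 1" and R: "0 \<le> R" "R < 1" and \<phi>: "continuous_on (sphere 0 1) \<phi>"
  shows "(\<lambda>k. of_real (pochhammer (real k + l) j * R ^ k) * (LINT z|sph. of_real (zon l (x \<bullet> z) 1 k) * \<phi> z))
     sums (LINT z|sph. of_real (kern l j (x \<bullet> z) R) * \<phi> z)"
proof -
  \<comment> \<open>A radius strictly between \<open>R\<close> and 1: the coefficients are bounded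
    by M / r^k, and the decay of (R/r)^k still beats the Pochhammer factor.\<close>
  define r where "r = (1 + R) / 2"
  have r: "0 < r" "r < 1" "R < r" using R by (auto simp: r_def)
  obtain M where M: "M > 0" "\<And>s k. \<bar>s\<bar> \<le> 1 \<Longrightarrow> \<bar>zon l s 1 k\<bar> \<le> M / r ^ k"
    using zon_bound[OF l r(1,2)] by blast
  obtain B where B: "\<And>z. z \<in> sphere 0 1 \<Longrightarrow> norm (\<phi> z) \<le> B"
    using compact_imp_bounded[OF compact_continuous_image[OF \<phi> compact_sphere]]
    unfolding bounded_iff by (metis imageI)
  define f where "f k z = complex_of_real (pochhammer (real k + l) j * zon l (x \<bullet> z) 1 k * R ^ k) * \<phi> z" for k z
  define c where "c k = pochhammer (real k + l) j * (R / r) ^ k * (M * B)" for k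
  have s1: "\<bar>x \<bullet> z\<bar> \<le> 1" if "z \<in> sphere 0 1" for z
    using that x by (intro abs_inner_le_1) auto
  have p: "pochhammer (real k + l) j \<ge> 0" for k using l by (auto simp: pochhammer_prod intro!: prod_nonneg)
  have fb: "norm (f k z) \<le> c k" if z: "z \<in> sphere 0 1" for k z
  proof -
    have "norm (f k z) = pochhammer (real k + l) j * R ^ k * (\<bar>zon l (x \<bullet> z) 1 k\<bar> * norm (\<phi> z))"
      using p R by (simp add: f_def norm_mult abs_mult norm_power)
    also have "\<dots> \<le> pochhammer (real k + l) j * R ^ k * ((M / r ^ k) * B)"
      using p R M r z by (intro mult_left_mono mult_mono M(2) s1 B) auto
    also have "\<dots> = c k" by (simp add: c_def power_divide)
    finally show ?thesis .
  qed
  have sc: "summable c" unfolding c_def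
    using R r by (intro summable_mult2 summable_pochhammer_power) auto
  have cf: "continuous_on (sphere 0 1) (f k)" for k
    unfolding f_def [abs_def] by (intro continuous_intros \<phi>)
  have intf: "integrable sph (f k)" for k by (rule integrable_sph_continuous[OF cf])
  have "(\<lambda>k. LINT z|sph. f k z) sums (LINT z|sph. (\<Sum>k. f k z))"
  proof (rule sums_integral[OF intf])
    show "AE z in sph. summable (\<lambda>k. norm (f k z))"
      by (rule AE_I2, rule summable_comparison_test'[OF sc]) (use fb in auto)
    show "summable (\<lambda>k. LINT z|sph. norm (f k z))"
    proof (rule summable_comparison_test'[OF summable_mult2[OF sc, of "sph_area TYPE('a)"]])
      fix k
      have "norm (LINT z|sph. norm (f k z)) \<le> c k * sph_area TYPE('a)"
        by (rule norm_integral_sph_le) (auto intro!: continuous_on_norm cf fb simp del: mem_sphere_0)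
      then show "norm (LINT z|sph. norm (f k z)) \<le> c k * sph_area TYPE('a)" .
    qed
  qed
  moreover have "(LINT z|sph. f k z) = of_real (pochhammer (real k + l) j * R ^ k) *
      (LINT z|sph. of_real (zon l (x \<bullet> z) 1 k) * \<phi> z)" for k
  proof -
    have "(LINT z|sph. f k z) = (LINT z|sph. of_real (pochhammer (real k + l) j * R ^ k) *
        (of_real (zon l (x \<bullet> z) 1 k) * \<phi> z))"
      by (simp add: f_def mult_ac)
    then show ?thesis by (simp only: integral_mult_right_zero)
  qed
  moreover have "(LINT z|sph. (\<Sum>k. f k z)) = (LINT z|sph. of_real (kern l j (x \<bullet> z) R) * \<phi> z)"
  proof (rule Bochner_Integration.integral_cong[OF refl])
    fix z assume "z \<in> space (sph :: 'a measure)"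
    then have "\<bar>x \<bullet> z\<bar> \<le> 1" by (intro s1) simp
    from sums_mult2[OF sums_of_real[OF kern_sums[OF this R]]]
    have "(\<lambda>k. f k z) sums (of_real (kern l j (x \<bullet> z) R) * \<phi> z)" unfolding f_def .
    then show "(\<Sum>k. f k z) = of_real (kern l j (x \<bullet> z) R) * \<phi> z" by (rule sums_unique[symmetric])
  qed
  ultimately show ?thesis by simp
qed

lemma harmonic_expansion:
  fixes u :: "'a::euclidean_space \<Rightarrow> complex"
  assumes h: "harmonic_on u (ball 0 1)" and c: "continuous_on (cball 0 1) u"
    and x: "norm x = 1" and R: "0 \<le> R" "R < 1"
  shows "(\<lambda>k. (LINT z|sph. of_real (zon (DIM('a) / 2) (x \<bullet> z) 1 k) * u z) * of_real R ^ k)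
     sums (of_real (sph_area TYPE('a)) * u (R *\<^sub>R x))"
proof -
  have cs: "continuous_on (sphere 0 1) u" using c by (rule continuous_on_subset) auto
  have "(LINT z|sph. of_real (kern (DIM('a) / 2) 0 (x \<bullet> z) R) * u z) = (LINT z|sph. poisson (R *\<^sub>R x) z * u z)"
    by (rule Bochner_Integration.integral_cong[OF refl]) (use x R in \<open>simp add: poisson_eq_kern\<close>)
  also have "\<dots> = of_real (sph_area TYPE('a)) * u (R *\<^sub>R x)"
    by (rule poisson_formula[OF h c]) (use x R in simp)
  finally show ?thesis
    using integral_kern_sums[OF _ x R cs, of "DIM('a) / 2" 0] by (simp add: mult.commute)
qed

section \<open>Zonal polynomials\<close>

lemma real_polynomial_function_inner_left: "real_polynomial_function (\<lambda>x::'a::euclidean_space. x \<bullet> z)"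
  by (intro real_polynomial_function.intros(1) bounded_linear_inner_left)

lemma real_polynomial_function_zon:
  fixes z :: "'a::euclidean_space"
  shows "real_polynomial_function (\<lambda>x. zon l (x \<bullet> z) (x \<bullet> x) k)"
proof -
  have N: "real_polynomial_function (\<lambda>x::'a. x \<bullet> x)"
    by (subst euclidean_inner)
      (intro real_polynomial_function_sum real_polynomial_function.intros(4) real_polynomial_function_inner_left finite_Basis)
  have g: "real_polynomial_function (\<lambda>x. gegen l (x \<bullet> z) (x \<bullet> x) k)" for k
    by (induction k rule: induct_nat_012)
      (auto intro!: real_polynomial_function_divide real_polynomial_function_diff real_polynomial_function.intros(2-4)
        real_polynomial_function_inner_left N)
  show ?thesis
  proof (cases "k < 2")
    case True
    then show ?thesis using g[of k] by (simp add: zon_def)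
  next
    case False
    then show ?thesis unfolding zon_def
      by (simp, intro real_polynomial_function_diff real_polynomial_function.intros(4) g N)
  qed
qed

lemma polynomial_function_bounded_linear_image:
  assumes "bounded_linear L" "polynomial_function q"
  shows "polynomial_function (\<lambda>x. L (q x))"
  using polynomial_function_compose[OF assms(2) polynomial_function_bounded_linear[OF assms(1)]]
  by (simp add: o_def)

lemma harmonic_on_poisson:
  fixes z :: "'a::euclidean_space"
  assumes z: "norm z = 1"
  shows "harmonic_on (\<lambda>x. poisson x z) (ball 0 1)"
  unfolding harmonic_on_jet
proof (rule exI[of _ "\<lambda>b x. poisson1 b x z"], rule exI[of _ "\<lambda>b c x. poisson2 b c x z"],
    unfold harmonic_jet_def, intro conjI ballI)
  fix x :: 'a assume "x \<in> ball 0 1"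
  then have ne: "x \<noteq> z" using z by auto
  show "((\<lambda>x. poisson x z) has_derivative (\<lambda>h. \<Sum>b\<in>Basis. (h \<bullet> b) *\<^sub>R poisson1 b x z)) (at x)"
    by (rule has_derivative_poisson[OF ne])
  show "(\<Sum>b\<in>Basis. poisson2 b b x z) = 0" by (rule poisson2_trace[OF z ne])
  show "((\<lambda>x. poisson1 b x z) has_derivative (\<lambda>h. \<Sum>c\<in>Basis. (h \<bullet> c) *\<^sub>R poisson2 b c x z)) (at x)" for b
    by (rule has_derivative_poisson1[OF ne])
next
  fix b c :: 'a
  have "continuous_on (ball 0 1 \<times> {z}) (\<lambda>(x, z). poisson2 b c x z)"
    by (rule continuous_on_poisson_aux(3)) (use z in auto)
  then have "continuous_on (ball 0 1) (\<lambda>x. (\<lambda>(x, z). poisson2 b c x z) (x, z))"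
    by (rule continuous_on_compose2) (auto intro!: continuous_intros)
  then show "continuous_on (ball 0 1) (\<lambda>x. poisson2 b c x z)" by simp
qed

text \<open>Compare powers of R in the Poisson formula for the function y \<mapsto> P(R y, z). This
  identifies the harmonic extension of a zonal function with its homogeneous polynomial.\<close>

lemma zon_poisson:
  fixes x z :: "'a::euclidean_space"
  assumes x: "norm x < 1" and z: "norm z = 1"
  shows "(LINT w|sph. of_real (zon (DIM('a) / 2) (z \<bullet> w) 1 k) * complex_of_real (poisson x w)) =
    of_real (sph_area TYPE('a)) * of_real (zon (DIM('a) / 2) (x \<bullet> z) (x \<bullet> x) k)"
proof (rule real_power_series_unique[of 1, where g = "\<lambda>R. of_real (sph_area TYPE('a)) * complex_of_real (poisson (R *\<^sub>R x) z)"])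
  let ?l = "DIM('a) / 2"
  fix R :: real assume R: "0 < R" "R < 1"
  have cp: "continuous_on (sphere 0 1) (\<lambda>w. complex_of_real (poisson x w))"
    by (intro continuous_intros continuous_on_poisson_slice x)
  have hp: "harmonic_on (\<lambda>x. complex_of_real (poisson x z)) (ball 0 1)"
    by (rule harmonic_on_linear_image[OF bounded_linear_of_real harmonic_on_poisson[OF z]])
  \<comment> \<open>On unit vectors the kernel depends only on the inner product and the radius, so
    \<open>z\<close> and \<open>w\<close> can exchange roles.\<close>
  have sym: "poisson (R *\<^sub>R z) w = poisson (R *\<^sub>R w) z" if "norm w = 1" for w
    using that z R by (simp add: poisson_eq_kern inner_commute)
  have "(LINT w|sph. of_real (kern ?l 0 (z \<bullet> w) R) * complex_of_real (poisson x w)) =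
      (LINT w|sph. of_real (poisson x w) * complex_of_real (poisson (R *\<^sub>R w) z))"
    by (rule Bochner_Integration.integral_cong[OF refl]) (use z R sym in \<open>simp flip: poisson_eq_kern\<close>)
  also have "\<dots> = of_real (sph_area TYPE('a)) * of_real (poisson (R *\<^sub>R x) z)"
    by (rule poisson_formula_dilate[OF hp _ _ x]) (use R in auto)
  finally show "(\<lambda>k. (LINT w|sph. of_real (zon ?l (z \<bullet> w) 1 k) * complex_of_real (poisson x w)) * of_real R ^ k)
      sums (of_real (sph_area TYPE('a)) * complex_of_real (poisson (R *\<^sub>R x) z))"
    using integral_kern_sums[OF _ z _ R(2) cp, of ?l 0] R by (simp add: mult.commute)
  obtain x' where x': "norm x' = 1" "x = norm x *\<^sub>R x'"
  proof (cases "x = 0")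
    case True
    obtain b :: 'a where "norm b = 1" using vector_choose_size[of 1] by auto
    with True show ?thesis by (intro that[of b]) auto
  next
    case False
    then show ?thesis by (intro that[of "sgn x"]) (auto simp: norm_sgn sgn_div_norm)
  qed
  have "norm x * R \<le> norm x * 1" using R by (intro mult_left_mono) auto
  then have "norm x * R < 1" using x by simp
  then have kz: "(\<lambda>k. zon ?l (x' \<bullet> z) 1 k * (norm x * R) ^ k) sums kern ?l 0 (x' \<bullet> z) (norm x * R)"
    using kern_sums[of "x' \<bullet> z" "norm x * R" ?l 0] x'(1) z R by (simp add: abs_inner_le_1)
  have "zon ?l (x \<bullet> z) (x \<bullet> x) k = norm x ^ k * zon ?l (x' \<bullet> z) 1 k" for k
  proof -
    have "x \<bullet> z = norm x * (x' \<bullet> z)" by (subst x'(2)) simp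
    moreover have "x \<bullet> x = (norm x)\<^sup>2 * 1" by (simp add: power2_norm_eq_inner)
    ultimately show ?thesis by (simp only: zon_dilate)
  qed
  then have "(\<lambda>k. zon ?l (x' \<bullet> z) 1 k * (norm x * R) ^ k) = (\<lambda>k. zon ?l (x \<bullet> z) (x \<bullet> x) k * R ^ k)"
    by (simp add: power_mult_distrib mult_ac)
  moreover have "kern ?l 0 (x' \<bullet> z) (norm x * R) = poisson (R *\<^sub>R x) z"
  proof -
    have "R *\<^sub>R x = (norm x * R) *\<^sub>R x'" by (subst x'(2)) simp
    then show ?thesis using \<open>norm x * R < 1\<close> x'(1) z R by (simp add: poisson_eq_kern)
  qed
  ultimately have "(\<lambda>k. zon ?l (x \<bullet> z) (x \<bullet> x) k * R ^ k) sums poisson (R *\<^sub>R x) z" using kz by simp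
  from sums_mult[OF sums_of_real[OF this, where 'a = complex], of "of_real (sph_area TYPE('a))"]
  show "(\<lambda>k. of_real (sph_area TYPE('a)) * of_real (zon ?l (x \<bullet> z) (x \<bullet> x) k) * of_real R ^ k)
      sums (of_real (sph_area TYPE('a)) * complex_of_real (poisson (R *\<^sub>R x) z))"
    by (simp add: mult.assoc)
qed simp

text \<open>In the unit ball the polynomial is a Poisson integral by \<open>zon_poisson\<close>;
  homogeneity carries harmonicity to balls of every radius.\<close>

lemma harmonic_on_zon:
  fixes z :: "'a::euclidean_space"
  assumes z: "norm z = 1"
  shows "harmonic_on (\<lambda>x. complex_of_real (zon (DIM('a) / 2) (x \<bullet> z) (x \<bullet> x) k)) UNIV"
proof (rule harmonic_on_local)
  let ?q = "\<lambda>x::'a. complex_of_real (zon (DIM('a) / 2) (x \<bullet> z) (x \<bullet> x) k)"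
  let ?w = "sph_area TYPE('a)"
  have w: "?w > 0" by (rule sph_area_pos)
  have "continuous_on (sphere 0 1) (\<lambda>w. complex_of_real (zon (DIM('a) / 2) (z \<bullet> w) 1 k))"
    by (intro continuous_intros)
  from harmonic_on_linear_image[OF bounded_linear_mult_right[of "of_real (1 / ?w)"] harmonic_on_poisson_integral[OF this]]
  have h: "harmonic_on ?q (ball 0 1)"
  proof (rule harmonic_on_cong)
    fix x :: 'a assume "x \<in> ball 0 1"
    then have x: "norm x < 1" by simp
    have "(LINT w|sph. of_real (poisson x w) * complex_of_real (zon (DIM('a) / 2) (z \<bullet> w) 1 k)) = ?w * ?q x"
      using zon_poisson[OF x z, of k] by (simp only: mult.commute[of "complex_of_real (poisson x _)"])
    then show "of_real (1 / ?w) * (LINT w|sph. of_real (poisson x w) * complex_of_real (zon (DIM('a) / 2) (z \<bullet> w) 1 k)) = ?q x"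
      using w by simp
  qed simp
  fix x :: 'a
  define R where "R = norm x + 1"
  have R: "R > 0" by (simp add: R_def add_nonneg_pos)
  have "harmonic_on (\<lambda>y. ?q ((1 / R) *\<^sub>R y)) (ball 0 R)"
    by (rule harmonic_on_dilation[OF h]) (use R in \<open>auto simp: divide_less_eq\<close>)
  from harmonic_on_linear_image[OF bounded_linear_mult_right[of "of_real (R ^ k)"] this]
  have "harmonic_on ?q (ball 0 R)"
  proof (rule harmonic_on_cong)
    fix y :: 'a
    have "zon (DIM('a) / 2) ((1 / R) * (y \<bullet> z)) ((1 / R)\<^sup>2 * (y \<bullet> y)) k = (1 / R) ^ k * zon (DIM('a) / 2) (y \<bullet> z) (y \<bullet> y) k"
      by (rule zon_dilate)
    then show "of_real (R ^ k) * ?q ((1 / R) *\<^sub>R y) = ?q y"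
      using R by (simp add: power2_eq_square power_divide)
  qed simp
  then show "\<exists>T. open T \<and> x \<in> T \<and> harmonic_on ?q T"
    by (intro exI[of _ "ball 0 R"]) (simp add: R_def)
qed

lemma zonal_in_spherical_harmonics:
  fixes z :: "'a::euclidean_space"
  assumes z: "norm z = 1"
  shows "(\<lambda>x. if norm x = 1 then complex_of_real (zon (DIM('a) / 2) (x \<bullet> z) 1 k) else 0) \<in> spherical_harmonics k"
  unfolding spherical_harmonics_def mem_Collect_eq
proof (intro exI conjI allI)
  let ?q = "\<lambda>x::'a. complex_of_real (zon (DIM('a) / 2) (x \<bullet> z) (x \<bullet> x) k)"
  show "polynomial_function ?q"
    by (rule polynomial_function_bounded_linear_image[OF bounded_linear_of_real])
      (use real_polynomial_function_zon in \<open>simp add: real_polynomial_function_eq\<close>)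
  show "?q (c *\<^sub>R x) = of_real c ^ k * ?q x" for c x
    using zon_dilate[of "DIM('a) / 2" c "x \<bullet> z" "x \<bullet> x" k] by (simp add: power2_eq_square mult.assoc)
  show "harmonic_on ?q UNIV" by (rule harmonic_on_zon[OF z])
  show "(\<lambda>x. if norm x = 1 then complex_of_real (zon (DIM('a) / 2) (x \<bullet> z) 1 k) else 0) = (\<lambda>x. if norm x = 1 then ?q x else 0)"
    by (auto simp: fun_eq_iff simp flip: power2_norm_eq_inner)
qed

section \<open>Inner product and reproducing property on the sphere\<close>

definition sph_inner :: "('a::euclidean_space \<Rightarrow> complex) \<Rightarrow> ('a \<Rightarrow> complex) \<Rightarrow> complex" where
  "sph_inner F G = (LINT z|sph. F z * cnj (G z))"

lemma integrable_sph_inner: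
  assumes "continuous_on (sphere 0 1) F" "continuous_on (sphere 0 1) G"
  shows "integrable sph (\<lambda>z. F z * cnj (G z))"
  by (intro integrable_sph_continuous continuous_intros assms)

lemma sph_inner_diff_left:
  assumes "continuous_on (sphere 0 1) F" "continuous_on (sphere 0 1) F'" "continuous_on (sphere 0 1) G"
  shows "sph_inner (\<lambda>z. F z - F' z) G = sph_inner F G - sph_inner F' G"
  unfolding sph_inner_def left_diff_distrib
  by (rule Bochner_Integration.integral_diff) (intro integrable_sph_inner assms)+

lemma sph_inner_sum_left:
  assumes "\<And>Y. Y \<in> B \<Longrightarrow> continuous_on (sphere 0 1) (F Y)" "continuous_on (sphere 0 1) G"
  shows "sph_inner (\<lambda>z. \<Sum>Y\<in>B. c Y * F Y z) G = (\<Sum>Y\<in>B. c Y * sph_inner (F Y) G)"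
proof -
  have "sph_inner (\<lambda>z. \<Sum>Y\<in>B. c Y * F Y z) G = (LINT z|sph. (\<Sum>Y\<in>B. c Y * (F Y z * cnj (G z))))"
    unfolding sph_inner_def by (simp only: sum_distrib_right mult.assoc)
  also have "\<dots> = (\<Sum>Y\<in>B. LINT z|sph. c Y * (F Y z * cnj (G z)))"
    by (rule Bochner_Integration.integral_sum) (intro integrable_mult_right integrable_sph_inner assms)
  finally show ?thesis by (simp only: sph_inner_def integral_mult_right_zero)
qed

lemma sph_inner_commute: "sph_inner G F = cnj (sph_inner F G)"
proof -
  have "cnj (sph_inner F G) = (LINT z|sph. cnj (F z * cnj (G z)))"
    unfolding sph_inner_def by (rule Bochner_Integration.integral_cnj[symmetric])
  then show ?thesis by (simp add: sph_inner_def mult.commute)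
qed

lemma sph_inner_self:
  assumes "continuous_on (sphere 0 1) (F :: 'a::euclidean_space \<Rightarrow> complex)"
  shows "sph_inner F F = of_real (LINT z|sph. (norm (F z))\<^sup>2)"
  unfolding sph_inner_def complex_norm_square[symmetric] by (rule integral_complex_of_real)

text \<open>Zero norm gives vanishing almost everywhere, which annihilates every inner product.
  Pointwise vanishing is later obtained by pairing with the zonal kernel.\<close>

lemma sph_inner_self_eq_0:
  fixes F :: "'a::euclidean_space \<Rightarrow> complex"
  assumes F: "continuous_on (sphere 0 1) F" and G: "continuous_on (sphere 0 1) G" and 0: "sph_inner F F = 0"
  shows "sph_inner F G = 0"
proof -
  have "(LINT z|sph. (norm (F z))\<^sup>2) = 0" using 0 by (simp add: sph_inner_self[OF F])
  moreover have "integrable sph (\<lambda>z. (norm (F z))\<^sup>2)"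
    by (intro integrable_sph_continuous continuous_intros F)
  ultimately have "AE z in sph. (norm (F z))\<^sup>2 = 0"
    by (subst (asm) integral_nonneg_eq_0_iff_AE) auto
  then have "AE z in sph. F z * cnj (G z) = 0" by eventually_elim simp
  then show ?thesis unfolding sph_inner_def by (rule integral_eq_zero_AE)
qed

lemma spherical_harmonicE:
  assumes "Y \<in> spherical_harmonics k"
  obtains q where "polynomial_function q" "\<And>c x. q (c *\<^sub>R x) = of_real c ^ k * q x" "harmonic_on q UNIV"
    "Y = (\<lambda>x. if norm x = 1 then q x else 0)"
  using assms unfolding spherical_harmonics_def by blast

lemma spherical_harmonic_continuous:
  fixes Y :: "'a::euclidean_space \<Rightarrow> complex"
  assumes "Y \<in> spherical_harmonics k" shows "continuous_on (sphere 0 1) Y"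
proof -
  obtain q where q: "polynomial_function q" "Y = (\<lambda>x. if norm x = 1 then q x else 0)"
    using spherical_harmonicE[OF assms] by metis
  have "continuous_on (sphere 0 1) q" using q(1) by (rule continuous_on_polymonial_function)
  then show ?thesis by (rule continuous_on_eq) (simp add: q(2))
qed

lemma spherical_harmonic_measurable:
  fixes Y :: "'a::euclidean_space \<Rightarrow> complex"
  assumes "Y \<in> spherical_harmonics k" shows "Y \<in> borel_measurable borel"
proof -
  obtain q where q: "polynomial_function q" "Y = (\<lambda>x. if norm x = 1 then q x else 0)"
    using spherical_harmonicE[OF assms] by metis
  have "continuous_on UNIV q" using q(1) by (rule continuous_on_polymonial_function)
  then have [measurable]: "q \<in> borel_measurable borel" by (rule borel_measurable_continuous_onI)
  show ?thesis unfolding q(2) by measurable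
qed

lemma spherical_harmonic_sph_inner:
  assumes "Y \<in> spherical_harmonics k" "Y' \<in> spherical_harmonics k"
  shows "(LINT x|sphere_measure. Y x * cnj (Y' x)) = sph_inner Y Y'"
proof -
  note [measurable] = spherical_harmonic_measurable[OF assms(1)] spherical_harmonic_measurable[OF assms(2)]
  have [measurable]: "cnj \<in> borel_measurable borel"
    by (intro borel_measurable_continuous_onI continuous_intros)
  show ?thesis unfolding sph_inner_def by (rule integral_sphere_measure) measurable
qed

lemma spherical_harmonics_add:
  assumes "Y \<in> spherical_harmonics k" "Y' \<in> spherical_harmonics k"
  shows "(\<lambda>x. Y x + Y' x) \<in> spherical_harmonics k"
proof -
  obtain q where q: "polynomial_function q" "\<And>c x. q (c *\<^sub>R x) = of_real c ^ k * q x" "harmonic_on q UNIV"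
    "Y = (\<lambda>x. if norm x = 1 then q x else 0)" by (rule spherical_harmonicE[OF assms(1)]) blast
  obtain q' where q': "polynomial_function q'" "\<And>c x. q' (c *\<^sub>R x) = of_real c ^ k * q' x" "harmonic_on q' UNIV"
    "Y' = (\<lambda>x. if norm x = 1 then q' x else 0)" by (rule spherical_harmonicE[OF assms(2)]) blast
  show ?thesis unfolding spherical_harmonics_def mem_Collect_eq
    by (intro exI[of _ "\<lambda>x. q x + q' x"] conjI allI polynomial_function_add harmonic_on_add q q')
      (auto simp: q q' algebra_simps)
qed

lemma spherical_harmonics_scale:
  assumes "Y \<in> spherical_harmonics k"
  shows "(\<lambda>x. c * Y x) \<in> spherical_harmonics k"
proof -
  obtain q where q: "polynomial_function q" "\<And>c x. q (c *\<^sub>R x) = of_real c ^ k * q x" "harmonic_on q UNIV"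
    "Y = (\<lambda>x. if norm x = 1 then q x else 0)" by (rule spherical_harmonicE[OF assms(1)]) blast
  show ?thesis unfolding spherical_harmonics_def mem_Collect_eq
    by (intro exI[of _ "\<lambda>x. c * q x"] conjI allI
        polynomial_function_bounded_linear_image[OF bounded_linear_mult_right]
        harmonic_on_linear_image[OF bounded_linear_mult_right] q)
      (auto simp: q algebra_simps)
qed

lemma spherical_harmonics_sum:
  fixes B :: "('a::euclidean_space \<Rightarrow> complex) set"
  assumes "finite B" "B \<subseteq> spherical_harmonics k" "F \<in> spherical_harmonics k"
  shows "(\<lambda>x. F x - (\<Sum>Y\<in>B. c Y * Y x)) \<in> spherical_harmonics k"
  using assms
proof (induction B)
  case (insert Y B)
  then have "(\<lambda>x. (F x - (\<Sum>Y\<in>B. c Y * Y x)) + (- c Y) * Y x) \<in> spherical_harmonics k"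
    by (intro spherical_harmonics_add spherical_harmonics_scale) auto
  then show ?case using insert by (simp add: algebra_simps)
qed simp

text \<open>The reproducing kernel of order \<open>k\<close> at a unit vector \<open>x\<close>,
  extended by zero off the sphere so as to be an element of
  \<open>spherical_harmonics k\<close>.\<close>

definition zonal_kernel :: "nat \<Rightarrow> 'a::euclidean_space \<Rightarrow> 'a \<Rightarrow> complex" where
  "zonal_kernel k x z = (if norm z = 1 then of_real (zon (DIM('a) / 2) (z \<bullet> x) 1 k / sph_area TYPE('a)) else 0)"

lemma zonal_kernel_in_spherical_harmonics:
  fixes x :: "'a::euclidean_space"
  assumes "norm x = 1" shows "zonal_kernel k x \<in> spherical_harmonics k"
proof -
  have "zonal_kernel k x = (\<lambda>z. of_real (1 / sph_area TYPE('a)) *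
      (if norm z = 1 then complex_of_real (zon (DIM('a) / 2) (z \<bullet> x) 1 k) else 0))"
    by (auto simp: zonal_kernel_def fun_eq_iff)
  then show ?thesis by (simp only: spherical_harmonics_scale[OF zonal_in_spherical_harmonics[OF assms]])
qed

text \<open>Comparing coefficients in the expansion of a homogeneous harmonic polynomial.\<close>
lemma spherical_harmonic_reproducing:
  fixes x :: "'a::euclidean_space"
  assumes Y: "Y \<in> spherical_harmonics k" and x: "norm x = 1"
  shows "sph_inner Y (zonal_kernel k x) = Y x"
proof -
  let ?w = "sph_area TYPE('a)"
  have w: "?w > 0" by (rule sph_area_pos)
  obtain q where q: "polynomial_function q" "\<And>c x. q (c *\<^sub>R x) = of_real c ^ k * q x" "harmonic_on q UNIV"
    "Y = (\<lambda>x. if norm x = 1 then q x else 0)" by (rule spherical_harmonicE[OF Y]) blast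
  \<comment> \<open>The trivial test \<open>k = k\<close> is the coefficient sequence
    \<open>if i = k then ... else 0\<close> of the homogeneous side, taken at \<open>i = k\<close>;
    this shape lets the uniqueness lemma match.\<close>
  have "(LINT z|sph. of_real (zon (DIM('a) / 2) (x \<bullet> z) 1 k) * q z) = (if k = k then ?w * q x else 0)"
  proof (rule real_power_series_unique[where \<delta> = 1 and g = "\<lambda>R. of_real ?w * q (R *\<^sub>R x)" and k = k
        and a = "\<lambda>i. LINT z|sph. of_real (zon (DIM('a) / 2) (x \<bullet> z) 1 i) * q z"
        and b = "\<lambda>i. if i = k then ?w * q x else 0"])
    fix R :: real assume R: "0 < R" "R < 1"
    show "(\<lambda>k. (LINT z|sph. of_real (zon (DIM('a) / 2) (x \<bullet> z) 1 k) * q z) * of_real R ^ k) sums (of_real ?w * q (R *\<^sub>R x))"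
      by (rule harmonic_expansion[OF harmonic_on_subset[OF q(3)] _ x])
        (use R q(1) continuous_on_polymonial_function in auto)
    have "(\<lambda>i. if i = k then of_real ?w * q x * of_real R ^ i else 0) sums (of_real ?w * q x * of_real R ^ k)"
      by (rule sums_single)
    moreover have "(\<lambda>i. if i = k then of_real ?w * q x * of_real R ^ i else 0) =
        (\<lambda>i. (if i = k then of_real ?w * q x else 0) * complex_of_real R ^ i)" by auto
    ultimately show "(\<lambda>i. (if i = k then of_real ?w * q x else 0) * of_real R ^ i) sums (of_real ?w * q (R *\<^sub>R x))"
      by (simp add: q(2) mult_ac)
  qed simp
  moreover have "sph_inner Y (zonal_kernel k x) =
      (LINT z|sph. of_real (1 / ?w) * (of_real (zon (DIM('a) / 2) (x \<bullet> z) 1 k) * q z))"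
    unfolding sph_inner_def
    by (rule Bochner_Integration.integral_cong) (auto simp: zonal_kernel_def q(4) inner_commute)
  ultimately show ?thesis
    using w x by (simp only: integral_mult_right_zero) (simp add: q(4))
qed

section \<open>Orthonormal bases of spherical harmonics\<close>

definition sph_orthonormal :: "nat \<Rightarrow> ('a::euclidean_space \<Rightarrow> complex) set \<Rightarrow> bool" where
  "sph_orthonormal k B \<longleftrightarrow> finite B \<and> B \<subseteq> spherical_harmonics k \<and>
     (\<forall>Y\<in>B. \<forall>Y'\<in>B. sph_inner Y Y' = (if Y = Y' then 1 else 0))"

lemma sph_orthonormal_residual:
  assumes B: "sph_orthonormal k B" and F: "F \<in> spherical_harmonics k" and Y: "Y \<in> B"
  shows "sph_inner (\<lambda>x. F x - (\<Sum>Y\<in>B. sph_inner F Y * Y x)) Y = 0"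
proof -
  have c: "continuous_on (sphere 0 1) Y" if "Y \<in> B" for Y
    using that B spherical_harmonic_continuous unfolding sph_orthonormal_def by blast
  have "sph_inner (\<lambda>x. F x - (\<Sum>Y\<in>B. sph_inner F Y * Y x)) Y =
      sph_inner F Y - sph_inner (\<lambda>x. \<Sum>Y\<in>B. sph_inner F Y * Y x) Y"
    by (intro sph_inner_diff_left spherical_harmonic_continuous[OF F] continuous_on_sum continuous_on_mult
        continuous_on_const c Y)
  also have "sph_inner (\<lambda>x. \<Sum>Y\<in>B. sph_inner F Y * Y x) Y = (\<Sum>Y'\<in>B. sph_inner F Y' * sph_inner Y' Y)"
    by (rule sph_inner_sum_left) (rule c, assumption, rule c[OF Y])
  also have "\<dots> = (\<Sum>Y'\<in>B. if Y' = Y then sph_inner F Y' else 0)"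
    using B Y by (intro sum.cong) (auto simp: sph_orthonormal_def)
  also have "\<dots> = sph_inner F Y" using B Y by (simp add: sph_orthonormal_def)
  finally show ?thesis by simp
qed

text \<open>Bessel's inequality for the zonal kernel bounds the size of an orthonormal set.\<close>
lemma sph_orthonormal_card:
  fixes B :: "('a::euclidean_space \<Rightarrow> complex) set"
  assumes B: "sph_orthonormal k B"
  shows "real (card B) \<le> zon (DIM('a) / 2) 1 1 k"
proof -
  let ?w = "sph_area TYPE('a)" and ?Z = "zon (DIM('a) / 2) 1 1 k"
  have w: "?w > 0" by (rule sph_area_pos)
  have H: "Y \<in> spherical_harmonics k" if "Y \<in> B" for Y using that B by (auto simp: sph_orthonormal_def)
  note c = spherical_harmonic_continuous[OF H]
  have bessel: "(\<Sum>Y\<in>B. (norm (Y x))\<^sup>2) \<le> ?Z / ?w" if x: "norm x = 1" for x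
  proof -
    let ?K = "zonal_kernel k x"
    note K = zonal_kernel_in_spherical_harmonics[OF x, of k]
    \<comment> \<open>The component of the kernel orthogonal to \<open>B\<close>. By the reproducing
      property its value at \<open>x\<close> is its squared norm, hence nonnegative; computing this
      value directly gives the bound.\<close>
    define D where "D = (\<lambda>z. ?K z - (\<Sum>Y\<in>B. sph_inner ?K Y * Y z))"
    have D: "D \<in> spherical_harmonics k"
      unfolding D_def using B K by (intro spherical_harmonics_sum) (auto simp: sph_orthonormal_def)
    note cD = spherical_harmonic_continuous[OF D] and cK = spherical_harmonic_continuous[OF K]
    have KY: "sph_inner ?K Y = cnj (Y x)" if "Y \<in> B" for Y
      using spherical_harmonic_reproducing[OF H[OF that] x] sph_inner_commute by metis
    have DY: "sph_inner Y D = 0" if "Y \<in> B" for Y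
      using sph_orthonormal_residual[OF B K that] sph_inner_commute[of Y D] by (simp add: D_def)
    have "sph_inner D D = sph_inner ?K D - sph_inner (\<lambda>z. \<Sum>Y\<in>B. sph_inner ?K Y * Y z) D"
      by (subst (1) D_def) (intro sph_inner_diff_left cK cD continuous_on_sum continuous_on_mult continuous_on_const c)
    also have "sph_inner (\<lambda>z. \<Sum>Y\<in>B. sph_inner ?K Y * Y z) D = (\<Sum>Y\<in>B. sph_inner ?K Y * sph_inner Y D)"
      by (rule sph_inner_sum_left) (rule c, assumption, rule cD)
    also have "\<dots> = 0" by (simp add: DY)
    finally have "sph_inner D D = cnj (D x)"
      using spherical_harmonic_reproducing[OF D x] sph_inner_commute by (metis diff_zero)
    then have "D x = of_real (LINT z|sph. (norm (D z))\<^sup>2)"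
      by (metis sph_inner_self[OF cD] complex_cnj_cnj complex_cnj_complex_of_real)
    moreover have "D x = of_real (?Z / ?w - (\<Sum>Y\<in>B. (norm (Y x))\<^sup>2))"
    proof -
      have "x \<bullet> x = 1" using x by (simp flip: power2_norm_eq_inner)
      then have "?K x = of_real (?Z / ?w)" using x by (simp add: zonal_kernel_def)
      moreover have "(\<Sum>Y\<in>B. sph_inner ?K Y * Y x) = (\<Sum>Y\<in>B. of_real ((norm (Y x))\<^sup>2))"
        by (intro sum.cong refl) (simp only: KY complex_norm_square mult.commute)
      ultimately show ?thesis by (simp add: D_def)
    qed
    ultimately have "?Z / ?w - (\<Sum>Y\<in>B. (norm (Y x))\<^sup>2) = (LINT z|sph. (norm (D z))\<^sup>2)"
      by (metis of_real_eq_iff)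
    also have "\<dots> \<ge> 0" by (rule integral_nonneg_AE) simp
    finally show ?thesis by simp
  qed
  \<comment> \<open>The pointwise bound is integrated: every element of \<open>B\<close> contributes
    1, and the constant on the right integrates to \<open>?Z\<close>.\<close>
  have "(LINT x|sph. (norm (Y x))\<^sup>2) = 1" if "Y \<in> B" for Y
    using sph_inner_self[OF c[OF that]] B that by (simp add: sph_orthonormal_def)
  then have "real (card B) = (\<Sum>Y\<in>B. LINT x|sph. (norm (Y x))\<^sup>2)" by simp
  also have "\<dots> = (LINT x|sph. (\<Sum>Y\<in>B. (norm (Y x))\<^sup>2))"
    by (rule Bochner_Integration.integral_sum[symmetric])
      (intro integrable_sph_continuous continuous_on_power continuous_on_norm c)
  also have "\<dots> \<le> (LINT x|(sph :: 'a measure). ?Z / ?w)"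
    using bessel by (intro integral_mono integrable_sph_continuous continuous_on_sum continuous_on_power
        continuous_on_norm c) auto
  also have "\<dots> = ?Z" using w by (simp add: sph_area_def)
  finally show ?thesis .
qed

text \<open>Orthonormal sets have bounded cardinality, so a largest one exists. A residual of
  positive norm could be normalised and adjoined to it; hence every residual has norm zero and
  vanishes by the reproducing property.\<close>

lemma spherical_onb_exists: "\<exists>B :: ('a::euclidean_space \<Rightarrow> complex) set. spherical_onb k B"
proof -
  define P where "P = (\<lambda>m. \<exists>B :: ('a \<Rightarrow> complex) set. sph_orthonormal k B \<and> card B = m)"
  have "P 0" unfolding P_def by (intro exI[of _ "{}"]) (simp add: sph_orthonormal_def)
  moreover have "\<forall>m. P m \<longrightarrow> m \<le> nat \<lfloor>zon (DIM('a) / 2) 1 1 k\<rfloor>"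
    unfolding P_def using sph_orthonormal_card[where 'a = 'a] by (auto simp: le_nat_floor)
  ultimately obtain m where m: "P m" "\<And>m'. P m' \<Longrightarrow> m' \<le> m" using Nat.ex_has_greatest_nat by metis
  then obtain B :: "('a \<Rightarrow> complex) set" where B: "sph_orthonormal k B" "card B = m" unfolding P_def by blast
  have fin: "finite B" and BH: "B \<subseteq> spherical_harmonics k" using B by (auto simp: sph_orthonormal_def)
  have span: "\<exists>c. F = (\<lambda>x. \<Sum>Y\<in>B. c Y * Y x)" if F: "F \<in> spherical_harmonics k" for F
  proof -
    define D where "D = (\<lambda>x. F x - (\<Sum>Y\<in>B. sph_inner F Y * Y x))"
    have D: "D \<in> spherical_harmonics k"
      unfolding D_def using fin BH F by (intro spherical_harmonics_sum) auto
    note cD = spherical_harmonic_continuous[OF D]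
    have DY: "sph_inner D Y = 0" if "Y \<in> B" for Y
      unfolding D_def by (rule sph_orthonormal_residual[OF B(1) F that])
    have DD: "sph_inner D D = 0"
    proof (rule ccontr)
      define d where "d = (LINT z|sph. (norm (D z))\<^sup>2)"
      assume "sph_inner D D \<noteq> 0"
      then have "d \<noteq> 0" by (simp add: sph_inner_self[OF cD] d_def)
      moreover have "d \<ge> 0" unfolding d_def by (rule integral_nonneg_AE) simp
      ultimately have d: "d > 0" by simp
      define D' where "D' = (\<lambda>x. of_real (1 / sqrt d) * D x)"
      have D': "D' \<in> spherical_harmonics k" unfolding D'_def by (rule spherical_harmonics_scale[OF D])
      have sc: "sph_inner D' G = of_real (1 / sqrt d) * sph_inner D G" for G
        unfolding sph_inner_def D'_def by (simp only: mult.assoc integral_mult_right_zero)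
      have "sph_inner D' D' = of_real (1 / sqrt d) * cnj (sph_inner D' D)"
        by (simp only: sc sph_inner_commute[of D D'])
      also have "\<dots> = of_real (1 / sqrt d * (1 / sqrt d * d))"
        by (simp only: sc sph_inner_self[OF cD] d_def[symmetric] complex_cnj_mult complex_cnj_complex_of_real of_real_mult)
      also have "1 / sqrt d * (1 / sqrt d * d) = 1" using d by (simp add: field_simps)
      finally have D'D': "sph_inner D' D' = 1" by simp
      have D'Y: "sph_inner D' Y = 0" "sph_inner Y D' = 0" if "Y \<in> B" for Y
        using DY[OF that] sph_inner_commute[of Y D'] by (simp_all add: sc)
      have "D' \<notin> B" using D'D' D'Y(1)[of D'] by auto
      moreover have "sph_orthonormal k (insert D' B)"
        using B(1) D' D'D' D'Y \<open>D' \<notin> B\<close> unfolding sph_orthonormal_def by auto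
      ultimately have "P (Suc m)" unfolding P_def using fin B(2) by (intro exI[of _ "insert D' B"]) simp
      with m(2)[of "Suc m"] show False by simp
    qed
    have "D x = 0" if "norm x = 1" for x
      using spherical_harmonic_reproducing[OF D that]
        sph_inner_self_eq_0[OF cD spherical_harmonic_continuous[OF zonal_kernel_in_spherical_harmonics[OF that, of k]] DD]
      by simp
    moreover have "D x = 0" if "norm x \<noteq> 1" for x
    proof -
      obtain q where "D = (\<lambda>x. if norm x = 1 then q x else 0)" by (rule spherical_harmonicE[OF D]) blast
      from fun_cong[OF this, of x] that show ?thesis by simp
    qed
    ultimately have D0: "D x = 0" for x by (cases "norm x = 1")
    show ?thesis
    proof (rule exI, rule ext)
      show "F x = (\<Sum>Y\<in>B. sph_inner F Y * Y x)" for x using D0[of x] by (simp add: D_def)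
    qed
  qed
  have on: "(LINT x|sphere_measure. Y x * cnj (Y' x)) = (if Y = Y' then 1 else 0)"
    if YB: "Y \<in> B" "Y' \<in> B" for Y Y'
  proof -
    have "(LINT x|sphere_measure. Y x * cnj (Y' x)) = sph_inner Y Y'"
      by (rule spherical_harmonic_sph_inner[OF subsetD[OF BH YB(1)] subsetD[OF BH YB(2)]])
    with B(1) YB show ?thesis unfolding sph_orthonormal_def by simp
  qed
  show ?thesis unfolding spherical_onb_def
    by (rule exI[of _ B], intro conjI ballI fin BH on span)
qed

text \<open>Expanding the reproducing kernel at \<open>y\<close> in the basis gives the coefficients
  \<open>cnj (Y y)\<close>, so the basis sum is that kernel whichever basis was chosen.\<close>

theorem zonal_harmonic_eq:
  fixes x y :: "'a::euclidean_space"
  assumes x: "norm x = 1" and y: "norm y = 1"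
  shows "zonal_harmonic k x y = of_real (zon (DIM('a) / 2) (x \<bullet> y) 1 k / sph_area TYPE('a))"
proof -
  define B :: "('a \<Rightarrow> complex) set" where "B = (SOME B. spherical_onb k B)"
  have B: "spherical_onb k B" unfolding B_def by (rule someI_ex[OF spherical_onb_exists])
  have H: "Y \<in> spherical_harmonics k" if "Y \<in> B" for Y using that B by (auto simp: spherical_onb_def)
  note c = spherical_harmonic_continuous[OF H]
  have on: "sph_inner Y Y' = (if Y = Y' then 1 else 0)" if "Y \<in> B" "Y' \<in> B" for Y Y'
    using B that spherical_harmonic_sph_inner[OF H H, OF that] by (auto simp: spherical_onb_def)
  note K = zonal_kernel_in_spherical_harmonics[OF y, of k]
  obtain a where a: "zonal_kernel k y = (\<lambda>x. \<Sum>Y\<in>B. a Y * Y x)"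
    using B K unfolding spherical_onb_def by blast
  have "a Y = cnj (Y y)" if Y: "Y \<in> B" for Y
  proof -
    have "sph_inner (zonal_kernel k y) Y = (\<Sum>Y'\<in>B. a Y' * sph_inner Y' Y)"
      unfolding a by (rule sph_inner_sum_left) (rule c, assumption, rule c[OF Y])
    also have "\<dots> = (\<Sum>Y'\<in>B. if Y' = Y then a Y' else 0)"
      using Y by (intro sum.cong) (auto simp: on)
    also have "\<dots> = a Y" using B Y by (simp add: spherical_onb_def)
    finally show ?thesis using spherical_harmonic_reproducing[OF H[OF Y] y] sph_inner_commute by metis
  qed
  then have "zonal_harmonic k x y = zonal_kernel k y x"
    unfolding zonal_harmonic_def B_def[symmetric] a by (intro sum.cong refl) (simp add: mult.commute)
  then show ?thesis using x by (simp add: zonal_kernel_def)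
qed

section \<open>The Bergman kernel\<close>

definition ball_measure :: "'a::euclidean_space measure" where
  "ball_measure = restrict_space lborel (ball 0 1)"

lemma space_ball_measure [simp]: "space (ball_measure :: 'a::euclidean_space measure) = ball 0 1"
  by (simp add: ball_measure_def space_restrict_space)

lemma measurable_ball_measure:
  "f \<in> borel_measurable borel \<Longrightarrow> f \<in> borel_measurable (ball_measure :: 'a::euclidean_space measure)"
  unfolding ball_measure_def by (rule measurable_restrict_space1) simp

lemma sets_ball_measure: "sets (ball_measure :: 'a::euclidean_space measure) = sets (restrict_space borel (ball 0 1))"
  by (simp add: ball_measure_def sets_restrict_space)

lemma measurable_ident_ball_measure: "(\<lambda>x. x) \<in> (ball_measure :: 'a::euclidean_space measure) \<rightarrow>\<^sub>M borel"
  by (rule measurable_ball_measure) simp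

lemma measurable_ball_measure_continuous:
  "continuous_on (ball 0 1) f \<Longrightarrow> f \<in> borel_measurable (ball_measure :: 'a::euclidean_space measure)"
  by (subst measurable_cong_sets[OF sets_ball_measure refl]) (rule borel_measurable_continuous_on_restrict)

lemma nn_integral_ball_measure:
  "(\<integral>\<^sup>+x. f x \<partial>(ball_measure :: 'a::euclidean_space measure)) = (\<integral>\<^sup>+x\<in>ball 0 1. f x \<partial>lborel)"
  unfolding ball_measure_def by (rule nn_integral_restrict_space) simp

lemma finite_measure_ball_measure: "finite_measure (ball_measure :: 'a::euclidean_space measure)"
proof
  have "emeasure ball_measure (ball (0::'a) 1) = emeasure lborel (ball (0::'a) 1)"
    unfolding ball_measure_def by (rule emeasure_restrict_space) auto
  then show "emeasure (ball_measure :: 'a measure) (space ball_measure) \<noteq> \<infinity>"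
    using emeasure_lborel_ball_finite[of "0::'a" 1] by simp
qed

interpretation ballm: finite_measure "ball_measure :: 'a::euclidean_space measure"
  by (rule finite_measure_ball_measure)

lemma DIM_ge_1: "1 \<le> DIM('a::euclidean_space)"
  by (simp add: Suc_leI)

lemma norm_scaleR_sgn: "norm x *\<^sub>R sgn x = (x :: 'a::real_normed_vector)"
  by (cases "x = 0") (simp_all add: sgn_div_norm)

lemma nn_integral_polar:
  fixes g :: "'a::euclidean_space \<Rightarrow> ennreal"
  assumes g: "g \<in> borel_measurable borel"
  shows "(\<integral>\<^sup>+x. g x \<partial>ball_measure) = (\<integral>\<^sup>+r. \<integral>\<^sup>+z. g (r *\<^sub>R z) \<partial>sph \<partial>radial_measure DIM('a))"
proof -
  interpret S: finite_measure "sphere_measure :: 'a measure" by (rule finite_measure_sphere_measure)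
  have m: "(\<lambda>p. g (fst p *\<^sub>R snd p)) \<in> borel_measurable (borel \<Otimes>\<^sub>M (borel :: 'a measure))"
    using g by measurable
  have m': "(\<lambda>p. g (fst p *\<^sub>R snd p)) \<in> borel_measurable (radial_measure DIM('a) \<Otimes>\<^sub>M (sphere_measure :: 'a measure))"
    using g by measurable
  have d: "(\<lambda>x::'a. (norm x, sgn x)) \<in> ball_measure \<rightarrow>\<^sub>M borel \<Otimes>\<^sub>M borel"
    unfolding ball_measure_def by (intro measurable_restrict_space1) simp
  have "(\<integral>\<^sup>+x. g x \<partial>ball_measure) = (\<integral>\<^sup>+x. (\<lambda>p. g (fst p *\<^sub>R snd p)) (norm x, sgn x) \<partial>ball_measure)"
    by (rule nn_integral_cong) (simp add: norm_scaleR_sgn)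
  also have "\<dots> = (\<integral>\<^sup>+p. g (fst p *\<^sub>R snd p) \<partial>distr ball_measure (borel \<Otimes>\<^sub>M borel) (\<lambda>x::'a. (norm x, sgn x)))"
    by (rule nn_integral_distr[symmetric]) (use d m in simp_all)
  also have "\<dots> = (\<integral>\<^sup>+p. g (fst p *\<^sub>R snd p) \<partial>(radial_measure DIM('a) \<Otimes>\<^sub>M (sphere_measure :: 'a measure)))"
    by (simp only: ball_measure_def polar_measure)
  also have "\<dots> = (\<integral>\<^sup>+r. \<integral>\<^sup>+z. g (r *\<^sub>R z) \<partial>sphere_measure \<partial>radial_measure DIM('a))"
    by (subst S.nn_integral_fst[OF m', symmetric]) simp
  finally show ?thesis by (simp only: nn_integral_sphere_measure)
qed

lemma integral_polar:
  fixes g :: "'a::euclidean_space \<Rightarrow> complex"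
  assumes g: "integrable ball_measure g" and gm: "g \<in> borel_measurable borel"
  shows "(LINT x|ball_measure. g x) = (LINT r|radial_measure DIM('a). LINT z|sph. g (r *\<^sub>R z))"
proof -
  interpret S: finite_measure "sphere_measure :: 'a measure" by (rule finite_measure_sphere_measure)
  interpret R: finite_measure "radial_measure DIM('a)" by (rule finite_measure_radial_measure[OF DIM_ge_1])
  interpret P: pair_sigma_finite "radial_measure DIM('a)" "sphere_measure :: 'a measure" ..
  have m: "(\<lambda>p. g (fst p *\<^sub>R snd p)) \<in> borel_measurable (borel \<Otimes>\<^sub>M (borel :: 'a measure))"
    using gm by measurable
  have d: "(\<lambda>x::'a. (norm x, sgn x)) \<in> ball_measure \<rightarrow>\<^sub>M borel \<Otimes>\<^sub>M borel"
    unfolding ball_measure_def by (intro measurable_restrict_space1) simp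
  have eq: "(\<lambda>x. (\<lambda>p. g (fst p *\<^sub>R snd p)) (norm x, sgn x)) = g"
    by (rule ext) (simp add: norm_scaleR_sgn)
  have P: "distr ball_measure (borel \<Otimes>\<^sub>M borel) (\<lambda>x::'a. (norm x, sgn x)) = radial_measure DIM('a) \<Otimes>\<^sub>M (sphere_measure :: 'a measure)"
    by (simp only: ball_measure_def polar_measure)
  have "(LINT x|ball_measure. g x) = (LINT p|distr ball_measure (borel \<Otimes>\<^sub>M borel) (\<lambda>x::'a. (norm x, sgn x)). g (fst p *\<^sub>R snd p))"
    using integral_distr[OF d m] eq by simp
  also have "\<dots> = (LINT r|radial_measure DIM('a). LINT z|sphere_measure. g (r *\<^sub>R z))"
  proof -
    have "integrable (distr ball_measure (borel \<Otimes>\<^sub>M borel) (\<lambda>x::'a. (norm x, sgn x))) (\<lambda>p. g (fst p *\<^sub>R snd p))"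
      using integrable_distr_eq[OF d m] eq g by simp
    from P.integral_fst'[OF this[unfolded P]] show ?thesis unfolding P by simp
  qed
  also have "\<dots> = (LINT r|radial_measure DIM('a). LINT z|sph. g (r *\<^sub>R z))"
  proof (rule Bochner_Integration.integral_cong[OF refl], rule integral_sphere_measure)
    show "(\<lambda>z. g (r *\<^sub>R z)) \<in> borel_measurable borel" for r using gm by measurable
  qed
  finally show ?thesis .
qed

lemma AE_radial_measure: "AE r in radial_measure n. 0 < r \<and> r < 1"
proof -
  have "AE r in lborel. r \<noteq> 0 \<and> r \<noteq> (1::real)"
    using AE_lborel_singleton[of "0::real"] AE_lborel_singleton[of "1::real"] by eventually_elim simp
  then have "AE r in lborel. 0 < ennreal (r ^ (n - 1)) * indicator {0..1} r \<longrightarrow> 0 < r \<and> r < 1"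
    by eventually_elim (auto simp: indicator_def)
  then show ?thesis unfolding radial_measure_def by (subst AE_density) auto
qed

text \<open>With t = 1 - \<rho> and a = 1 - r, the base 1 - r \<rho> = a + r t dominates both
  \<open>a\<close> and \<open>t\<close>. Using \<open>a\<close> for t \<le> a and \<open>t\<close>
  beyond gives the two summands; s > -1 and s < \<beta> are the convergence conditions at 0 and at
  infinity.\<close>

lemma radial_estimate:
  assumes s: "-1 < s" "s < \<beta>" and r: "0 \<le> r" "r < 1"
  shows "(\<integral>\<^sup>+\<rho>. ennreal ((1 - \<rho>) powr s * (1 - r * \<rho>) powr (- (\<beta> + 1))) \<partial>radial_measure n)
     \<le> ennreal ((1 / (s + 1) + 1 / (\<beta> - s)) * (1 - r) powr (s - \<beta>))"
proof -
  define a where "a = 1 - r"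
  have a: "0 < a" "a \<le> 1" using r by (auto simp: a_def)
  define g where "g \<rho> = (1 - \<rho>) powr s * (1 - r * \<rho>) powr (- (\<beta> + 1))" for \<rho>
  \<comment> \<open>A majorant in t whose upper range is extended to infinity, so that both
    integrals are explicit powers of \<open>a\<close>.\<close>
  define h where "h t = indicator {0..a} t * (t powr s * a powr (- (\<beta> + 1))) + indicator {a..} t * t powr (s - \<beta> - 1)" for t :: real
  have [measurable]: "g \<in> borel_measurable borel" unfolding g_def [abs_def] by measurable
  have "(\<integral>\<^sup>+\<rho>. ennreal (g \<rho>) \<partial>radial_measure n) =
      (\<integral>\<^sup>+\<rho>. ennreal (\<rho> ^ (n - 1)) * indicator {0..1} \<rho> * ennreal (g \<rho>) \<partial>lborel)"
    unfolding radial_measure_def by (subst nn_integral_density) auto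
  also have "\<dots> \<le> (\<integral>\<^sup>+\<rho>. indicator {0..1} \<rho> * ennreal (g \<rho>) \<partial>lborel)"
  proof (rule nn_integral_mono)
    fix \<rho> :: real
    show "ennreal (\<rho> ^ (n - 1)) * indicator {0..1} \<rho> * ennreal (g \<rho>) \<le> indicator {0..1} \<rho> * ennreal (g \<rho>)"
    proof (cases "\<rho> \<in> {0..1}")
      case True
      then have "ennreal (\<rho> ^ (n - 1)) * ennreal (g \<rho>) \<le> 1 * ennreal (g \<rho>)"
        by (intro mult_right_mono) (auto simp: power_le_one)
      with True show ?thesis by simp
    qed simp
  qed
  also have "\<dots> = (\<integral>\<^sup>+t. indicator {0..1} (1 + (-1) * t) * ennreal (g (1 + (-1) * t)) \<partial>lborel)"
    by (subst nn_integral_real_affine[where c = "-1" and t = 1]) auto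
  also have "\<dots> \<le> (\<integral>\<^sup>+t. ennreal (h t) \<partial>lborel)"
  proof (rule nn_integral_mono)
    fix t :: real
    show "indicator {0..1} (1 + (-1) * t) * ennreal (g (1 + (-1) * t)) \<le> ennreal (h t)"
    proof (cases "t \<in> {0..1}")
      case True
      have "g (1 + (-1) * t) = t powr s * (a + r * t) powr (- (\<beta> + 1))"
        by (simp add: g_def a_def algebra_simps)
      also have "\<dots> \<le> h t"
      proof (cases "t \<le> a")
        case ta: True
        have "(a + r * t) powr (- (\<beta> + 1)) \<le> a powr (- (\<beta> + 1))"
          using a True r s by (intro powr_mono2') auto
        then have "t powr s * (a + r * t) powr (- (\<beta> + 1)) \<le> t powr s * a powr (- (\<beta> + 1))"
          by (intro mult_left_mono) auto
        with ta True show ?thesis by (simp add: h_def add_increasing2)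
      next
        case ta: False
        have "0 \<le> (1 - r) * (1 - t)" using r True by (intro mult_nonneg_nonneg) auto
        then have "t \<le> a + r * t" by (simp add: a_def algebra_simps)
        then have "(a + r * t) powr (- (\<beta> + 1)) \<le> t powr (- (\<beta> + 1))"
          using ta a s by (intro powr_mono2') auto
        then have "t powr s * (a + r * t) powr (- (\<beta> + 1)) \<le> t powr s * t powr (- (\<beta> + 1))"
          by (intro mult_left_mono) auto
        also have "\<dots> = t powr (s - \<beta> - 1)" by (simp flip: powr_add add: algebra_simps)
        finally show ?thesis using ta True by (simp add: h_def)
      qed
      finally show ?thesis using True by (simp add: indicator_def ennreal_leI)
    qed (auto simp: indicator_def)
  qed
  also have "\<dots> = (\<integral>\<^sup>+t. ennreal (indicator {0..a} t * (t powr s * a powr (- (\<beta> + 1)))) +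
      ennreal (indicator {a..} t * t powr (s - \<beta> - 1)) \<partial>lborel)"
    by (intro nn_integral_cong) (simp add: h_def)
  also have "\<dots> = (\<integral>\<^sup>+t. ennreal (indicator {0..a} t * (t powr s * a powr (- (\<beta> + 1)))) \<partial>lborel) +
      (\<integral>\<^sup>+t. ennreal (indicator {a..} t * t powr (s - \<beta> - 1)) \<partial>lborel)"
    by (rule nn_integral_add) measurable
  also have "(\<integral>\<^sup>+t. ennreal (indicator {0..a} t * (t powr s * a powr (- (\<beta> + 1)))) \<partial>lborel) =
      ennreal (a powr (s + 1) / (s + 1) * a powr (- (\<beta> + 1)))"
  proof (rule nn_integral_has_integral_lebesgue)
    show "((\<lambda>t. t powr s * a powr (- (\<beta> + 1))) has_integral a powr (s + 1) / (s + 1) * a powr (- (\<beta> + 1))) {0..a}"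
      by (rule has_integral_mult_left[OF has_integral_powr_from_0]) (use a s in auto)
  qed simp
  also have "a powr (s + 1) / (s + 1) * a powr (- (\<beta> + 1)) = 1 / (s + 1) * a powr (s - \<beta>)"
    by (simp flip: powr_add add: algebra_simps)
  also have "(\<integral>\<^sup>+t. ennreal (indicator {a..} t * t powr (s - \<beta> - 1)) \<partial>lborel) =
      ennreal (- (a powr (s - \<beta> - 1 + 1)) / (s - \<beta> - 1 + 1))"
  proof (rule nn_integral_has_integral_lebesgue)
    show "((\<lambda>t. t powr (s - \<beta> - 1)) has_integral - (a powr (s - \<beta> - 1 + 1)) / (s - \<beta> - 1 + 1)) {a..}"
      by (rule has_integral_powr_to_inf) (use a s in auto)
  qed simp
  also have "- (a powr (s - \<beta> - 1 + 1)) / (s - \<beta> - 1 + 1) = 1 / (\<beta> - s) * a powr (s - \<beta>)"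
    using s by (simp add: field_simps)
  also have "ennreal (1 / (s + 1) * a powr (s - \<beta>)) + ennreal (1 / (\<beta> - s) * a powr (s - \<beta>)) =
      ennreal ((1 / (s + 1) + 1 / (\<beta> - s)) * a powr (s - \<beta>))"
    using s by (simp add: ring_distribs flip: ennreal_plus)
  finally show ?thesis by (simp add: g_def a_def)
qed

text \<open>Induction through (1 - r^2)^(b+1) = (1 - r^2)^b - r^2 (1 - r^2)^b. The value is the
  reciprocal of the degree-k coefficient of the Bergman kernel, factor 2 included.\<close>

lemma integral_radial_beta:
  assumes n: "1 \<le> n"
  shows "(LINT r|radial_measure n. r ^ (2 * k) * (1 - r\<^sup>2) ^ b) = fact b / (2 * pochhammer (real k + n / 2) (Suc b))"
proof (induction b arbitrary: k)
  case 0
  have "(LINT r|radial_measure n. r ^ (2 * k)) = (LINT r|lborel. (r ^ (n - 1) * indicator {0..1} r) *\<^sub>R r ^ (2 * k))"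
  proof -
    have "radial_measure n = density lborel (\<lambda>r. ennreal (r ^ (n - 1) * indicator {0..1} r))"
      unfolding radial_measure_def by (intro arg_cong[where f = "density lborel"] ext) (simp add: indicator_def)
    then show ?thesis by (simp only:) (rule integral_density, auto simp: indicator_def)
  qed
  also have "\<dots> = (LINT r|lborel. r ^ (n - 1 + 2 * k) * indicator {0..1} r)"
    by (simp add: power_add mult_ac)
  also have "\<dots> = 1 ^ (n + 2 * k) / (n + 2 * k) - 0 ^ (n + 2 * k) / (n + 2 * k)"
  proof (rule integral_FTC_Icc_nonneg)
    show "((\<lambda>r. r ^ (n + 2 * k) / (n + 2 * k)) has_real_derivative x ^ (n - 1 + 2 * k)) (at x)" for x :: real
    proof -
      define m where "m = n + 2 * k"
      have m: "m > 0" "n - 1 + 2 * k = m - 1" using n by (auto simp: m_def)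
      have "((\<lambda>r. r ^ m / m) has_real_derivative x ^ (m - 1)) (at x)"
        using m(1) by (auto intro!: derivative_eq_intros)
      then show ?thesis unfolding m(2) by (simp add: m_def)
    qed
  qed auto
  also have "\<dots> = fact 0 / (2 * pochhammer (real k + n / 2) (Suc 0))"
    using n by (simp add: power_0_left field_simps)
  finally show ?case by simp
next
  case (Suc b)
  interpret R: finite_measure "radial_measure n" by (rule finite_measure_radial_measure[OF n])
  let ?m = "real k + n / 2"
  have int: "integrable (radial_measure n) (\<lambda>r. r ^ (2 * k) * (1 - r\<^sup>2) ^ b)" for k
  proof (rule R.integrable_const_bound[of _ 1])
    show "AE r in radial_measure n. norm (r ^ (2 * k) * (1 - r\<^sup>2) ^ b) \<le> 1"
      using AE_radial_measure by eventually_elim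
        (auto simp: abs_mult power_le_one abs_square_le_1 intro!: mult_le_one)
  qed measurable
  have "(LINT r|radial_measure n. r ^ (2 * k) * (1 - r\<^sup>2) ^ Suc b) =
      (LINT r|radial_measure n. r ^ (2 * k) * (1 - r\<^sup>2) ^ b - r ^ (2 * Suc k) * (1 - r\<^sup>2) ^ b)"
    by (simp add: algebra_simps power2_eq_square)
  also have "\<dots> = (LINT r|radial_measure n. r ^ (2 * k) * (1 - r\<^sup>2) ^ b) - (LINT r|radial_measure n. r ^ (2 * Suc k) * (1 - r\<^sup>2) ^ b)"
    by (rule Bochner_Integration.integral_diff[OF int int])
  also have "\<dots> = fact b / (2 * pochhammer ?m (Suc b)) - fact b / (2 * pochhammer (?m + 1) (Suc b))"
    unfolding Suc.IH by (simp add: add_ac)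
  also have "\<dots> = fact (Suc b) / (2 * pochhammer ?m (Suc (Suc b)))"
  proof -
    define q where "q = pochhammer (?m + 1) b"
    have m: "?m > 0" using n by simp
    then have q: "q > 0" unfolding q_def by (intro pochhammer_pos) simp
    have "pochhammer ?m (Suc b) = ?m * q" by (simp add: q_def pochhammer_rec)
    moreover have "pochhammer (?m + 1) (Suc b) = q * (?m + 1 + b)" by (simp add: q_def pochhammer_Suc)
    moreover have "pochhammer ?m (Suc (Suc b)) = ?m * (q * (?m + 1 + b))"
      by (subst pochhammer_rec) (simp add: q_def pochhammer_Suc)
    moreover have "fact b / (2 * (M * q)) - fact b / (2 * (q * (M + 1 + b))) = fact (Suc b) / (2 * (M * (q * (M + 1 + b))))"
      if "M > 0" for M :: real
    proof -
      have "M + 1 + b \<noteq> 0" using that by linarith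
      then show ?thesis using that q by (simp add: divide_simps) (simp add: algebra_simps)
    qed
    ultimately show ?thesis using m by metis
  qed
  finally show ?case .
qed

lemma norm_direction [simp]: "norm (direction (x :: 'a::euclidean_space)) = 1"
proof (cases "x = 0")
  case True
  obtain b :: 'a where "norm b = 1" using vector_choose_size[of 1] by auto
  then have "norm (SOME u :: 'a. norm u = 1) = 1" by (rule someI)
  with True show ?thesis by (simp add: direction_def)
qed (simp add: direction_def norm_sgn)

lemma norm_scaleR_direction: "norm x *\<^sub>R direction x = (x :: 'a::euclidean_space)"
  by (simp add: direction_def norm_scaleR_sgn)

lemma direction_scaleR: "norm z = 1 \<Longrightarrow> 0 < r \<Longrightarrow> direction (r *\<^sub>R z :: 'a::euclidean_space) = z"
  by (auto simp: direction_def sgn_div_norm)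

lemma borel_measurable_direction [measurable]: "(direction :: 'a::euclidean_space \<Rightarrow> 'a) \<in> borel_measurable borel"
  unfolding direction_def [abs_def] by measurable

lemma abs_inner_direction: "\<bar>direction x \<bullet> direction (y :: 'a::euclidean_space)\<bar> \<le> 1"
  by (rule abs_inner_le_1) simp_all

text \<open>The Bergman kernel for natural parameter \<open>b\<close> as a real function, with the
  basis and the Gamma function eliminated; \<open>bergman_kernel_eq\<close> is the link.\<close>

definition rkernel :: "nat \<Rightarrow> 'a::euclidean_space \<Rightarrow> 'a \<Rightarrow> real" where
  "rkernel b x y = 2 / (fact b * sph_area TYPE('a)) *
     (\<Sum>k. pochhammer (real k + DIM('a) / 2) (Suc b) * zon (DIM('a) / 2) (direction x \<bullet> direction y) 1 k * (norm x * norm y) ^ k)"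

lemma norm_mult_less_1: "norm x < 1 \<Longrightarrow> norm y \<le> 1 \<Longrightarrow> norm x * norm y < 1"
  by (meson mult_left_le norm_ge_zero order_le_less_trans)

lemma rkernel_kern:
  fixes x y :: "'a::euclidean_space"
  assumes "norm x < 1" "norm y \<le> 1"
  shows "rkernel b x y = 2 / (fact b * sph_area TYPE('a)) *
    kern (DIM('a) / 2) (Suc b) (direction x \<bullet> direction y) (norm x * norm y)"
proof -
  have "(\<lambda>k. pochhammer (real k + DIM('a) / 2) (Suc b) * zon (DIM('a) / 2) (direction x \<bullet> direction y) 1 k * (norm x * norm y) ^ k)
      sums kern (DIM('a) / 2) (Suc b) (direction x \<bullet> direction y) (norm x * norm y)"
    by (rule kern_sums[OF abs_inner_direction _ norm_mult_less_1[OF assms]]) simp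
  from sums_unique[OF this] show ?thesis unfolding rkernel_def by simp
qed

lemma rkernel_commute: "rkernel b x y = rkernel b y x"
  by (simp only: rkernel_def inner_commute mult.commute[of "norm x"])

text \<open>For natural \<open>b\<close> the quotient Gamma(k + n/2 + b + 1) / Gamma(k + n/2) is a
  rising factorial with \<open>b + 1\<close> factors, and \<open>zonal_harmonic_eq\<close> evaluates
  the basis sum.\<close>

lemma bergman_kernel_eq:
  fixes x y :: "'a::euclidean_space"
  assumes "norm x < 1" "norm y \<le> 1"
  shows "bergman_kernel (real b) x y = of_real (rkernel b x y)"
proof -
  let ?l = "DIM('a) / 2" and ?w = "sph_area TYPE('a)" and ?s = "direction x \<bullet> direction y"
  let ?a = "\<lambda>k. pochhammer (real k + ?l) (Suc b) * zon ?l ?s 1 k * (norm x * norm y) ^ k"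
  have l: "?l > 0" by simp
  have coeff: "Gamma (real b + 1 + real k + real DIM('a) / 2) / (Gamma (real b + 1) * Gamma (real k + real DIM('a) / 2)) =
      pochhammer (real k + ?l) (Suc b) / fact b" for k
  proof -
    have "real k + ?l > 0" using l by linarith
    then have "real k + ?l \<notin> \<int>\<^sub>\<le>\<^sub>0" by (auto elim!: nonpos_Ints_cases)
    from pochhammer_Gamma[OF this, of "Suc b"]
    have "pochhammer (real k + ?l) (Suc b) = Gamma (real b + 1 + real k + real DIM('a) / 2) / Gamma (real k + real DIM('a) / 2)"
      by (simp add: add_ac)
    moreover have "Gamma (real b + 1) = fact b" using Gamma_fact[of b, where 'a = real] by (simp add: add.commute)
    ultimately show ?thesis by simp
  qed
  have s: "summable ?a"
    by (rule sums_summable[OF kern_sums[OF abs_inner_direction _ norm_mult_less_1[OF assms]]]) simp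
  have "bergman_kernel (real b) x y = 2 * (\<Sum>k. of_real (1 / (fact b * ?w) * ?a k))"
    unfolding bergman_kernel_def coeff zonal_harmonic_eq[OF norm_direction norm_direction]
    by (simp add: power_mult_distrib mult_ac)
  also have "(\<Sum>k. complex_of_real (1 / (fact b * ?w) * ?a k)) = of_real (\<Sum>k. 1 / (fact b * ?w) * ?a k)"
    by (rule suminf_of_real[symmetric]) (rule summable_mult[OF s])
  also have "(\<Sum>k. 1 / (fact b * ?w) * ?a k) = 1 / (fact b * ?w) * (\<Sum>k. ?a k)"
    by (rule suminf_mult[OF s])
  finally show ?thesis by (simp add: rkernel_def)
qed

lemma borel_measurable_gegen [measurable]:
  assumes [measurable]: "f \<in> borel_measurable M" "g \<in> borel_measurable M"
  shows "(\<lambda>x. gegen l (f x) (g x) k) \<in> borel_measurable M"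
  by (induction k rule: induct_nat_012) simp_all

lemma borel_measurable_zon [measurable]:
  assumes [measurable]: "f \<in> borel_measurable M" "g \<in> borel_measurable M"
  shows "(\<lambda>x. zon l (f x) (g x) k) \<in> borel_measurable M"
  unfolding zon_def by measurable

lemma borel_measurable_rkernel [measurable]:
  fixes f g :: "'m \<Rightarrow> 'a::euclidean_space"
  assumes [measurable]: "f \<in> borel_measurable M" "g \<in> borel_measurable M"
  shows "(\<lambda>p. rkernel b (f p) (g p)) \<in> borel_measurable M"
  unfolding rkernel_def by measurable

text \<open>The Poisson kernel at radius |x||y| is written with |y| x as its first argument: for
  fixed |y| this is a fixed point of the ball, and integration over the direction of
  \<open>y\<close> yields the known mass.\<close>

lemma rkernel_bound:
  "\<exists>C>0. \<forall>x y :: 'a::euclidean_space. norm x < 1 \<longrightarrow> norm y \<le> 1 \<longrightarrow>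
     \<bar>rkernel b x y\<bar> \<le> C * poisson (norm y *\<^sub>R x) (direction y) / (1 - norm x * norm y) ^ Suc b"
proof -
  let ?l = "DIM('a) / 2" and ?w = "sph_area TYPE('a)"
  have w: "?w > 0" by (rule sph_area_pos)
  obtain C where C: "C > 0" "\<And>s R. \<bar>s\<bar> \<le> 1 \<Longrightarrow> 0 \<le> R \<Longrightarrow> R < 1 \<Longrightarrow>
      \<bar>kern ?l (Suc b) s R\<bar> \<le> C * kern ?l 0 s R / (1 - R) ^ Suc b"
    using kern_bound[of ?l "Suc b"] by auto
  have "\<bar>rkernel b x y\<bar> \<le> 2 / (fact b * ?w) * C * poisson (norm y *\<^sub>R x) (direction y) / (1 - norm x * norm y) ^ Suc b"
    if xy: "norm x < 1" "norm y \<le> 1" for x y :: 'a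
  proof -
    let ?s = "direction x \<bullet> direction y" and ?R = "norm x * norm y"
    have R: "0 \<le> ?R" "?R < 1" using norm_mult_less_1[OF xy] by auto
    have "norm y *\<^sub>R x = ?R *\<^sub>R direction x"
      using norm_scaleR_direction[of x] by (metis mult.commute scaleR_scaleR)
    then have "poisson (norm y *\<^sub>R x) (direction y) = kern ?l 0 ?s ?R"
      using R by (simp add: poisson_eq_kern)
    moreover have "\<bar>rkernel b x y\<bar> = 2 / (fact b * ?w) * \<bar>kern ?l (Suc b) ?s ?R\<bar>"
      using w by (simp add: rkernel_kern[OF xy] abs_mult)
    moreover have "2 / (fact b * ?w) * \<bar>kern ?l (Suc b) ?s ?R\<bar> \<le> 2 / (fact b * ?w) * (C * kern ?l 0 ?s ?R / (1 - ?R) ^ Suc b)"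
      using w by (intro mult_left_mono C(2) abs_inner_direction R) auto
    ultimately show ?thesis by simp
  qed
  moreover have "2 / (fact b * ?w) * C > 0" using w C(1) by simp
  ultimately show ?thesis by blast
qed

lemma poisson_le:
  fixes x z :: "'a::euclidean_space"
  assumes "norm x \<le> s" "s < 1" "norm z = 1"
  shows "poisson x z \<le> ((1 - s)\<^sup>2) powr (- (DIM('a) / 2))"
proof -
  have "1 - s \<le> norm (x - z)" using norm_triangle_ineq2[of z x] assms by (simp add: norm_minus_commute)
  then have "(1 - s)\<^sup>2 \<le> (norm (x - z))\<^sup>2" using assms by (intro power_mono) auto
  then have "((x - z) \<bullet> (x - z)) powr (- (DIM('a) / 2)) \<le> ((1 - s)\<^sup>2) powr (- (DIM('a) / 2))"
    using assms by (intro powr_mono2') (auto simp: power2_norm_eq_inner)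
  moreover have "1 - x \<bullet> x \<le> 1" by simp
  moreover have "0 \<le> 1 - x \<bullet> x" using assms by (simp flip: power2_norm_eq_inner add: power_le_one)
  ultimately show ?thesis unfolding poisson_def
    using mult_mono[of "1 - x \<bullet> x" 1 "((x - z) \<bullet> (x - z)) powr (- (DIM('a) / 2))" "((1 - s)\<^sup>2) powr (- (DIM('a) / 2))"] by simp
qed

text \<open>A crude bound, uniform in \<open>y\<close>, that supplies the dominating functions for
  limits and for Fubini while \<open>x\<close> stays in a smaller ball.\<close>

lemma rkernel_locally_bounded:
  assumes s: "0 \<le> s" "s < 1"
  shows "\<exists>K. \<forall>x y :: 'a::euclidean_space. norm x \<le> s \<longrightarrow> norm y \<le> 1 \<longrightarrow> \<bar>rkernel b x y\<bar> \<le> K"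
proof -
  obtain C where C: "C > 0" "\<And>x y :: 'a. norm x < 1 \<Longrightarrow> norm y \<le> 1 \<Longrightarrow>
     \<bar>rkernel b x y\<bar> \<le> C * poisson (norm y *\<^sub>R x) (direction y) / (1 - norm x * norm y) ^ Suc b"
    using rkernel_bound[where 'a = 'a] by blast
  have "\<bar>rkernel b x y\<bar> \<le> C * ((1 - s)\<^sup>2) powr (- (DIM('a) / 2)) / (1 - s) ^ Suc b"
    if xy: "norm x \<le> s" "norm y \<le> 1" for x y :: 'a
  proof -
    have le: "norm x * norm y \<le> s" using xy s by (metis mult_left_le norm_ge_zero order_trans)
    have "\<bar>rkernel b x y\<bar> \<le> C * poisson (norm y *\<^sub>R x) (direction y) / (1 - norm x * norm y) ^ Suc b"
      using xy s by (intro C(2)) auto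
    also have "\<dots> \<le> C * ((1 - s)\<^sup>2) powr (- (DIM('a) / 2)) / (1 - s) ^ Suc b"
      using le s C(1) by (intro frac_le mult_left_mono poisson_le power_mono) (auto simp: mult.commute)
    finally show ?thesis .
  qed
  then show ?thesis by blast
qed

text \<open>
  Integrating over spheres first, the Poisson kernel contributes its constant mass, so only
  a one-dimensional integral remains.
\<close>
theorem rkernel_integral_bound:
  assumes s: "-1 < s" "s < real b"
  shows "\<exists>C>0. \<forall>x :: 'a::euclidean_space. norm x < 1 \<longrightarrow>
    (\<integral>\<^sup>+y. ennreal (\<bar>rkernel b x y\<bar> * (1 - norm y) powr s) \<partial>ball_measure) \<le> ennreal (C * (1 - norm x) powr (s - b))"
proof -
  let ?w = "sph_area TYPE('a)"
  have w: "?w > 0" by (rule sph_area_pos)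
  obtain C where C: "C > 0" "\<And>x y :: 'a. norm x < 1 \<Longrightarrow> norm y \<le> 1 \<Longrightarrow>
     \<bar>rkernel b x y\<bar> \<le> C * poisson (norm y *\<^sub>R x) (direction y) / (1 - norm x * norm y) ^ Suc b"
    using rkernel_bound[where 'a = 'a] by blast
  define K where "K = 1 / (s + 1) + 1 / (real b - s)"
  have K: "K > 0" using s by (auto simp: K_def intro!: add_pos_pos)
  have "(\<integral>\<^sup>+y. ennreal (\<bar>rkernel b x y\<bar> * (1 - norm y) powr s) \<partial>ball_measure) \<le> ennreal (C * ?w * K * (1 - norm x) powr (s - b))"
    if x: "norm x < 1" for x :: 'a
  proof -
    let ?h = "\<lambda>r. (1 - r) powr s * (1 - norm x * r) powr (- (real b + 1))"
    have "(\<integral>\<^sup>+y. ennreal (\<bar>rkernel b x y\<bar> * (1 - norm y) powr s) \<partial>ball_measure) =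
        (\<integral>\<^sup>+r. \<integral>\<^sup>+z. ennreal (\<bar>rkernel b x (r *\<^sub>R z)\<bar> * (1 - norm (r *\<^sub>R z)) powr s) \<partial>sph \<partial>radial_measure DIM('a))"
      by (rule nn_integral_polar) measurable
    also have "\<dots> \<le> (\<integral>\<^sup>+r. ennreal (C * ?w) * ennreal (?h r) \<partial>radial_measure DIM('a))"
    \<comment> \<open>Almost every \<open>r\<close> suffices: this excludes r = 0, where the
      direction of r z need not be z, and the boundary value r = 1.\<close>
    proof (rule nn_integral_mono_AE)
      show "AE r in radial_measure DIM('a). (\<integral>\<^sup>+z. ennreal (\<bar>rkernel b x (r *\<^sub>R z)\<bar> * (1 - norm (r *\<^sub>R z)) powr s) \<partial>sph) \<le> ennreal (C * ?w) * ennreal (?h r)"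
        using AE_radial_measure
      proof eventually_elim
        case (elim r)
        have "r * norm x \<le> 1 * norm x" using elim by (intro mult_right_mono) auto
        then have rx: "norm (r *\<^sub>R x) < 1" using x elim by simp
        have xr: "norm x * r < 1" using rx elim by (simp add: mult.commute)
        have cp: "continuous_on (sphere 0 1) (poisson (r *\<^sub>R x))" by (rule continuous_on_poisson_slice[OF rx])
        have "(\<integral>\<^sup>+z. ennreal (\<bar>rkernel b x (r *\<^sub>R z)\<bar> * (1 - norm (r *\<^sub>R z)) powr s) \<partial>sph) \<le>
            (\<integral>\<^sup>+z. ennreal (C * ?h r) * ennreal (poisson (r *\<^sub>R x) z) \<partial>sph)"
        proof (rule nn_integral_mono)
          fix z assume "z \<in> space (sph :: 'a measure)"
          then have z: "norm z = 1" by simp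
          have "\<bar>rkernel b x (r *\<^sub>R z)\<bar> \<le> C * poisson (norm (r *\<^sub>R z) *\<^sub>R x) (direction (r *\<^sub>R z)) / (1 - norm x * norm (r *\<^sub>R z)) ^ Suc b"
            using x z elim by (intro C(2)) auto
          also have "\<dots> = C * poisson (r *\<^sub>R x) z * (1 - norm x * r) powr (- (real b + 1))"
          proof -
            have "(1 - norm x * r) powr (- real (Suc b)) = 1 / (1 - norm x * r) ^ Suc b"
              using xr by (simp only: powr_minus_divide powr_realpow diff_gt_0_iff_gt)
            then show ?thesis using z elim by (simp add: direction_scaleR add.commute)
          qed
          finally have "\<bar>rkernel b x (r *\<^sub>R z)\<bar> * (1 - norm (r *\<^sub>R z)) powr s \<le>
              (C * poisson (r *\<^sub>R x) z * (1 - norm x * r) powr (- (real b + 1))) * (1 - r) powr s"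
            using z elim by (simp add: mult_right_mono)
          also have "\<dots> = C * ?h r * poisson (r *\<^sub>R x) z" by (simp add: mult_ac)
          finally have "ennreal (\<bar>rkernel b x (r *\<^sub>R z)\<bar> * (1 - norm (r *\<^sub>R z)) powr s) \<le> ennreal (C * ?h r * poisson (r *\<^sub>R x) z)"
            by (rule ennreal_leI)
          also have "\<dots> = ennreal (C * ?h r) * ennreal (poisson (r *\<^sub>R x) z)"
            using C(1) rx by (intro ennreal_mult) (auto intro!: poisson_nonneg)
          finally show "ennreal (\<bar>rkernel b x (r *\<^sub>R z)\<bar> * (1 - norm (r *\<^sub>R z)) powr s) \<le> ennreal (C * ?h r) * ennreal (poisson (r *\<^sub>R x) z)" .
        qed
        also have "\<dots> = ennreal (C * ?h r) * (\<integral>\<^sup>+z. ennreal (poisson (r *\<^sub>R x) z) \<partial>sph)"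
          by (rule nn_integral_cmult) (intro measurable_compose[OF borel_measurable_sph_continuous[OF cp]] measurable_ennreal)
        also have "(\<integral>\<^sup>+z. ennreal (poisson (r *\<^sub>R x) z) \<partial>sph) = ennreal ?w"
          using nn_integral_eq_integral[OF integrable_sph_continuous[OF cp]] rx
          by (simp add: integral_poisson poisson_nonneg)
        also have "ennreal (C * ?h r) * ennreal ?w = ennreal (C * ?w) * ennreal (?h r)"
          using C(1) w by (simp add: mult_ac flip: ennreal_mult)
        finally show ?case .
      qed
    qed
    also have "\<dots> = ennreal (C * ?w) * (\<integral>\<^sup>+r. ennreal (?h r) \<partial>radial_measure DIM('a))"
      by (rule nn_integral_cmult) measurable
    also have "\<dots> \<le> ennreal (C * ?w) * ennreal (K * (1 - norm x) powr (s - b))"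
      unfolding K_def using s x by (intro mult_left_mono radial_estimate) auto
    also have "\<dots> = ennreal (C * ?w * K * (1 - norm x) powr (s - b))"
      using C(1) w K by (simp add: mult_ac flip: ennreal_mult)
    finally show ?thesis .
  qed
  moreover have "C * ?w * K > 0" using C(1) w K by simp
  ultimately show ?thesis by blast
qed

section \<open>Kernel integrals and the reproducing formula\<close>

lemma direction_scaleR_pos: "0 < s \<Longrightarrow> direction (s *\<^sub>R x) = direction (x :: 'a::euclidean_space)"
  by (simp add: direction_def sgn_scaleR)

lemma zon_direction:
  "zon l (x \<bullet> v) (x \<bullet> x) k = norm x ^ k * zon l (direction x \<bullet> v) 1 k"
proof -
  have "x \<bullet> v = norm x * (direction x \<bullet> v)"
    using norm_scaleR_direction[of x] by (metis inner_scaleR_left)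
  moreover have "x \<bullet> x = (norm x)\<^sup>2 * 1" by (simp add: power2_norm_eq_inner)
  ultimately show ?thesis by (simp only: zon_dilate)
qed

text \<open>Expanded in powers of s|y|, the kernel has coefficients that are zonal in
  \<open>z\<close>, and \<open>zon_poisson\<close> evaluates each of them. The result feeds the
  criterion \<open>harmonic_onI_poisson\<close>.\<close>

lemma rkernel_poisson:
  fixes x y :: "'a::euclidean_space"
  assumes s: "0 < s" "s < 1" and x: "norm x < 1" and y: "norm y \<le> 1"
  shows "(LINT z|sph. of_real (poisson x z) * complex_of_real (rkernel b (s *\<^sub>R z) y)) =
    of_real (sph_area TYPE('a)) * of_real (rkernel b (s *\<^sub>R x) y)"
proof -
  let ?l = "DIM('a) / 2" and ?w = "sph_area TYPE('a)" and ?v = "direction y" and ?R = "s * norm y"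
  define c where "c = 2 / (fact b * ?w)"
  have "s * norm y \<le> s * 1" using s y by (intro mult_left_mono) auto
  then have "?R < 1" using s by linarith
  then have R: "0 \<le> ?R" "?R < 1" using s by auto
  have "norm x * ?R \<le> norm x * 1" using R by (intro mult_left_mono) auto
  then have xR: "norm x * ?R < 1" using x by linarith
  have cp: "continuous_on (sphere 0 1) (\<lambda>z. complex_of_real (poisson x z))"
    by (intro continuous_intros continuous_on_poisson_slice x)
  have "(\<lambda>k. complex_of_real (pochhammer (real k + ?l) (Suc b) * ?R ^ k) *
        (of_real ?w * of_real (zon ?l (x \<bullet> ?v) (x \<bullet> x) k)))
      sums (LINT z|sph. complex_of_real (kern ?l (Suc b) (?v \<bullet> z) ?R) * of_real (poisson x z))"
    using integral_kern_sums[OF _ norm_direction[of y] R cp, of ?l "Suc b"]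
    by (simp only: zon_poisson[OF x norm_direction])
  then have 1: "(\<lambda>k. of_real ?w * complex_of_real (pochhammer (real k + ?l) (Suc b) * zon ?l (direction x \<bullet> ?v) 1 k * (norm x * ?R) ^ k))
      sums (LINT z|sph. of_real (kern ?l (Suc b) (?v \<bullet> z) ?R) * of_real (poisson x z))"
    by (simp add: zon_direction power_mult_distrib mult_ac)
  have "(\<lambda>k. pochhammer (real k + ?l) (Suc b) * zon ?l (direction x \<bullet> ?v) 1 k * (norm x * ?R) ^ k)
      sums kern ?l (Suc b) (direction x \<bullet> ?v) (norm x * ?R)"
    by (rule kern_sums[OF abs_inner_direction]) (use R xR in auto)
  from sums_mult[OF sums_of_real[OF this, where 'a = complex], of "of_real ?w"] 1
  have 2: "(LINT z|sph. of_real (kern ?l (Suc b) (?v \<bullet> z) ?R) * complex_of_real (poisson x z)) =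
      of_real ?w * of_real (kern ?l (Suc b) (direction x \<bullet> ?v) (norm x * ?R))"
    using sums_unique2 by blast
  have "(LINT z|sph. of_real (poisson x z) * complex_of_real (rkernel b (s *\<^sub>R z) y)) =
      (LINT z|sph. of_real c * (of_real (kern ?l (Suc b) (?v \<bullet> z) ?R) * complex_of_real (poisson x z)))"
  proof (rule Bochner_Integration.integral_cong[OF refl])
    fix z assume "z \<in> space (sph :: 'a measure)"
    then have z: "norm z = 1" by simp
    then have "rkernel b (s *\<^sub>R z) y = c * kern ?l (Suc b) (?v \<bullet> z) ?R"
      using s y by (subst rkernel_kern) (auto simp: c_def direction_scaleR inner_commute)
    then show "of_real (poisson x z) * complex_of_real (rkernel b (s *\<^sub>R z) y) =
        of_real c * (of_real (kern ?l (Suc b) (?v \<bullet> z) ?R) * complex_of_real (poisson x z))" by simp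
  qed
  also have "\<dots> = of_real c * (of_real ?w * of_real (kern ?l (Suc b) (direction x \<bullet> ?v) (norm x * ?R)))"
    by (simp only: integral_mult_right_zero 2)
  also have "\<dots> = of_real ?w * of_real (rkernel b (s *\<^sub>R x) y)"
  proof -
    have "norm (s *\<^sub>R x) < 1" using s x mult_strict_mono[of s 1 "norm x" 1] by simp
    then have "rkernel b (s *\<^sub>R x) y = c * kern ?l (Suc b) (direction x \<bullet> ?v) (norm x * ?R)"
      using s y by (subst rkernel_kern) (auto simp: c_def direction_scaleR_pos mult_ac)
    then show ?thesis by simp
  qed
  finally show ?thesis .
qed

text \<open>Written with homogeneous polynomials in \<open>x\<close>, the series no longer shows the
  jump of \<open>direction\<close> at the origin, and the Weierstrass test gives uniform
  convergence.\<close>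

lemma continuous_on_rkernel:
  fixes y :: "'a::euclidean_space"
  assumes s: "0 \<le> s" "s < 1" and y: "norm y \<le> 1"
  shows "continuous_on (cball 0 s) (\<lambda>x. rkernel b x y)"
proof -
  let ?l = "DIM('a) / 2" and ?v = "direction y"
  define f where "f k x = pochhammer (real k + ?l) (Suc b) * norm y ^ k * zon ?l (x \<bullet> ?v) (x \<bullet> x) k" for k and x :: 'a
  define r where "r = (1 + s) / 2"
  have r: "0 < r" "r < 1" "s < r" using s by (auto simp: r_def)
  obtain M where M: "M > 0" "\<And>s k. \<bar>s\<bar> \<le> 1 \<Longrightarrow> \<bar>zon ?l s 1 k\<bar> \<le> M / r ^ k"
    using zon_bound[of ?l r] r by auto
  have p: "pochhammer (real k + ?l) (Suc b) \<ge> 0" for k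
  proof -
    have "0 < real k + ?l" by (rule add_nonneg_pos) auto
    then show ?thesis by (intro less_imp_le pochhammer_pos)
  qed
  have fb: "norm (f k x) \<le> pochhammer (real k + ?l) (Suc b) * (s / r) ^ k * M" if "x \<in> cball 0 s" for k x
  proof -
    have "norm (f k x) = pochhammer (real k + ?l) (Suc b) * (norm y ^ k * (norm x ^ k * \<bar>zon ?l (direction x \<bullet> ?v) 1 k\<bar>))"
      using p by (simp add: f_def zon_direction abs_mult)
    also have "\<dots> \<le> pochhammer (real k + ?l) (Suc b) * (1 * (s ^ k * (M / r ^ k)))"
      using p that s y M(1) r by (intro mult_left_mono mult_mono M(2) abs_inner_direction power_mono power_le_one) auto
    finally show ?thesis by (simp add: power_divide)
  qed
  have "summable (\<lambda>k. pochhammer (real k + ?l) (Suc b) * (s / r) ^ k * M)"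
    using s r by (intro summable_mult2 summable_pochhammer_power) auto
  then have "uniform_limit (cball 0 s) (\<lambda>n x. \<Sum>k<n. f k x) (\<lambda>x. \<Sum>k. f k x) sequentially"
    by (rule Weierstrass_m_test[rotated]) (rule fb)
  moreover have "\<forall>\<^sub>F n in sequentially. continuous_on (cball 0 s) (\<lambda>x. \<Sum>k<n. f k x)"
    unfolding f_def by (intro always_eventually allI continuous_intros)
  ultimately have "continuous_on (cball 0 s) (\<lambda>x. \<Sum>k. f k x)"
    by (intro uniform_limit_theorem) auto
  moreover have eq: "(\<lambda>x. rkernel b x y) = (\<lambda>x. 2 / (fact b * sph_area TYPE('a)) * (\<Sum>k. f k x))"
    unfolding rkernel_def f_def by (simp add: zon_direction power_mult_distrib mult_ac)
  ultimately show ?thesis unfolding eq by (intro continuous_on_mult_left)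
qed

lemma integrable_rkernel_mult:
  fixes g :: "'a::euclidean_space \<Rightarrow> complex"
  assumes g: "integrable ball_measure g" and x: "norm x < 1"
  shows "integrable ball_measure (\<lambda>y. of_real (rkernel b x y) * g y)"
proof -
  obtain K where K: "\<And>x' y :: 'a. norm x' \<le> norm x \<Longrightarrow> norm y \<le> 1 \<Longrightarrow> \<bar>rkernel b x' y\<bar> \<le> K"
    using rkernel_locally_bounded[of "norm x" b, where 'a = 'a] x by auto
  note [measurable] = borel_measurable_integrable[OF g]
  have [measurable]: "(\<lambda>y. rkernel b x y) \<in> borel_measurable ball_measure"
    by (rule measurable_ball_measure) measurable
  show ?thesis
  proof (rule Bochner_Integration.integrable_bound)
    show "integrable ball_measure (\<lambda>y. K * norm (g y))" by (intro integrable_mult_right integrable_norm g)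
    show "AE y in ball_measure. norm (of_real (rkernel b x y) * g y) \<le> norm (K * norm (g y))"
    proof (rule AE_I2)
      fix y assume "y \<in> space (ball_measure :: 'a measure)"
      then have "\<bar>rkernel b x y\<bar> \<le> K" by (intro K) auto
      then show "norm (of_real (rkernel b x y) * g y) \<le> norm (K * norm (g y))"
        by (auto simp: norm_mult abs_mult intro!: mult_right_mono)
    qed
  qed measurable
qed

text \<open>Dominated convergence gives continuity, and Fubini moves the Poisson integral onto the
  kernel, where \<open>rkernel_poisson\<close> applies.\<close>

theorem harmonic_on_rkernel_integral:
  fixes g :: "'a::euclidean_space \<Rightarrow> complex"
  assumes g: "integrable ball_measure g"
  shows "harmonic_on (\<lambda>x. LINT y|ball_measure. of_real (rkernel b x y) * g y) (ball 0 1)"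
proof (rule harmonic_onI_poisson)
  let ?G = "\<lambda>x. LINT y|ball_measure. of_real (rkernel b x y) * g y"
  let ?w = "sph_area TYPE('a)"
  note gm = borel_measurable_integrable[OF g]
  have km: "(\<lambda>y. rkernel b x y) \<in> borel_measurable ball_measure" for x :: 'a
    by (rule measurable_ball_measure) measurable
  have cont: "continuous_on (cball 0 s) ?G" if s: "0 \<le> s" "s < 1" for s
  proof (rule continuous_on_sequentiallyI)
    fix u a assume u: "\<forall>n. u n \<in> cball (0::'a) s" "a \<in> cball 0 s" "u \<longlonglongrightarrow> a"
    obtain K where K: "\<And>x y :: 'a. norm x \<le> s \<Longrightarrow> norm y \<le> 1 \<Longrightarrow> \<bar>rkernel b x y\<bar> \<le> K"
      using rkernel_locally_bounded[OF s, of b, where 'a = 'a] by auto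
    show "(\<lambda>n. ?G (u n)) \<longlonglongrightarrow> ?G a"
    proof (rule integral_dominated_convergence[where w = "\<lambda>y. K * norm (g y)"])
      show "integrable ball_measure (\<lambda>y. K * norm (g y))" by (intro integrable_mult_right integrable_norm g)
      show "AE y in ball_measure. (\<lambda>n. of_real (rkernel b (u n) y) * g y) \<longlonglongrightarrow> of_real (rkernel b a y) * g y"
      proof (rule AE_I2)
        fix y assume "y \<in> space (ball_measure :: 'a measure)"
        then have "norm y \<le> 1" by simp
        from continuous_on_rkernel[OF s this, of b] u
        have "(\<lambda>n. rkernel b (u n) y) \<longlonglongrightarrow> rkernel b a y"
          unfolding continuous_on_sequentially comp_def by blast
        then show "(\<lambda>n. of_real (rkernel b (u n) y) * g y) \<longlonglongrightarrow> of_real (rkernel b a y) * g y"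
          by (intro tendsto_intros)
      qed
      show "AE y in ball_measure. norm (of_real (rkernel b (u n) y) * g y) \<le> K * norm (g y)" for n
      proof (rule AE_I2)
        fix y assume "y \<in> space (ball_measure :: 'a measure)"
        then have "\<bar>rkernel b (u n) y\<bar> \<le> K" using u(1) by (intro K) auto
        then show "norm (of_real (rkernel b (u n) y) * g y) \<le> K * norm (g y)"
          by (auto simp: norm_mult intro!: mult_right_mono)
      qed
    qed (use gm km in measurable)
  qed
  show "continuous_on (ball 0 1) ?G"
  proof (rule continuous_at_imp_continuous_on, rule ballI)
    fix x :: 'a assume "x \<in> ball 0 1"
    define s where "s = (1 + norm x) / 2"
    have s: "0 \<le> s" "s < 1" "x \<in> ball 0 s" using \<open>x \<in> ball 0 1\<close> by (auto simp: s_def add_nonneg_nonneg)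
    have "continuous_on (ball 0 s) ?G" using cont[OF s(1,2)] by (rule continuous_on_subset) auto
    then show "isCont ?G x" using s(3) by (simp add: continuous_on_eq_continuous_at)
  qed
  fix s :: real and x :: 'a assume s: "0 < s" "s < 1" and x: "norm x < 1"
  interpret P: pair_sigma_finite "sph :: 'a measure" "ball_measure :: 'a measure" ..
  define h where "h z y = of_real (poisson x z) * (of_real (rkernel b (s *\<^sub>R z) y) * g y)" for z y
  have idm: "(\<lambda>z. z) \<in> sph \<rightarrow>\<^sub>M (borel :: 'a measure)"
    by (rule borel_measurable_sph_continuous) (rule continuous_on_id)
  have pm: "poisson x \<in> borel_measurable borel" unfolding poisson_def [abs_def] by measurable
  have hm: "case_prod h \<in> borel_measurable (sph \<Otimes>\<^sub>M ball_measure)"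
  proof -
    have [measurable]: "(\<lambda>p. fst p) \<in> sph \<Otimes>\<^sub>M (ball_measure :: 'a measure) \<rightarrow>\<^sub>M (borel :: 'a measure)"
      by (rule measurable_compose[OF measurable_fst idm])
    have [measurable]: "(\<lambda>p. snd p) \<in> (sph :: 'a measure) \<Otimes>\<^sub>M ball_measure \<rightarrow>\<^sub>M (borel :: 'a measure)"
      by (rule measurable_compose[OF measurable_snd measurable_ident_ball_measure])
    have [measurable]: "(\<lambda>p. g (snd p)) \<in> borel_measurable ((sph :: 'a measure) \<Otimes>\<^sub>M ball_measure)"
      by (rule measurable_compose[OF measurable_snd gm])
    note pm [measurable]
    show ?thesis unfolding h_def case_prod_beta by measurable
  qed
  obtain K where K: "\<And>x y :: 'a. norm x \<le> s \<Longrightarrow> norm y \<le> 1 \<Longrightarrow> \<bar>rkernel b x y\<bar> \<le> K"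
    using rkernel_locally_bounded[of s b, where 'a = 'a] s by auto
  define B where "B = ((1 - norm x)\<^sup>2) powr (- (DIM('a) / 2))"
  have hb: "norm (h z y) \<le> B * K * norm (g y)" if "norm z = 1" "norm y < 1" for z y
  proof -
    have "\<bar>poisson x z\<bar> \<le> B"
      using poisson_le[of x "norm x" z] poisson_nonneg[of x z] x that by (simp add: B_def)
    moreover have "\<bar>rkernel b (s *\<^sub>R z) y\<bar> \<le> K" using s that by (intro K) auto
    ultimately have "\<bar>poisson x z\<bar> * (\<bar>rkernel b (s *\<^sub>R z) y\<bar> * norm (g y)) \<le> B * (K * norm (g y))"
      by (intro mult_mono mult_nonneg_nonneg) (auto simp: B_def)
    then show ?thesis by (simp add: h_def norm_mult mult.assoc)
  qed
  have hy: "integrable ball_measure (h z)" if "norm z = 1" for z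
    unfolding h_def using s that by (intro integrable_mult_right integrable_rkernel_mult g) auto
  have int: "integrable (sph \<Otimes>\<^sub>M ball_measure) (case_prod h)"
  proof (rule P.Fubini_integrable[OF hm])
    show "AE z in sph. integrable ball_measure (\<lambda>y. case (z, y) of (z, y) \<Rightarrow> h z y)"
      by (rule AE_I2) (simp add: hy)
    show "integrable sph (\<lambda>z. LINT y|ball_measure. norm (case (z, y) of (z, y) \<Rightarrow> h z y))"
    proof (rule sph.integrable_const_bound[of _ "LINT y|ball_measure. B * K * norm (g y)"])
      show "AE z in sph. norm (LINT y|ball_measure. norm (case (z, y) of (z, y) \<Rightarrow> h z y)) \<le> (LINT y|ball_measure. B * K * norm (g y))"
      proof (rule AE_I2)
        fix z assume "z \<in> space (sph :: 'a measure)"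
        then have z: "norm z = 1" by simp
        have "(LINT y|ball_measure. norm (h z y)) \<le> (LINT y|ball_measure. B * K * norm (g y))"
          using hb[OF z] by (intro integral_mono integrable_norm hy[OF z] integrable_mult_right g) auto
        moreover have "0 \<le> (LINT y|ball_measure. norm (h z y))" by (rule integral_nonneg_AE) simp
        ultimately show "norm (LINT y|ball_measure. norm (case (z, y) of (z, y) \<Rightarrow> h z y)) \<le> (LINT y|ball_measure. B * K * norm (g y))"
          by simp
      qed
      show "(\<lambda>z. LINT y|ball_measure. norm (case (z, y) of (z, y) \<Rightarrow> h z y)) \<in> borel_measurable sph"
        using hm by (intro ballm.borel_measurable_lebesgue_integral) (simp add: case_prod_beta)
    qed
  qed
  have "(LINT z|sph. of_real (poisson x z) * ?G (s *\<^sub>R z)) = (LINT z|sph. LINT y|ball_measure. h z y)"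
    unfolding h_def by (simp only: integral_mult_right_zero)
  also have "\<dots> = (LINT y|ball_measure. LINT z|sph. h z y)"
    by (rule P.Fubini_integral[OF int, symmetric])
  also have "\<dots> = (LINT y|ball_measure. of_real ?w * (of_real (rkernel b (s *\<^sub>R x) y) * g y))"
  proof (rule Bochner_Integration.integral_cong[OF refl])
    fix y assume "y \<in> space (ball_measure :: 'a measure)"
    then have y: "norm y \<le> 1" by simp
    have "(LINT z|sph. h z y) = (LINT z|sph. (of_real (poisson x z) * of_real (rkernel b (s *\<^sub>R z) y)) * g y)"
      by (simp only: h_def mult.assoc)
    also have "\<dots> = (of_real ?w * of_real (rkernel b (s *\<^sub>R x) y)) * g y"
      by (simp only: integral_mult_left_zero rkernel_poisson[OF s x y])
    finally show "(LINT z|sph. h z y) = of_real ?w * (of_real (rkernel b (s *\<^sub>R x) y) * g y)" by (simp add: mult.assoc)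
  qed
  finally show "(LINT z|sph. of_real (poisson x z) * ?G (s *\<^sub>R z)) = of_real ?w * ?G (s *\<^sub>R x)"
    by (simp only: integral_mult_right_zero)
qed

text \<open>The expansions obtained from two spheres both represent f(t v) for small t, so their
  coefficients coincide. Hence the moment over the sphere of radius \<open>r\<close> scales like
  r^k.\<close>

lemma harmonic_coeffs:
  fixes f :: "'a::euclidean_space \<Rightarrow> complex"
  assumes h: "harmonic_on f (ball 0 1)" and v: "norm v = 1"
  shows "\<exists>a :: nat \<Rightarrow> complex.
    (\<forall>r k. 0 < r \<longrightarrow> r < 1 \<longrightarrow>
       (LINT z|sph. of_real (zon (DIM('a) / 2) (v \<bullet> z) 1 k) * f (r *\<^sub>R z)) = a k * of_real r ^ k) \<and>
    (\<forall>r. 0 \<le> r \<longrightarrow> r < 1 \<longrightarrow> (\<lambda>k. a k * of_real r ^ k) sums (of_real (sph_area TYPE('a)) * f (r *\<^sub>R v)))"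
proof -
  let ?w = "sph_area TYPE('a)"
  define m where "m r k = (LINT z|sph. of_real (zon (DIM('a) / 2) (v \<bullet> z) 1 k) * f (r *\<^sub>R z))" for r k
  \<comment> \<open>1/2 is a reference radius; any other radius in (0, 1) gives the same
    \<open>a k\<close>.\<close>
  define a where "a k = m (1/2) k / of_real (1/2) ^ k" for k
  have sums: "(\<lambda>k. (m r k / of_real r ^ k) * of_real t ^ k) sums (of_real ?w * f (t *\<^sub>R v))"
    if r: "0 < r" "r < 1" and t: "0 \<le> t" "t < r" for r t
  proof -
    have inb: "r *\<^sub>R y \<in> ball 0 1" if "y \<in> cball 0 1" for y :: 'a
      using r that by (intro scaleR_in_ball) auto
    have "(\<lambda>k. m r k * of_real (t / r) ^ k) sums (of_real ?w * f (r *\<^sub>R (t / r) *\<^sub>R v))"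
      unfolding m_def
    proof (rule harmonic_expansion[where u = "\<lambda>y. f (r *\<^sub>R y)"])
      show "harmonic_on (\<lambda>y. f (r *\<^sub>R y)) (ball 0 1)" by (rule harmonic_on_dilation[OF h]) (rule inb, simp)
      show "continuous_on (cball 0 1) (\<lambda>y. f (r *\<^sub>R y))"
        by (rule continuous_on_compose2[OF harmonic_on_imp_continuous_on[OF h]])
          (use inb in \<open>auto intro!: continuous_intros\<close>)
    qed (use r t v in auto)
    then show ?thesis using r by (simp add: power_divide)
  qed
  have m: "m r k = a k * of_real r ^ k" if r: "0 < r" "r < 1" for r k
  proof -
    have "m r k / of_real r ^ k = a k" unfolding a_def
    proof (rule real_power_series_unique[where \<delta> = "min r (1/2)" and g = "\<lambda>t. of_real ?w * f (t *\<^sub>R v)"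
          and a = "\<lambda>k. m r k / of_real r ^ k" and b = "\<lambda>k. m (1/2) k / of_real (1/2) ^ k"])
      fix t :: real assume t: "0 < t" "t < min r (1/2)"
      show "(\<lambda>k. (m r k / of_real r ^ k) * of_real t ^ k) sums (of_real ?w * f (t *\<^sub>R v))"
        using r t by (intro sums) auto
      show "(\<lambda>k. (m (1/2) k / of_real (1/2) ^ k) * of_real t ^ k) sums (of_real ?w * f (t *\<^sub>R v))"
        using t by (intro sums) auto
    qed (use r in auto)
    then show ?thesis using r by (auto simp: field_simps)
  qed
  show ?thesis
  proof (intro exI[of _ a] conjI allI impI)
    show "(LINT z|sph. of_real (zon (DIM('a) / 2) (v \<bullet> z) 1 k) * f (r *\<^sub>R z)) = a k * of_real r ^ k"
      if "0 < r" "r < 1" for r k using m[OF that] by (simp add: m_def)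
  next
    fix r :: real assume r: "0 \<le> r" "r < 1"
    define q where "q = (1 + r) / 2"
    have q: "0 < q" "q < 1" "r < q" using r by (auto simp: q_def)
    have "m q k / of_real q ^ k = a k" for k using m[OF q(1,2), of k] q by simp
    with sums[OF q(1,2) r(1) q(3)] show "(\<lambda>k. a k * of_real r ^ k) sums (of_real ?w * f (r *\<^sub>R v))" by simp
  qed
qed

lemma rkernel_0:
  fixes y :: "'a::euclidean_space"
  shows "rkernel b 0 y = 2 / (fact b * sph_area TYPE('a)) * pochhammer (DIM('a) / 2) (Suc b)"
proof -
  have "(\<lambda>k. (pochhammer (real k + DIM('a) / 2) (Suc b) * zon (DIM('a) / 2) (direction 0 \<bullet> direction y) 1 k) * 0 ^ k)
      sums (pochhammer (real 0 + DIM('a) / 2) (Suc b) * zon (DIM('a) / 2) (direction 0 \<bullet> direction y) 1 0)"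
    by (rule powser_sums_zero)
  from sums_unique[OF this] show ?thesis by (simp add: rkernel_def)
qed

text \<open>At the origin the kernel is a positive constant, so the integral of the bare weight can
  be read off from the kernel estimate.\<close>

lemma ball_weight_finite:
  assumes "-1 < s" "s < real b"
  shows "(\<integral>\<^sup>+y. ennreal ((1 - norm y) powr s) \<partial>(ball_measure :: 'a::euclidean_space measure)) < \<infinity>"
proof -
  obtain C where C0: "\<And>x :: 'a. norm x < 1 \<Longrightarrow>
      (\<integral>\<^sup>+y. ennreal (\<bar>rkernel b x y\<bar> * (1 - norm y) powr s) \<partial>ball_measure) \<le> ennreal (C * (1 - norm x) powr (s - b))"
    using rkernel_integral_bound[OF assms, where 'a = 'a] by blast
  have C: "(\<integral>\<^sup>+y. ennreal (\<bar>rkernel b (0::'a) y\<bar> * (1 - norm y) powr s) \<partial>ball_measure) \<le> ennreal C"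
    using C0[of 0] by simp
  define c where "c = 2 / (fact b * sph_area TYPE('a)) * pochhammer (DIM('a) / 2) (Suc b)"
  have c: "c > 0"
  proof -
    have "pochhammer (real DIM('a) / 2) (Suc b) > 0" by (rule pochhammer_pos) simp
    then show ?thesis unfolding c_def using sph_area_pos[where 'a = 'a]
      by (intro mult_pos_pos divide_pos_pos) auto
  qed
  have m: "(\<lambda>y::'a. ennreal ((1 - norm y) powr s)) \<in> borel_measurable ball_measure"
    by (rule measurable_ball_measure) measurable
  have "ennreal c * (\<integral>\<^sup>+y. ennreal ((1 - norm y) powr s) \<partial>(ball_measure :: 'a measure)) =
      (\<integral>\<^sup>+y. ennreal c * ennreal ((1 - norm y) powr s) \<partial>(ball_measure :: 'a measure))"
    by (rule nn_integral_cmult[OF m, symmetric])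
  also have "\<dots> = (\<integral>\<^sup>+y. ennreal (\<bar>rkernel b (0::'a) y\<bar> * (1 - norm y) powr s) \<partial>ball_measure)"
  proof (rule nn_integral_cong)
    fix y :: 'a
    have "rkernel b 0 y = c" by (simp only: rkernel_0 c_def)
    with c show "ennreal c * ennreal ((1 - norm y) powr s) = ennreal (\<bar>rkernel b 0 y\<bar> * (1 - norm y) powr s)"
      by (simp add: ennreal_mult)
  qed
  also have "\<dots> < \<infinity>" using C by (simp add: order.strict_trans1)
  finally show ?thesis using c by (auto simp: ennreal_mult_less_top)
qed

text \<open>The factor 2^b is the price of 1 - |y|^2 \<le> 2 (1 - |y|); the weight that remains has
  exponent b - t > -1.\<close>

lemma integrable_growth_weight:
  fixes f :: "'a::euclidean_space \<Rightarrow> complex"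
  assumes f: "continuous_on (ball 0 1) f" and A: "\<And>y. norm y < 1 \<Longrightarrow> norm (f y) * (1 - norm y) powr t \<le> A"
    and t: "0 < t" "t < real b + 1"
  shows "integrable ball_measure (\<lambda>y. f y * of_real ((1 - (norm y)\<^sup>2) ^ b))"
    and "\<And>y. norm y < 1 \<Longrightarrow> norm (f y * of_real ((1 - (norm y)\<^sup>2) ^ b)) \<le> 2 ^ b * (norm (f y) * (1 - norm y) powr t) * (1 - norm y) powr (real b - t)"
proof -
  show le: "norm (f y * of_real ((1 - (norm y)\<^sup>2) ^ b)) \<le> 2 ^ b * (norm (f y) * (1 - norm y) powr t) * (1 - norm y) powr (real b - t)"
    if y: "norm y < 1" for y
  proof -
    have e: "1 - (norm y)\<^sup>2 = (1 - norm y) * (1 + norm y)" by (simp add: power2_eq_square algebra_simps)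
    have "\<bar>(1 - (norm y)\<^sup>2) ^ b\<bar> = (1 - norm y) ^ b * (1 + norm y) ^ b"
      unfolding e power_mult_distrib using y by (simp add: abs_mult)
    also have "\<dots> \<le> (1 - norm y) ^ b * 2 ^ b"
      using y by (intro mult_left_mono power_mono) auto
    also have "(1 - norm y) ^ b = (1 - norm y) powr t * (1 - norm y) powr (real b - t)"
      using y by (simp add: powr_realpow flip: powr_add)
    finally have "norm (f y) * \<bar>(1 - (norm y)\<^sup>2) ^ b\<bar> \<le> norm (f y) * ((1 - norm y) powr t * (1 - norm y) powr (real b - t) * 2 ^ b)"
      by (rule mult_left_mono) simp
    then show ?thesis by (simp only: norm_mult norm_of_real) (simp add: mult_ac)
  qed
  have m: "(\<lambda>y. f y * of_real ((1 - (norm y)\<^sup>2) ^ b)) \<in> borel_measurable ball_measure"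
    by (rule measurable_ball_measure_continuous) (intro continuous_intros f)
  have wm: "(\<lambda>y::'a. (1 - norm y) powr (real b - t)) \<in> borel_measurable ball_measure"
    by (rule measurable_ball_measure) measurable
  have w: "integrable ball_measure (\<lambda>y::'a. (1 - norm y) powr (real b - t))"
    using wm ball_weight_finite[of "real b - t" b, where 'a = 'a] t
    by (intro integrableI_bounded) auto
  show "integrable ball_measure (\<lambda>y. f y * of_real ((1 - (norm y)\<^sup>2) ^ b))"
  proof (rule Bochner_Integration.integrable_bound[OF _ m])
    show "integrable ball_measure (\<lambda>y::'a. (2 ^ b * A) * (1 - norm y) powr (real b - t))"
      by (intro integrable_mult_right w)
    show "AE y in ball_measure. norm (f y * of_real ((1 - (norm y)\<^sup>2) ^ b)) \<le> norm ((2 ^ b * A) * (1 - norm y) powr (real b - t))"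
    proof (rule AE_I2)
      fix y :: 'a assume "y \<in> space (ball_measure :: 'a measure)"
      then have y: "norm y < 1" by simp
      have "2 ^ b * (norm (f y) * (1 - norm y) powr t) * (1 - norm y) powr (real b - t) \<le> (2 ^ b * A) * (1 - norm y) powr (real b - t)"
        using A[OF y] by (intro mult_right_mono mult_left_mono) auto
      then show "norm (f y * of_real ((1 - (norm y)\<^sup>2) ^ b)) \<le> norm ((2 ^ b * A) * (1 - norm y) powr (real b - t))"
        using le[OF y] by (simp only: real_norm_def)
    qed
  qed
qed

text \<open>In polar coordinates the degree-k term of the kernel extracts the degree-k moment of
  \<open>f\<close>, leaving r^(2k) (1 - r^2)^b. The radial integral cancels the kernel coefficient,
  and the expansion of \<open>f\<close> along the ray through \<open>x\<close> returns.\<close>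

theorem rkernel_reproducing:
  fixes f :: "'a::euclidean_space \<Rightarrow> complex"
  assumes h: "harmonic_on f (ball 0 1)" and g: "integrable ball_measure (\<lambda>y. f y * of_real ((1 - (norm y)\<^sup>2) ^ b))"
    and x: "norm x < 1"
  shows "(LINT y|ball_measure. of_real (rkernel b x y) * (f y * of_real ((1 - (norm y)\<^sup>2) ^ b))) = f x"
proof -
  let ?l = "DIM('a) / 2" and ?w = "sph_area TYPE('a)" and ?R = "radial_measure DIM('a)"
  have w: "?w > 0" by (rule sph_area_pos)
  define c where "c = 2 / (fact b * ?w)"
  interpret R: finite_measure ?R by (rule finite_measure_radial_measure[OF DIM_ge_1])
  define v where "v = direction x"
  have v: "norm v = 1" by (simp add: v_def)
  obtain a :: "nat \<Rightarrow> complex" where a': "(\<forall>r k. 0 < r \<longrightarrow> r < 1 \<longrightarrow>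
       (LINT z|sph. of_real (zon ?l (v \<bullet> z) 1 k) * f (r *\<^sub>R z)) = a k * of_real r ^ k) \<and>
    (\<forall>r. 0 \<le> r \<longrightarrow> r < 1 \<longrightarrow> (\<lambda>k. a k * of_real r ^ k) sums (of_real ?w * f (r *\<^sub>R v)))"
    using harmonic_coeffs[OF h v] by (elim exE)
  have a: "(LINT z|sph. of_real (zon ?l (v \<bullet> z) 1 k) * f (r *\<^sub>R z)) = a k * of_real r ^ k"
    if "0 < r" "r < 1" for r k using a' that by simp
  have as: "(\<lambda>k. a k * of_real r ^ k) sums (of_real ?w * f (r *\<^sub>R v))" if "0 \<le> r" "r < 1" for r
    using a' that by simp
  \<comment> \<open>Extended by zero, because polar integration asks for a function that is Borel on
    the whole space.\<close>
  define f0 where "f0 y = indicator (ball 0 1) y *\<^sub>R f y" for y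
  have f0m [measurable]: "f0 \<in> borel_measurable borel"
    unfolding f0_def [abs_def]
    by (rule borel_measurable_continuous_on_indicator[OF _ harmonic_on_imp_continuous_on[OF h]]) simp
  define G where "G y = of_real (rkernel b x y) * (f0 y * of_real ((1 - (norm y)\<^sup>2) ^ b))" for y
  have G: "G y = of_real (rkernel b x y) * (f y * of_real ((1 - (norm y)\<^sup>2) ^ b))" if "norm y < 1" for y
    using that by (simp add: G_def f0_def)
  have iG: "integrable ball_measure G"
    using integrable_rkernel_mult[OF g x, of b] by (rule Bochner_Integration.integrable_cong[THEN iffD1, rotated 2]) (auto simp: G)
  define L where "L k = pochhammer (real k + ?l) (Suc b)" for k
  have L: "L k > 0" for k
  proof -
    have "0 < real k + ?l" by (rule add_nonneg_pos) auto
    then show ?thesis unfolding L_def by (rule pochhammer_pos)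
  qed
  \<comment> \<open>Since r^(2k) (1 - r^2)^b \<le> 1 for 0 < r < 1, \<open>d k\<close> dominates
    \<open>H k r\<close> in norm for all these radii, and its absolute summability allows termwise
    integration.\<close>
  define d where "d k = of_real (c * L k * norm x ^ k) * a k" for k
  define H where "H k r = complex_of_real (r ^ (2 * k) * (1 - r\<^sup>2) ^ b) * d k" for k r
  have inner: "(\<lambda>k. H k r) sums (LINT z|sph. G (r *\<^sub>R z))" if r: "0 < r" "r < 1" for r
  proof -
    have xr: "0 \<le> norm x * r" "norm x * r < 1"
      using r x mult_strict_mono[of "norm x" 1 r 1] by auto
    have cf: "continuous_on (sphere 0 1) (\<lambda>z. f (r *\<^sub>R z))"
      by (rule continuous_on_compose2[OF harmonic_on_imp_continuous_on[OF h]])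
        (use r in \<open>auto intro!: continuous_intros\<close>)
    have "(\<lambda>k. of_real (c * (1 - r\<^sup>2) ^ b) * (of_real (L k * (norm x * r) ^ k) * (a k * of_real r ^ k)))
        sums (of_real (c * (1 - r\<^sup>2) ^ b) * (LINT z|sph. of_real (kern ?l (Suc b) (v \<bullet> z) (norm x * r)) * f (r *\<^sub>R z)))"
      using sums_mult[OF integral_kern_sums[OF _ v xr cf, of ?l "Suc b"]] by (simp only: a[OF r] L_def)
    moreover have "of_real (c * (1 - r\<^sup>2) ^ b) * (of_real (L k * (norm x * r) ^ k) * (a k * of_real r ^ k)) = H k r" for k
    proof -
      have "r ^ (2 * k) = r ^ k * r ^ k" by (simp add: mult_2 power_add)
      then show ?thesis
        by (simp only: H_def d_def power_mult_distrib of_real_mult of_real_power mult_ac)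
    qed
    moreover have "of_real (c * (1 - r\<^sup>2) ^ b) * (LINT z|sph. of_real (kern ?l (Suc b) (v \<bullet> z) (norm x * r)) * f (r *\<^sub>R z))
        = (LINT z|sph. G (r *\<^sub>R z))"
    proof -
      have "(LINT z|sph. G (r *\<^sub>R z)) = (LINT z|sph. of_real (c * (1 - r\<^sup>2) ^ b) *
          (of_real (kern ?l (Suc b) (v \<bullet> z) (norm x * r)) * f (r *\<^sub>R z)))"
      proof (rule Bochner_Integration.integral_cong[OF refl])
        fix z assume "z \<in> space (sph :: 'a measure)"
        then have z: "norm z = 1" by simp
        have "rkernel b x (r *\<^sub>R z) = c * kern ?l (Suc b) (v \<bullet> z) (norm x * r)"
          using r x z by (subst rkernel_kern) (auto simp: c_def v_def direction_scaleR)
        then show "G (r *\<^sub>R z) = of_real (c * (1 - r\<^sup>2) ^ b) * (of_real (kern ?l (Suc b) (v \<bullet> z) (norm x * r)) * f (r *\<^sub>R z))"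
          using r z by (subst G) auto
      qed
      then show ?thesis by (simp only: integral_mult_right_zero)
    qed
    ultimately show ?thesis by simp
  qed
  have sd: "summable (\<lambda>k. norm (d k))"
  proof -
    define q where "q = (1 + norm x) / 2"
    have q: "0 < q" "q < 1" "norm x < q" using x by (auto simp: q_def add_pos_nonneg)
    \<comment> \<open>The terms of a convergent series are bounded, so \<open>a k\<close> grows at
      most like q^(-k) with q > |x|.\<close>
    have "(\<lambda>k. a k * of_real q ^ k) \<longlonglongrightarrow> 0"
      using summable_LIMSEQ_zero[OF sums_summable[OF as[of q]]] q by simp
    then have "Bseq (\<lambda>k. a k * of_real q ^ k)" by (intro convergent_imp_Bseq) (auto simp: convergent_def)
    then obtain K where K: "\<And>k. norm (a k * of_real q ^ k) \<le> K" unfolding Bseq_def by blast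
    show ?thesis
    proof (rule summable_comparison_test')
      show "summable (\<lambda>k. L k * (norm x / q) ^ k * (c * K))"
        unfolding L_def using q by (intro summable_mult2 summable_pochhammer_power) auto
      fix k
      have c0: "c \<ge> 0" using w by (simp add: c_def)
      have "norm (d k) = c * L k * (norm x / q) ^ k * norm (a k * of_real q ^ k)"
        using L[of k] c0 q by (simp add: d_def norm_mult norm_power power_divide)
      also have "\<dots> \<le> c * L k * (norm x / q) ^ k * K"
        using L[of k] c0 q by (intro mult_left_mono K) auto
      finally show "norm (norm (d k)) \<le> L k * (norm x / q) ^ k * (c * K)" by (simp add: mult_ac)
    qed
  qed
  have Hb: "norm (H k r) \<le> norm (d k)" if "0 < r" "r < 1" for k r
  proof -
    have "\<bar>r ^ (2 * k) * (1 - r\<^sup>2) ^ b\<bar> \<le> 1"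
      using that by (auto simp: abs_mult power_le_one abs_square_le_1 intro!: mult_le_one)
    then show ?thesis unfolding H_def norm_mult norm_of_real by (intro mult_left_le_one_le) auto
  qed
  have iH: "integrable ?R (H k)" for k
  proof (rule R.integrable_const_bound[of _ "norm (d k)"])
    show "AE r in ?R. norm (H k r) \<le> norm (d k)"
      using AE_radial_measure by eventually_elim (rule Hb, auto)
    show "H k \<in> borel_measurable ?R" unfolding H_def [abs_def] by measurable
  qed
  have "(\<lambda>k. LINT r|?R. H k r) sums (LINT r|?R. (\<Sum>k. H k r))"
  proof (rule sums_integral[OF iH])
    show "AE r in ?R. summable (\<lambda>k. norm (H k r))"
      using AE_radial_measure
      by eventually_elim (rule summable_comparison_test'[OF sd], use Hb in auto)
    show "summable (\<lambda>k. LINT r|?R. norm (H k r))"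
    proof (rule summable_comparison_test'[OF summable_mult2[OF sd, of "measure ?R UNIV"]])
      fix k
      have "AE r in ?R. norm (H k r) \<le> norm (d k)"
        using AE_radial_measure by eventually_elim (rule Hb, auto)
      then have "(LINT r|?R. norm (H k r)) \<le> (LINT r|?R. norm (d k))"
        by (intro integral_mono_AE integrable_norm iH R.integrable_const)
      moreover have "0 \<le> (LINT r|?R. norm (H k r))" by (rule integral_nonneg_AE) simp
      ultimately show "norm (LINT r|?R. norm (H k r)) \<le> norm (d k) * measure ?R UNIV"
        by (simp add: mult.commute)
    qed
  qed
  moreover have "(LINT r|?R. (\<Sum>k. H k r)) = (LINT y|ball_measure. G y)"
  proof -
    have Gm: "G \<in> borel_measurable borel" unfolding G_def [abs_def] by measurable
    have "(LINT y|ball_measure. G y) = (LINT r|?R. LINT z|sph. G (r *\<^sub>R z))"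
      by (rule integral_polar[OF iG Gm])
    also have "\<dots> = (LINT r|?R. (\<Sum>k. H k r))"
    proof (rule integral_cong_AE)
      show "AE r in ?R. (LINT z|sph. G (r *\<^sub>R z)) = (\<Sum>k. H k r)"
        using AE_radial_measure
      proof eventually_elim
        case (elim r)
        then show ?case by (intro sums_unique inner) auto
      qed
      show "(\<lambda>r. \<Sum>k. H k r) \<in> borel_measurable ?R" unfolding H_def by measurable
      have [measurable]: "(\<lambda>p. snd p) \<in> ?R \<Otimes>\<^sub>M sph \<rightarrow>\<^sub>M (borel :: 'a measure)"
        by (rule measurable_compose[OF measurable_snd borel_measurable_sph_continuous[OF continuous_on_id]])
      have [measurable]: "(\<lambda>p. fst p) \<in> ?R \<Otimes>\<^sub>M (sph :: 'a measure) \<rightarrow>\<^sub>M borel"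
        by (rule measurable_compose[OF measurable_fst]) simp
      note Gm [measurable]
      show "(\<lambda>r. LINT z|sph. G (r *\<^sub>R z)) \<in> borel_measurable ?R"
        by (rule sph.borel_measurable_lebesgue_integral) (simp only: case_prod_beta', measurable)
    qed
    finally show ?thesis by simp
  qed
  moreover have "(LINT r|?R. H k r) = of_real (1 / ?w) * (a k * of_real (norm x) ^ k)" for k
  proof -
    have "(LINT r|?R. H k r) = of_real (LINT r|?R. r ^ (2 * k) * (1 - r\<^sup>2) ^ b) * d k"
      unfolding H_def by (simp only: integral_mult_left_zero integral_complex_of_real)
    also have "(LINT r|?R. r ^ (2 * k) * (1 - r\<^sup>2) ^ b) = fact b / (2 * L k)"
      unfolding L_def by (rule integral_radial_beta[OF DIM_ge_1])
    also have "of_real (fact b / (2 * L k)) * d k = of_real (fact b / (2 * L k) * (c * L k * norm x ^ k)) * a k"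
      by (simp only: d_def of_real_mult mult.assoc)
    \<comment> \<open>The radial integral is reciprocal to the kernel coefficient; of all constants
      only 1 / area survives.\<close>
    also have "fact b / (2 * L k) * (c * L k * norm x ^ k) = 1 / ?w * norm x ^ k"
      using L[of k] w by (simp add: c_def field_simps)
    finally show ?thesis by simp
  qed
  ultimately have "(\<lambda>k. of_real (1 / ?w) * (a k * of_real (norm x) ^ k)) sums (LINT y|ball_measure. G y)" by simp
  moreover have "(\<lambda>k. of_real (1 / ?w) * (a k * of_real (norm x) ^ k)) sums (of_real (1 / ?w) * (of_real ?w * f (norm x *\<^sub>R v)))"
    by (rule sums_mult[OF as]) (use x in auto)
  ultimately have "(LINT y|ball_measure. G y) = of_real (1 / ?w) * (of_real ?w * f (norm x *\<^sub>R v))"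
    by (rule sums_unique2)
  also have "\<dots> = f x" using w by (simp add: v_def norm_scaleR_direction)
  finally have "(LINT y|ball_measure. G y) = f x" .
  moreover have "(LINT y|ball_measure. G y) = (LINT y|ball_measure. of_real (rkernel b x y) * (f y * of_real ((1 - (norm y)\<^sup>2) ^ b)))"
    by (rule Bochner_Integration.integral_cong) (auto simp: G)
  ultimately show ?thesis by simp
qed

section \<open>A Schur test\<close>

lemma ennpowr_ennreal: "0 \<le> a \<Longrightarrow> ennpowr (ennreal a) p = ennreal (a powr p)"
  by (simp add: ennpowr_def)

lemma ennpowr_top [simp]: "ennpowr top p = top"
  by (simp add: ennpowr_def)

lemma ennpowr_mono:
  assumes "a \<le> b" "0 \<le> p" shows "ennpowr a p \<le> ennpowr b p"
proof (cases "b = top")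
  case False
  then obtain b' where b: "b = ennreal b'" "0 \<le> b'" by (cases b) auto
  then obtain a' where a: "a = ennreal a'" "0 \<le> a'" using assms(1) by (cases a) (auto simp: top_unique)
  have "a' \<le> b'" using assms(1) a b by simp
  then show ?thesis using a b assms(2) by (simp add: ennpowr_ennreal powr_mono2 ennreal_leI)
qed simp

lemma ennpowr_cmult:
  assumes c: "0 < c"
  shows "ennpowr (ennreal c * a) p = ennreal (c powr p) * ennpowr a p"
proof (cases "a = top")
  case True
  have "ennreal c * top = top" "ennreal (c powr p) * top = top"
    using c by (simp_all add: ennreal_mult_top)
  then show ?thesis unfolding True ennpowr_top by simp
next
  case False
  then obtain a' where a: "a = ennreal a'" "0 \<le> a'" by (cases a) auto
  then show ?thesis using c by (simp add: ennpowr_ennreal powr_mult flip: ennreal_mult)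
qed

text \<open>The weights \<tau> and \<tau>^(-(p-1)) cancel in the geometric mean, so the left side is
  free of \<tau> and the right side can be optimised.\<close>

lemma weighted_young:
  fixes u v \<tau> p :: real
  assumes p: "1 < p" and \<tau>: "0 < \<tau>" and uv: "0 \<le> u" "0 \<le> v"
  shows "u powr (1 - 1/p) * v powr (1/p) \<le> (1 - 1/p) * \<tau> * u + 1/p * \<tau> powr (- (p - 1)) * v"
proof (cases "u = 0 \<or> v = 0")
  case True
  then show ?thesis using p \<tau> uv by (auto intro!: mult_nonneg_nonneg add_nonneg_nonneg)
next
  case False
  have "(\<tau> * u) powr (1 - 1/p) * (\<tau> powr (- (p - 1)) * v) powr (1/p) \<le> (1 - 1/p) * (\<tau> * u) + 1/p * (\<tau> powr (- (p - 1)) * v)"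
    using False uv p \<tau> by (intro Youngs_inequality_0) auto
  moreover have "(\<tau> * u) powr (1 - 1/p) * (\<tau> powr (- (p - 1)) * v) powr (1/p) = u powr (1 - 1/p) * v powr (1/p)"
  proof -
    have "\<tau> powr (1 - 1/p) * (\<tau> powr (- (p - 1))) powr (1/p) = \<tau> powr ((1 - 1/p) + (- (p - 1)) * (1/p))"
      by (simp only: powr_powr powr_add)
    also have "(1 - 1/p) + (- (p - 1)) * (1/p) = 0" using p by (simp add: field_simps)
    finally have "\<tau> powr (1 - 1/p) * (\<tau> powr (- (p - 1))) powr (1/p) = 1" using \<tau> by simp
    then show ?thesis using uv \<tau> by (simp add: powr_mult mult_ac)
  qed
  ultimately show ?thesis by (simp add: mult.assoc)
qed

text \<open>Young's inequality, optimised over \<open>\<tau>\<close>.\<close>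
lemma nn_integral_holder:
  fixes F G :: "'a \<Rightarrow> real"
  assumes p: "1 < p" and F: "F \<in> borel_measurable M" "\<And>x. 0 \<le> F x"
    and G: "G \<in> borel_measurable M" "\<And>x. 0 \<le> G x"
    and A: "(\<integral>\<^sup>+x. ennreal (F x) \<partial>M) \<le> ennreal A" "0 < A"
  shows "ennpowr (\<integral>\<^sup>+x. ennreal (F x powr (1 - 1/p) * G x powr (1/p)) \<partial>M) p
    \<le> ennreal (A powr (p - 1)) * (\<integral>\<^sup>+x. ennreal (G x) \<partial>M)"
proof (cases "(\<integral>\<^sup>+x. ennreal (G x) \<partial>M) = \<infinity>")
  case True
  have "ennreal (A powr (p - 1)) * \<infinity> = \<infinity>" using A(2) by (simp add: ennreal_mult_top)
  with True show ?thesis by simp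
next
  case False
  note [measurable] = F(1) G(1)
  obtain B where B: "(\<integral>\<^sup>+x. ennreal (G x) \<partial>M) = ennreal B" "0 \<le> B"
    using False by (cases "\<integral>\<^sup>+x. ennreal (G x) \<partial>M") auto
  let ?I = "\<integral>\<^sup>+x. ennreal (F x powr (1 - 1/p) * G x powr (1/p)) \<partial>M"
  have bound: "?I \<le> ennreal ((1 - 1/p) * \<tau> * A + 1/p * \<tau> powr (- (p - 1)) * B)" if \<tau>: "0 < \<tau>" for \<tau>
  proof -
    have c: "0 \<le> (1 - 1/p) * \<tau>" "0 \<le> 1/p * \<tau> powr (- (p - 1))" using p \<tau> by auto
    have "?I \<le> (\<integral>\<^sup>+x. ennreal ((1 - 1/p) * \<tau> * F x + 1/p * \<tau> powr (- (p - 1)) * G x) \<partial>M)"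
      by (intro nn_integral_mono ennreal_leI weighted_young p \<tau> F G)
    also have "\<dots> = (\<integral>\<^sup>+x. ennreal ((1 - 1/p) * \<tau>) * ennreal (F x) + ennreal (1/p * \<tau> powr (- (p - 1))) * ennreal (G x) \<partial>M)"
      by (intro nn_integral_cong) (simp only: ennreal_plus ennreal_mult c F(2) G(2) mult_nonneg_nonneg)
    also have "\<dots> = ennreal ((1 - 1/p) * \<tau>) * (\<integral>\<^sup>+x. ennreal (F x) \<partial>M) + ennreal (1/p * \<tau> powr (- (p - 1))) * (\<integral>\<^sup>+x. ennreal (G x) \<partial>M)"
      by (simp add: nn_integral_add nn_integral_cmult)
    also have "\<dots> \<le> ennreal ((1 - 1/p) * \<tau>) * ennreal A + ennreal (1/p * \<tau> powr (- (p - 1))) * ennreal B"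
      unfolding B(1) by (intro add_mono mult_left_mono A) auto
    also have "\<dots> = ennreal ((1 - 1/p) * \<tau> * A + 1/p * \<tau> powr (- (p - 1)) * B)"
      by (simp only: ennreal_plus ennreal_mult c less_imp_le[OF A(2)] B(2) mult_nonneg_nonneg)
    finally show ?thesis .
  qed
  then have "?I < \<infinity>" using bound[of 1] by (simp add: order.strict_trans1)
  then obtain i where i: "?I = ennreal i" "0 \<le> i" by (cases ?I) auto
  have ib: "i \<le> (1 - 1/p) * \<tau> * A + 1/p * \<tau> powr (- (p - 1)) * B" if "0 < \<tau>" for \<tau>
  proof -
    have "0 \<le> (1 - 1/p) * \<tau> * A + 1/p * \<tau> powr (- (p - 1)) * B"
      using p that A(2) B(2) by (intro add_nonneg_nonneg mult_nonneg_nonneg) auto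
    then show ?thesis using bound[OF that] i by (simp del: ennreal_plus)
  qed
  have "i powr p \<le> A powr (p - 1) * B"
  proof -
    \<comment> \<open>A strict upper bound \<open>B'\<close> is positive even when
      \<open>B = 0\<close>, so the optimal \<tau> is positive; afterwards \<open>B'\<close>
      decreases to \<open>B\<close>.\<close>
    have "i powr p / A powr (p - 1) \<le> B'" if B': "B < B'" for B'
    proof -
      have B'0: "0 < B'" using B(2) B' by simp
      \<comment> \<open>This choice makes \<tau> A equal to \<tau>^(-(p-1)) B', so the convex
        combination collapses to \<tau> A.\<close>
      define \<tau> where "\<tau> = (B' / A) powr (1/p)"
      have \<tau>: "0 < \<tau>" using B'0 A(2) by (simp add: \<tau>_def)
      have e: "\<tau> powr (- (p - 1)) * B' = \<tau> * A"
      proof -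
        have "\<tau> powr p = B' / A" using p B'0 A(2) by (simp add: \<tau>_def powr_powr)
        moreover have "\<tau> powr p = \<tau> * \<tau> powr (p - 1)" using \<tau> by (simp add: powr_diff)
        ultimately have "B' = \<tau> * A * \<tau> powr (p - 1)" using A(2) by (simp add: field_simps)
        moreover have "\<tau> powr (- (p - 1)) * \<tau> powr (p - 1) = 1" using \<tau> by (simp flip: powr_add)
        ultimately show ?thesis by (metis mult.assoc mult.commute mult_1_right)
      qed
      have "i \<le> (1 - 1/p) * \<tau> * A + 1/p * \<tau> powr (- (p - 1)) * B" by (rule ib[OF \<tau>])
      also have "\<dots> \<le> (1 - 1/p) * \<tau> * A + 1/p * (\<tau> powr (- (p - 1)) * B')"
        using B' p by (simp add: mult.assoc mult_left_mono divide_right_mono)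
      also have "\<dots> = \<tau> * A" unfolding e using p by (simp add: field_simps)
      finally have "i powr p \<le> (\<tau> * A) powr p" using i(2) p by (intro powr_mono2) auto
      also have "\<dots> = (B' / A) * A powr p" using \<tau> A(2) p B'0 by (simp add: powr_mult \<tau>_def powr_powr)
      also have "\<dots> = B' * A powr (p - 1)" using A(2) by (simp add: powr_diff)
      finally show ?thesis using A(2) by (simp add: divide_le_eq)
    qed
    then have "i powr p / A powr (p - 1) \<le> B" by (rule dense_ge)
    then show ?thesis using A(2) by (simp add: divide_le_eq mult.commute)
  qed
  then show ?thesis unfolding i(1) B(1) ennpowr_ennreal[OF i(2)]
    using B(2) by (simp add: ennreal_leI flip: ennreal_mult)
qed

lemma measurable_ball_pair:
  assumes "(\<lambda>p. f (fst p) (snd p)) \<in> borel_measurable (borel \<Otimes>\<^sub>M (borel :: 'a::euclidean_space measure))"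
  shows "(\<lambda>p. f (fst p) (snd p)) \<in> borel_measurable ((ball_measure :: 'a measure) \<Otimes>\<^sub>M (ball_measure :: 'a measure))"
proof -
  have "(\<lambda>p. (fst p, snd p)) \<in> (ball_measure :: 'a measure) \<Otimes>\<^sub>M (ball_measure :: 'a measure) \<rightarrow>\<^sub>M borel \<Otimes>\<^sub>M borel"
    by (intro measurable_Pair measurable_compose[OF measurable_fst measurable_ident_ball_measure]
        measurable_compose[OF measurable_snd measurable_ident_ball_measure])
  from measurable_compose[OF this assms] show ?thesis by simp
qed

text \<open>
  The Schur test with the weight \<open>(1 - |y|)^(-c)\<close>; the exponent \<open>c\<close> has to satisfy the
  four inequalities below.
\<close>
theorem rkernel_schur:
  fixes u :: "'a::euclidean_space \<Rightarrow> complex"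
  assumes p: "1 < p" and \<alpha>: "-1 < \<alpha>" and b: "(\<alpha> + 1) / p < real b + 1"
    and u: "continuous_on (ball 0 1) u"
    and fin: "(\<integral>\<^sup>+x. ennreal (norm (u x) powr p * (1 - norm x) powr \<alpha>) \<partial>ball_measure) < \<infinity>"
  shows "(\<integral>\<^sup>+x. ennpowr (\<integral>\<^sup>+y. ennreal (\<bar>rkernel b x y\<bar> * norm (u y) * (1 - norm y) powr real b) \<partial>ball_measure) p
     * ennreal ((1 - norm x) powr \<alpha>) \<partial>(ball_measure :: 'a measure)) < \<infinity>"
proof -
  \<comment> \<open>The exponent conjugate to \<open>p\<close>.\<close>
  define q where "q = p / (p - 1)"
  have q: "1/q = 1 - 1/p" "q > 0" "q * (p - 1) = p" using p by (auto simp: q_def field_simps)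
  have "max 0 ((\<alpha> - b) / p) < min ((real b + 1) / q) ((\<alpha> + 1) / p)"
  proof -
    have "(\<alpha> - b) / p < (real b + 1) / q"
    proof -
      have "\<alpha> + 1 < (real b + 1) * p" using b p by (simp add: divide_less_eq)
      then have "\<alpha> - b < (real b + 1) * (p - 1)" by (simp add: algebra_simps)
      then have "(\<alpha> - b) / p < (real b + 1) * (p - 1) / p" using p by (intro divide_strict_right_mono) auto
      then show ?thesis by (simp add: q_def)
    qed
    moreover have "(\<alpha> - b) / p < (\<alpha> + 1) / p" using p by (intro divide_strict_right_mono) auto
    moreover have "0 < (real b + 1) / q" "0 < (\<alpha> + 1) / p" using p q \<alpha> by auto
    ultimately show ?thesis by simp
  qed
  then obtain c where c: "max 0 ((\<alpha> - b) / p) < c" "c < min ((real b + 1) / q) ((\<alpha> + 1) / p)"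
    using dense by blast
  \<comment> \<open>The first and third inequalities place b - c q in (-1, b), the other two place
    \<alpha> - c p there: the ranges required by the two applications of the kernel
    estimate.\<close>
  have c1: "0 < c" "\<alpha> - c * p < real b" "c * q < real b + 1" "-1 < \<alpha> - c * p"
    using c p q by (auto simp: divide_less_eq less_divide_eq)
  have s1: "-1 < real b - c * q" "real b - c * q < real b" using c1 q by auto
  obtain C1 where C1: "C1 > 0" "\<And>x :: 'a. norm x < 1 \<Longrightarrow>
    (\<integral>\<^sup>+y. ennreal (\<bar>rkernel b x y\<bar> * (1 - norm y) powr (real b - c * q)) \<partial>ball_measure) \<le> ennreal (C1 * (1 - norm x) powr (real b - c * q - b))"
    using rkernel_integral_bound[OF s1, where 'a = 'a] by blast
  obtain C2 where C2: "C2 > 0" "\<And>x :: 'a. norm x < 1 \<Longrightarrow>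
    (\<integral>\<^sup>+y. ennreal (\<bar>rkernel b x y\<bar> * (1 - norm y) powr (\<alpha> - c * p)) \<partial>ball_measure) \<le> ennreal (C2 * (1 - norm x) powr (\<alpha> - c * p - b))"
    using rkernel_integral_bound[OF c1(4,2), where 'a = 'a] by blast
  define K where "K = C1 powr (p - 1)"
  \<comment> \<open>Weighted so that the Hoelder factors recombine to the original weight: (b - c
    q)/q + (b + c p)/p = b.\<close>
  define w where "w y = norm (u y) powr p * (1 - norm y) powr (real b + c * p)" for y
  note um [measurable] = measurable_ball_measure_continuous[OF u]
  note measurable_ident_ball_measure [measurable]
  have wm [measurable]: "w \<in> borel_measurable ball_measure"
    unfolding w_def [abs_def] by measurable
  have km: "(\<lambda>y. \<bar>rkernel b x y\<bar>) \<in> borel_measurable ball_measure" for x :: 'a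
    by (rule measurable_ball_measure) measurable
  have holder: "ennpowr (\<integral>\<^sup>+y. ennreal (\<bar>rkernel b x y\<bar> * norm (u y) * (1 - norm y) powr real b) \<partial>ball_measure) p
      \<le> ennreal (K * (1 - norm x) powr (- c * p)) * (\<integral>\<^sup>+y. ennreal (\<bar>rkernel b x y\<bar> * w y) \<partial>ball_measure)"
    if x: "norm x < 1" for x :: 'a
  proof -
    define F where "F y = \<bar>rkernel b x y\<bar> * (1 - norm y) powr (real b - c * q)" for y
    define G where "G y = \<bar>rkernel b x y\<bar> * w y" for y
    have "ennpowr (\<integral>\<^sup>+y. ennreal (F y powr (1 - 1/p) * G y powr (1/p)) \<partial>ball_measure) p
        \<le> ennreal ((C1 * (1 - norm x) powr (real b - c * q - b)) powr (p - 1)) * (\<integral>\<^sup>+y. ennreal (G y) \<partial>ball_measure)"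
    proof (rule nn_integral_holder[OF p])
      show "F \<in> borel_measurable ball_measure" unfolding F_def [abs_def] by (rule measurable_ball_measure) measurable
      show "G \<in> borel_measurable ball_measure" unfolding G_def [abs_def] using km wm by measurable
      show "0 \<le> F y" "0 \<le> G y" for y by (auto simp: F_def G_def w_def)
      show "(\<integral>\<^sup>+y. ennreal (F y) \<partial>ball_measure) \<le> ennreal (C1 * (1 - norm x) powr (real b - c * q - b))"
        unfolding F_def by (rule C1(2)[OF x])
      show "0 < C1 * (1 - norm x) powr (real b - c * q - b)" using C1(1) x by simp
    qed
    moreover have "(C1 * (1 - norm x) powr (real b - c * q - b)) powr (p - 1) = K * (1 - norm x) powr (- c * p)"
    proof -
      have "(real b - c * q - real b) * (p - 1) = - c * (q * (p - 1))" by simp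
      also have "\<dots> = - c * p" by (simp only: q(3))
      finally have e: "(real b - c * q - real b) * (p - 1) = - c * p" .
      have "(C1 * (1 - norm x) powr (real b - c * q - b)) powr (p - 1) =
          C1 powr (p - 1) * (1 - norm x) powr ((real b - c * q - real b) * (p - 1))"
        using C1(1) by (simp only: powr_mult powr_powr less_imp_le powr_ge_zero)
      then show ?thesis by (simp only: e K_def)
    qed
    moreover have "(\<integral>\<^sup>+y. ennreal (F y powr (1 - 1/p) * G y powr (1/p)) \<partial>ball_measure) =
        (\<integral>\<^sup>+y. ennreal (\<bar>rkernel b x y\<bar> * norm (u y) * (1 - norm y) powr real b) \<partial>ball_measure)"
    proof (rule nn_integral_cong)
      fix y :: 'a assume "y \<in> space ball_measure"
      then have y: "1 - norm y > 0" by simp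
      have "F y powr (1 - 1/p) * G y powr (1/p) =
          (\<bar>rkernel b x y\<bar> powr (1 - 1/p) * \<bar>rkernel b x y\<bar> powr (1/p)) * (norm (u y) powr p) powr (1/p) *
          ((1 - norm y) powr ((real b - c * q) * (1 - 1/p)) * (1 - norm y) powr ((real b + c * p) * (1/p)))"
        by (simp add: F_def G_def w_def powr_mult powr_powr mult_ac)
      also have "\<bar>rkernel b x y\<bar> powr (1 - 1/p) * \<bar>rkernel b x y\<bar> powr (1/p) = \<bar>rkernel b x y\<bar>"
        by (simp flip: powr_add)
      also have "(norm (u y) powr p) powr (1/p) = norm (u y)" using p by (simp add: powr_powr)
      also have "(1 - norm y) powr ((real b - c * q) * (1 - 1/p)) * (1 - norm y) powr ((real b + c * p) * (1/p)) = (1 - norm y) powr real b"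
      proof -
        have "(real b - c * q) * (1 - 1/p) + (real b + c * p) * (1/p) = (real b - c * q) * (1/q) + (real b + c * p) * (1/p)"
          by (simp only: q(1))
        also have "\<dots> = real b * (1/q + 1/p)" using p q(2) by (simp add: field_simps)
        also have "\<dots> = real b" by (simp add: q(1))
        finally show ?thesis by (simp flip: powr_add)
      qed
      finally show "ennreal (F y powr (1 - 1/p) * G y powr (1/p)) = ennreal (\<bar>rkernel b x y\<bar> * norm (u y) * (1 - norm y) powr real b)"
        by simp
    qed
    ultimately show ?thesis unfolding G_def by simp
  qed
  have fm: "(\<lambda>p. ennreal (\<bar>rkernel b (fst p) (snd p)\<bar> * (1 - norm (fst p)) powr (\<alpha> - c * p'))) \<in>
      borel_measurable ((ball_measure :: 'a measure) \<Otimes>\<^sub>M (ball_measure :: 'a measure))" for p'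
    by (rule measurable_ball_pair[where f = "\<lambda>x y. ennreal (\<bar>rkernel b x y\<bar> * (1 - norm x) powr (\<alpha> - c * p'))"]) measurable
  have "(\<integral>\<^sup>+x. ennpowr (\<integral>\<^sup>+y. ennreal (\<bar>rkernel b x y\<bar> * norm (u y) * (1 - norm y) powr real b) \<partial>ball_measure) p
     * ennreal ((1 - norm x) powr \<alpha>) \<partial>(ball_measure :: 'a measure)) \<le>
     (\<integral>\<^sup>+x. \<integral>\<^sup>+y. ennreal K * (ennreal (\<bar>rkernel b x y\<bar> * (1 - norm x) powr (\<alpha> - c * p)) * ennreal (w y)) \<partial>ball_measure \<partial>ball_measure)"
  proof (rule nn_integral_mono)
    fix x :: 'a assume "x \<in> space ball_measure"
    then have x: "norm x < 1" by simp
    have km': "(\<lambda>y. ennreal (\<bar>rkernel b x y\<bar> * w y)) \<in> borel_measurable ball_measure" using km wm by measurable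
    have "ennpowr (\<integral>\<^sup>+y. ennreal (\<bar>rkernel b x y\<bar> * norm (u y) * (1 - norm y) powr real b) \<partial>ball_measure) p * ennreal ((1 - norm x) powr \<alpha>)
      \<le> ennreal (K * (1 - norm x) powr (- c * p)) * (\<integral>\<^sup>+y. ennreal (\<bar>rkernel b x y\<bar> * w y) \<partial>ball_measure) * ennreal ((1 - norm x) powr \<alpha>)"
      by (rule mult_right_mono[OF holder[OF x]]) simp
    also have "\<dots> = ennreal (K * (1 - norm x) powr (\<alpha> - c * p)) * (\<integral>\<^sup>+y. ennreal (\<bar>rkernel b x y\<bar> * w y) \<partial>ball_measure)"
    proof -
      have "ennreal (K * (1 - norm x) powr (- c * p)) * ennreal ((1 - norm x) powr \<alpha>) = ennreal (K * ((1 - norm x) powr (- c * p) * (1 - norm x) powr \<alpha>))"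
        by (simp add: K_def mult.assoc flip: ennreal_mult)
      also have "(1 - norm x) powr (- c * p) * (1 - norm x) powr \<alpha> = (1 - norm x) powr (\<alpha> - c * p)"
        by (simp add: algebra_simps flip: powr_add)
      finally have e: "ennreal (K * (1 - norm x) powr (- c * p)) * ennreal ((1 - norm x) powr \<alpha>) = ennreal (K * (1 - norm x) powr (\<alpha> - c * p))" .
      show ?thesis unfolding e[symmetric] by (simp only: mult_ac)
    qed
    also have "\<dots> = (\<integral>\<^sup>+y. ennreal (K * (1 - norm x) powr (\<alpha> - c * p)) * ennreal (\<bar>rkernel b x y\<bar> * w y) \<partial>ball_measure)"
      by (rule nn_integral_cmult[OF km', symmetric])
    also have "\<dots> = (\<integral>\<^sup>+y. ennreal K * (ennreal (\<bar>rkernel b x y\<bar> * (1 - norm x) powr (\<alpha> - c * p)) * ennreal (w y)) \<partial>ball_measure)"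
      by (intro nn_integral_cong) (simp add: K_def w_def mult_ac flip: ennreal_mult)
    finally show "ennpowr (\<integral>\<^sup>+y. ennreal (\<bar>rkernel b x y\<bar> * norm (u y) * (1 - norm y) powr real b) \<partial>ball_measure) p * ennreal ((1 - norm x) powr \<alpha>)
      \<le> (\<integral>\<^sup>+y. ennreal K * (ennreal (\<bar>rkernel b x y\<bar> * (1 - norm x) powr (\<alpha> - c * p)) * ennreal (w y)) \<partial>ball_measure)" .
  qed
  also have "\<dots> = (\<integral>\<^sup>+y. \<integral>\<^sup>+x. ennreal K * (ennreal (\<bar>rkernel b x y\<bar> * (1 - norm x) powr (\<alpha> - c * p)) * ennreal (w y)) \<partial>ball_measure \<partial>(ball_measure :: 'a measure))"
  proof -
    interpret P: pair_sigma_finite "ball_measure :: 'a measure" "ball_measure :: 'a measure" ..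
    have "(\<lambda>p. w (snd p)) \<in> borel_measurable ((ball_measure :: 'a measure) \<Otimes>\<^sub>M ball_measure)"
      by (rule measurable_compose[OF measurable_snd wm])
    then have "(\<lambda>(x, y). ennreal K * (ennreal (\<bar>rkernel b x y\<bar> * (1 - norm x) powr (\<alpha> - c * p)) * ennreal (w y)))
        \<in> borel_measurable ((ball_measure :: 'a measure) \<Otimes>\<^sub>M ball_measure)"
      using fm[of p] unfolding case_prod_beta by measurable
    from P.Fubini'[OF this] show ?thesis by simp
  qed
  \<comment> \<open>Now \<open>x\<close> is the integration variable; symmetry of the kernel turns
    the inner integral into the second estimate, with exponent \<alpha> - c p.\<close>
  also have "\<dots> \<le> (\<integral>\<^sup>+y. ennreal (K * C2) * ennreal (norm (u y) powr p * (1 - norm y) powr \<alpha>) \<partial>(ball_measure :: 'a measure))"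
  proof (rule nn_integral_mono)
    fix y :: 'a assume "y \<in> space ball_measure"
    then have y: "norm y < 1" by simp
    have m: "(\<lambda>x. ennreal (\<bar>rkernel b y x\<bar> * (1 - norm x) powr (\<alpha> - c * p))) \<in> borel_measurable ball_measure"
      by (rule measurable_ball_measure) measurable
    have "(\<integral>\<^sup>+x. ennreal K * (ennreal (\<bar>rkernel b x y\<bar> * (1 - norm x) powr (\<alpha> - c * p)) * ennreal (w y)) \<partial>ball_measure)
        = (\<integral>\<^sup>+x. (ennreal K * ennreal (w y)) * ennreal (\<bar>rkernel b y x\<bar> * (1 - norm x) powr (\<alpha> - c * p)) \<partial>ball_measure)"
      by (simp add: mult_ac rkernel_commute[of b _ y])
    also have "\<dots> = (ennreal K * ennreal (w y)) * (\<integral>\<^sup>+x. ennreal (\<bar>rkernel b y x\<bar> * (1 - norm x) powr (\<alpha> - c * p)) \<partial>ball_measure)"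
      by (rule nn_integral_cmult[OF m])
    also have "\<dots> \<le> (ennreal K * ennreal (w y)) * ennreal (C2 * (1 - norm y) powr (\<alpha> - c * p - b))"
      by (intro mult_left_mono C2(2) y) simp
    also have "\<dots> = ennreal (K * (norm (u y) powr p * (1 - norm y) powr (real b + c * p)) * (C2 * (1 - norm y) powr (\<alpha> - c * p - b)))"
      using C2(1) by (simp add: K_def w_def flip: ennreal_mult)
    also have "K * (norm (u y) powr p * (1 - norm y) powr (real b + c * p)) * (C2 * (1 - norm y) powr (\<alpha> - c * p - b)) =
        (K * C2) * (norm (u y) powr p * ((1 - norm y) powr (real b + c * p) * (1 - norm y) powr (\<alpha> - c * p - b)))"
      by (simp add: mult_ac)
    \<comment> \<open>The exponents b + c p and \<alpha> - c p - b add up to \<alpha>, which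
      restores the Bergman weight.\<close>
    also have "(1 - norm y) powr (real b + c * p) * (1 - norm y) powr (\<alpha> - c * p - b) = (1 - norm y) powr \<alpha>"
      by (simp flip: powr_add)
    also have "ennreal ((K * C2) * (norm (u y) powr p * (1 - norm y) powr \<alpha>)) = ennreal (K * C2) * ennreal (norm (u y) powr p * (1 - norm y) powr \<alpha>)"
      using C2(1) by (intro ennreal_mult) (auto simp: K_def)
    finally show "(\<integral>\<^sup>+x. ennreal K * (ennreal (\<bar>rkernel b x y\<bar> * (1 - norm x) powr (\<alpha> - c * p)) * ennreal (w y)) \<partial>ball_measure)
        \<le> ennreal (K * C2) * ennreal (norm (u y) powr p * (1 - norm y) powr \<alpha>)" .
  qed
  also have "\<dots> = ennreal (K * C2) * (\<integral>\<^sup>+y. ennreal (norm (u y) powr p * (1 - norm y) powr \<alpha>) \<partial>(ball_measure :: 'a measure))"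
  proof (rule nn_integral_cmult)
    show "(\<lambda>y. ennreal (norm (u y) powr p * (1 - norm y) powr \<alpha>)) \<in> borel_measurable (ball_measure :: 'a measure)"
      by measurable
  qed
  also have "\<dots> < \<infinity>" using fin by (simp add: ennreal_mult_less_top)
  finally show ?thesis .
qed

section \<open>The distance\<close>

definition superlevel_inner :: "nat \<Rightarrow> real \<Rightarrow> 'a::euclidean_space set \<Rightarrow> 'a \<Rightarrow> ennreal" where
  "superlevel_inner b t U x =
     (\<integral>\<^sup>+y. ennreal (\<bar>rkernel b x y\<bar> * (1 - norm y) powr (real b - t)) * indicator U y \<partial>ball_measure)"

lemma superlevel_subset: "superlevel \<epsilon> t f \<subseteq> ball 0 1"
  by (auto simp: superlevel_def)

lemma superlevel_integral_eq:
  fixes f :: "'a::euclidean_space \<Rightarrow> complex"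
  shows "superlevel_integral (real b) t p \<alpha> \<epsilon> f =
    (\<integral>\<^sup>+x. ennpowr (superlevel_inner b t (superlevel \<epsilon> t f) x) p * ennreal ((1 - norm x) powr \<alpha>) \<partial>ball_measure)"
proof -
  let ?U = "superlevel \<epsilon> t f"
  have inner: "(\<integral>\<^sup>+y\<in>?U. ennreal (norm (bergman_kernel (real b) x y) * (1 - norm y) powr (real b - t)) \<partial>lborel) =
      superlevel_inner b t ?U x" if x: "norm x < 1" for x
    unfolding superlevel_inner_def nn_integral_ball_measure
  proof (rule nn_integral_cong)
    fix y :: 'a
    show "ennreal (norm (bergman_kernel (real b) x y) * (1 - norm y) powr (real b - t)) * indicator ?U y =
        ennreal (\<bar>rkernel b x y\<bar> * (1 - norm y) powr (real b - t)) * indicator ?U y * indicator (ball 0 1) y"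
    proof (cases "y \<in> ?U")
      case True
      then have y: "norm y < 1" using superlevel_subset[of \<epsilon> t f] by auto
      then have "norm (bergman_kernel (real b) x y) = \<bar>rkernel b x y\<bar>"
        by (subst bergman_kernel_eq) (use x in auto)
      with True y show ?thesis by simp
    qed simp
  qed
  show ?thesis unfolding superlevel_integral_def nn_integral_ball_measure
  proof (rule nn_integral_cong)
    fix x :: 'a
    show "ennpowr (\<integral>\<^sup>+y\<in>?U. ennreal (norm (bergman_kernel (real b) x y) * (1 - norm y) powr (real b - t)) \<partial>lborel) p *
        ennreal ((1 - norm x) powr \<alpha>) * indicator (ball 0 1) x =
        ennpowr (superlevel_inner b t ?U x) p * ennreal ((1 - norm x) powr \<alpha>) * indicator (ball 0 1) x"
      by (cases "norm x < 1") (simp_all add: inner)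
  qed
qed

lemma bergman_norm_finite_iff:
  "bergman_norm p \<alpha> f < \<infinity> \<longleftrightarrow>
    (\<integral>\<^sup>+x. ennreal (norm (f x) powr p * (1 - norm x) powr \<alpha>) \<partial>(ball_measure :: 'a::euclidean_space measure)) < \<infinity>"
  by (auto simp: bergman_norm_def ennpowr_def nn_integral_ball_measure top.not_eq_extremum split: if_splits)

lemma growth_normD:
  assumes "growth_norm t f \<le> ennreal A" "0 \<le> A" "norm x < 1"
  shows "norm (f x) * (1 - norm x) powr t \<le> A"
proof -
  have "ennreal (norm (f x) * (1 - norm x) powr t) \<le> growth_norm t f"
    unfolding growth_norm_def by (rule SUP_upper) (use assms(3) in simp)
  then have "ennreal (norm (f x) * (1 - norm x) powr t) \<le> ennreal A" using assms(1) by (rule order_trans)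
  then show ?thesis using assms(2) by simp
qed

lemma superlevel_sets:
  fixes f :: "'a::euclidean_space \<Rightarrow> complex"
  assumes "continuous_on (ball 0 1) f"
  shows "superlevel \<epsilon> t f \<in> sets ball_measure"
proof -
  note [measurable] = measurable_ball_measure_continuous[OF assms] measurable_ident_ball_measure
  have "{x \<in> space (ball_measure :: 'a measure). \<epsilon> \<le> norm (f x) * (1 - norm x) powr t} \<in> sets ball_measure"
    by measurable
  then show ?thesis by (simp add: superlevel_def)
qed

lemma critical_level_le_growth_norm:
  fixes f u :: "'a::euclidean_space \<Rightarrow> complex"
  assumes p: "1 < p" and \<alpha>: "-1 < \<alpha>" and b: "(\<alpha> + 1) / p < real b + 1"
    and u: "u \<in> bergman_space p \<alpha>"
  shows "critical_level (real b) t p \<alpha> f \<le> growth_norm t (\<lambda>x. f x - u x)"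
proof (cases "growth_norm t (\<lambda>x. f x - u x)")
  case (real g)
  have uc: "continuous_on (ball 0 1) u"
    using u by (auto simp: bergman_space_def intro: harmonic_on_imp_continuous_on)
  have ui: "(\<integral>\<^sup>+x. ennreal (norm (u x) powr p * (1 - norm x) powr \<alpha>) \<partial>(ball_measure :: 'a measure)) < \<infinity>"
    using u bergman_norm_finite_iff[of p \<alpha> u] by (simp add: bergman_space_def)
  define S where "S = (\<lambda>x::'a. \<integral>\<^sup>+y. ennreal (\<bar>rkernel b x y\<bar> * norm (u y) * (1 - norm y) powr real b) \<partial>ball_measure)"
  have S: "(\<integral>\<^sup>+x. ennpowr (S x) p * ennreal ((1 - norm x) powr \<alpha>) \<partial>ball_measure) < \<infinity>"
    unfolding S_def by (rule rkernel_schur[OF p \<alpha> b uc ui])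
  have km: "(\<lambda>y. ennreal (\<bar>rkernel b x y\<bar> * norm (u y) * (1 - norm y) powr real b)) \<in> borel_measurable ball_measure" for x :: 'a
  proof -
    note [measurable] = measurable_ball_measure_continuous[OF uc] measurable_ident_ball_measure
    show ?thesis by measurable
  qed
  have lev: "critical_level (real b) t p \<alpha> f \<le> ennreal \<epsilon>" if \<epsilon>: "g < \<epsilon>" for \<epsilon>
  proof -
    define \<delta> where "\<delta> = \<epsilon> - g"
    have \<delta>: "\<delta> > 0" using \<epsilon> by (simp add: \<delta>_def)
    let ?U = "superlevel \<epsilon> t f"
    have uU: "\<delta> \<le> norm (u y) * (1 - norm y) powr t" if y: "y \<in> ?U" for y
    proof -
      have y1: "norm y < 1" "\<epsilon> \<le> norm (f y) * (1 - norm y) powr t" using y by (auto simp: superlevel_def)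
      have "norm (f y - u y) * (1 - norm y) powr t \<le> g"
        by (rule growth_normD[where f = "\<lambda>x. f x - u x"]) (use real y1 in auto)
      moreover have "norm (f y) * (1 - norm y) powr t \<le> (norm (f y - u y) + norm (u y)) * (1 - norm y) powr t"
        using norm_triangle_ineq[of "f y - u y" "u y"] by (intro mult_right_mono) auto
      ultimately show ?thesis using y1 unfolding \<delta>_def distrib_right by linarith
    qed
    have inner: "superlevel_inner b t ?U x \<le> ennreal (1 / \<delta>) * S x" for x :: 'a
    proof -
      have "superlevel_inner b t ?U x \<le>
          (\<integral>\<^sup>+y. ennreal (1 / \<delta>) * ennreal (\<bar>rkernel b x y\<bar> * norm (u y) * (1 - norm y) powr real b) \<partial>ball_measure)"
        unfolding superlevel_inner_def
      proof (rule nn_integral_mono)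
        fix y :: 'a assume "y \<in> space ball_measure"
        then have y: "norm y < 1" by simp
        show "ennreal (\<bar>rkernel b x y\<bar> * (1 - norm y) powr (real b - t)) * indicator ?U y
            \<le> ennreal (1 / \<delta>) * ennreal (\<bar>rkernel b x y\<bar> * norm (u y) * (1 - norm y) powr real b)"
        proof (cases "y \<in> ?U")
          case True
          \<comment> \<open>A factor that is at least 1 on the superlevel set: inserting it brings
            in |u| and raises the weight exponent from b - t to b.\<close>
          have "1 \<le> 1 / \<delta> * (norm (u y) * (1 - norm y) powr t)" using uU[OF True] \<delta> by (simp add: field_simps)
          then have "\<bar>rkernel b x y\<bar> * (1 - norm y) powr (real b - t) * 1 \<le>
              \<bar>rkernel b x y\<bar> * (1 - norm y) powr (real b - t) * (1 / \<delta> * (norm (u y) * (1 - norm y) powr t))"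
            by (intro mult_left_mono) auto
          also have "\<dots> = 1 / \<delta> * (\<bar>rkernel b x y\<bar> * norm (u y) * ((1 - norm y) powr (real b - t) * (1 - norm y) powr t))"
            by (simp add: mult_ac)
          also have "(1 - norm y) powr (real b - t) * (1 - norm y) powr t = (1 - norm y) powr real b"
            by (simp flip: powr_add)
          finally show ?thesis using True \<delta> by (simp add: ennreal_leI flip: ennreal_mult)
        qed simp
      qed
      also have "\<dots> = ennreal (1 / \<delta>) * S x" unfolding S_def by (rule nn_integral_cmult[OF km])
      finally show ?thesis .
    qed
    have Sm: "S \<in> borel_measurable ball_measure"
    proof -
      have [measurable]: "(\<lambda>p. fst p) \<in> ball_measure \<Otimes>\<^sub>M ball_measure \<rightarrow>\<^sub>M (borel :: 'a measure)"
        by (rule measurable_compose[OF measurable_fst measurable_ident_ball_measure])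
      have [measurable]: "(\<lambda>p. snd p) \<in> ball_measure \<Otimes>\<^sub>M ball_measure \<rightarrow>\<^sub>M (borel :: 'a measure)"
        by (rule measurable_compose[OF measurable_snd measurable_ident_ball_measure])
      have [measurable]: "(\<lambda>p. u (snd p)) \<in> borel_measurable (ball_measure \<Otimes>\<^sub>M ball_measure)"
        by (rule measurable_compose[OF measurable_snd measurable_ball_measure_continuous[OF uc]])
      show ?thesis unfolding S_def
        by (rule ballm.borel_measurable_nn_integral) (simp only: case_prod_beta', measurable)
    qed
    have "superlevel_integral (real b) t p \<alpha> \<epsilon> f \<le>
        (\<integral>\<^sup>+x. ennreal ((1 / \<delta>) powr p) * (ennpowr (S x) p * ennreal ((1 - norm x) powr \<alpha>)) \<partial>ball_measure)"
      unfolding superlevel_integral_eq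
    proof (rule nn_integral_mono)
      fix x :: 'a
      have "ennpowr (superlevel_inner b t ?U x) p \<le> ennpowr (ennreal (1 / \<delta>) * S x) p"
        by (rule ennpowr_mono[OF inner]) (use p in simp)
      also have "\<dots> = ennreal ((1 / \<delta>) powr p) * ennpowr (S x) p" by (rule ennpowr_cmult) (use \<delta> in simp)
      finally have "ennpowr (superlevel_inner b t ?U x) p * ennreal ((1 - norm x) powr \<alpha>) \<le>
          ennreal ((1 / \<delta>) powr p) * ennpowr (S x) p * ennreal ((1 - norm x) powr \<alpha>)"
        by (rule mult_right_mono) simp
      then show "ennpowr (superlevel_inner b t ?U x) p * ennreal ((1 - norm x) powr \<alpha>) \<le>
          ennreal ((1 / \<delta>) powr p) * (ennpowr (S x) p * ennreal ((1 - norm x) powr \<alpha>))" by (simp add: mult.assoc)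
    qed
    also have "\<dots> = ennreal ((1 / \<delta>) powr p) * (\<integral>\<^sup>+x. ennpowr (S x) p * ennreal ((1 - norm x) powr \<alpha>) \<partial>ball_measure)"
    proof (rule nn_integral_cmult)
      have em: "(\<lambda>a. ennpowr a p) \<in> borel_measurable borel" unfolding ennpowr_def by measurable
      note [measurable] = measurable_compose[OF Sm em] measurable_ident_ball_measure
      show "(\<lambda>x. ennpowr (S x) p * ennreal ((1 - norm x) powr \<alpha>)) \<in> borel_measurable ball_measure" by measurable
    qed
    also have "\<dots> < \<infinity>" using S by (simp add: ennreal_mult_less_top)
    finally have "superlevel_integral (real b) t p \<alpha> \<epsilon> f < \<infinity>" .
    moreover have "0 < \<epsilon>" using \<epsilon> real by simp
    ultimately show ?thesis unfolding critical_level_def by (intro Inf_lower) auto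
  qed
  \<comment> \<open>Admissibility is established for levels strictly above \<open>g\<close>; the
    bound by \<open>g\<close> itself follows by letting the excess tend to 0.\<close>
  show ?thesis unfolding real
  proof (rule ennreal_le_epsilon)
    fix e :: real assume "0 < e"
    then show "critical_level (real b) t p \<alpha> f \<le> ennreal g + ennreal e"
      using lev[of "g + e"] real by simp
  qed
qed simp

text \<open>The constant stems from one kernel estimate with exponent b - t, so it depends only on
  \<open>b\<close>, \<open>t\<close> and the dimension and is quantified before \<open>f\<close>,
  \<open>p\<close> and \<alpha>.\<close>

lemma dist_le_critical_level:
  assumes t: "0 < t" "t < real b + 1"
  shows "\<exists>C>0. \<forall>(f :: 'a::euclidean_space \<Rightarrow> complex) p \<alpha>. f \<in> growth_space t \<longrightarrow> 1 < p \<longrightarrow>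
    dist_to_bergman t p \<alpha> f \<le> ennreal C * critical_level (real b) t p \<alpha> f"
proof -
  have s: "-1 < real b - t" "real b - t < real b" using t by auto
  obtain C where C: "C > 0" "\<And>x :: 'a. norm x < 1 \<Longrightarrow>
    (\<integral>\<^sup>+y. ennreal (\<bar>rkernel b x y\<bar> * (1 - norm y) powr (real b - t)) \<partial>ball_measure) \<le> ennreal (C * (1 - norm x) powr (real b - t - b))"
    using rkernel_integral_bound[OF s, where 'a = 'a] by blast
  \<comment> \<open>2^b comes from replacing 1 - |y|^2 by 1 - |y|, and \<open>C\<close> from the
    kernel estimate.\<close>
  define K where "K = 2 ^ b * C"
  have K: "K > 0" using C(1) by (simp add: K_def)
  have main: "dist_to_bergman t p \<alpha> f \<le> ennreal (K * \<epsilon>)"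
    if f: "f \<in> growth_space t" and p: "1 < p" and \<epsilon>: "0 < \<epsilon>" and fin: "superlevel_integral (real b) t p \<alpha> \<epsilon> f < \<infinity>"
    for f :: "'a \<Rightarrow> complex" and p \<alpha> \<epsilon>
  proof -
    let ?U = "superlevel \<epsilon> t f"
    have h: "harmonic_on f (ball 0 1)" using f by (simp add: growth_space_def)
    have fc: "continuous_on (ball 0 1) f" by (rule harmonic_on_imp_continuous_on[OF h])
    obtain A where A: "growth_norm t f = ennreal A" "0 \<le> A"
      using f by (cases "growth_norm t f") (auto simp: growth_space_def)
    have fA: "norm (f y) * (1 - norm y) powr t \<le> A" if "norm y < 1" for y
      using growth_normD[OF eq_refl[OF A(1)] A(2) that] .
    define g where "g y = f y * of_real ((1 - (norm y)\<^sup>2) ^ b)" for y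
    have ig: "integrable ball_measure g" unfolding g_def by (rule integrable_growth_weight(1)[OF fc fA t])
    have gb: "norm (g y) \<le> 2 ^ b * (norm (f y) * (1 - norm y) powr t) * (1 - norm y) powr (real b - t)" if "norm y < 1" for y
      unfolding g_def by (rule integrable_growth_weight(2)[OF fc fA t that])
    have U: "?U \<in> sets ball_measure" by (rule superlevel_sets[OF fc])
    have igU: "integrable ball_measure (\<lambda>y. indicator ?U y *\<^sub>R g y)" by (rule integrable_mult_indicator[OF U ig])
    define F where "F x = (LINT y|ball_measure. of_real (rkernel b x y) * (indicator ?U y *\<^sub>R g y))" for x
    have hF: "harmonic_on F (ball 0 1)" unfolding F_def [abs_def] by (rule harmonic_on_rkernel_integral[OF igU])
    \<comment> \<open>\<open>A + 1\<close> instead of \<open>A\<close> keeps the constant positive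
      even for f = 0, as pulling it out of \<open>ennpowr\<close> requires.\<close>
    have Fle: "ennreal (norm (F x)) \<le> ennreal (2 ^ b * (A + 1)) * superlevel_inner b t ?U x" if x: "norm x < 1" for x
    proof -
      have "ennreal (norm (F x)) \<le> (\<integral>\<^sup>+y. ennreal (norm (of_real (rkernel b x y) * (indicator ?U y *\<^sub>R g y))) \<partial>ball_measure)"
        unfolding F_def by (rule integral_norm_bound_ennreal[OF integrable_rkernel_mult[OF igU x]])
      also have "\<dots> \<le> (\<integral>\<^sup>+y. ennreal (2 ^ b * (A + 1)) * (ennreal (\<bar>rkernel b x y\<bar> * (1 - norm y) powr (real b - t)) * indicator ?U y) \<partial>ball_measure)"
      proof (rule nn_integral_mono)
        fix y :: 'a assume "y \<in> space ball_measure"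
        then have y: "norm y < 1" by simp
        show "ennreal (norm (of_real (rkernel b x y) * (indicator ?U y *\<^sub>R g y))) \<le>
            ennreal (2 ^ b * (A + 1)) * (ennreal (\<bar>rkernel b x y\<bar> * (1 - norm y) powr (real b - t)) * indicator ?U y)"
        proof (cases "y \<in> ?U")
          case True
          have "norm (g y) \<le> 2 ^ b * (A + 1) * (1 - norm y) powr (real b - t)"
            using fA[OF y] by (intro order_trans[OF gb[OF y]] mult_right_mono mult_left_mono) auto
          then have "\<bar>rkernel b x y\<bar> * norm (g y) \<le> \<bar>rkernel b x y\<bar> * (2 ^ b * (A + 1) * (1 - norm y) powr (real b - t))"
            by (rule mult_left_mono) simp
          then show ?thesis using True A(2) by (simp add: norm_mult mult_ac ennreal_leI flip: ennreal_mult)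
        qed simp
      qed
      also have "\<dots> = ennreal (2 ^ b * (A + 1)) * superlevel_inner b t ?U x"
        unfolding superlevel_inner_def
      proof (rule nn_integral_cmult)
        note [measurable] = measurable_ident_ball_measure U
        show "(\<lambda>y. ennreal (\<bar>rkernel b x y\<bar> * (1 - norm y) powr (real b - t)) * indicator ?U y) \<in> borel_measurable ball_measure"
          by measurable
      qed
      finally show ?thesis .
    qed
    have "(\<integral>\<^sup>+x. ennreal (norm (F x) powr p * (1 - norm x) powr \<alpha>) \<partial>ball_measure) < \<infinity>"
    proof -
      define c where "c = 2 ^ b * (A + 1)"
      have c: "c > 0" using A(2) by (simp add: c_def add_nonneg_pos)
      have "(\<integral>\<^sup>+x. ennreal (norm (F x) powr p * (1 - norm x) powr \<alpha>) \<partial>ball_measure) \<le>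
          (\<integral>\<^sup>+x. ennreal (c powr p) * (ennpowr (superlevel_inner b t ?U x) p * ennreal ((1 - norm x) powr \<alpha>)) \<partial>ball_measure)"
      proof (rule nn_integral_mono)
        fix x :: 'a assume "x \<in> space ball_measure"
        then have x: "norm x < 1" by simp
        have "ennreal (norm (F x) powr p) = ennpowr (ennreal (norm (F x))) p" by (simp add: ennpowr_ennreal)
        also have "\<dots> \<le> ennpowr (ennreal c * superlevel_inner b t ?U x) p"
          unfolding c_def by (rule ennpowr_mono[OF Fle[OF x]]) (use p in simp)
        also have "\<dots> = ennreal (c powr p) * ennpowr (superlevel_inner b t ?U x) p" by (rule ennpowr_cmult[OF c])
        finally have "ennreal (norm (F x) powr p) * ennreal ((1 - norm x) powr \<alpha>) \<le>
            ennreal (c powr p) * ennpowr (superlevel_inner b t ?U x) p * ennreal ((1 - norm x) powr \<alpha>)"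
          by (rule mult_right_mono) simp
        then show "ennreal (norm (F x) powr p * (1 - norm x) powr \<alpha>) \<le>
            ennreal (c powr p) * (ennpowr (superlevel_inner b t ?U x) p * ennreal ((1 - norm x) powr \<alpha>))"
          by (simp add: ennreal_mult mult.assoc)
      qed
      also have "\<dots> = ennreal (c powr p) * (\<integral>\<^sup>+x. ennpowr (superlevel_inner b t ?U x) p * ennreal ((1 - norm x) powr \<alpha>) \<partial>ball_measure)"
      proof (rule nn_integral_cmult)
        have [measurable]: "(\<lambda>p. fst p) \<in> ball_measure \<Otimes>\<^sub>M ball_measure \<rightarrow>\<^sub>M (borel :: 'a measure)"
          by (rule measurable_compose[OF measurable_fst measurable_ident_ball_measure])
        have [measurable]: "(\<lambda>p. snd p) \<in> ball_measure \<Otimes>\<^sub>M ball_measure \<rightarrow>\<^sub>M (borel :: 'a measure)"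
          by (rule measurable_compose[OF measurable_snd measurable_ident_ball_measure])
        have "(indicator ?U :: 'a \<Rightarrow> ennreal) \<in> borel_measurable ball_measure"
          using U by (rule borel_measurable_indicator)
        from measurable_compose[OF measurable_snd this]
        have [measurable]: "(\<lambda>p. indicator ?U (snd p) :: ennreal) \<in> borel_measurable ((ball_measure :: 'a measure) \<Otimes>\<^sub>M ball_measure)" .
        have Im: "superlevel_inner b t ?U \<in> borel_measurable ball_measure"
          unfolding superlevel_inner_def [abs_def]
          by (rule ballm.borel_measurable_nn_integral) (simp only: case_prod_beta', measurable)
        have em: "(\<lambda>a. ennpowr a p) \<in> borel_measurable borel" unfolding ennpowr_def by measurable
        note [measurable] = measurable_compose[OF Im em] measurable_ident_ball_measure
        show "(\<lambda>x. ennpowr (superlevel_inner b t ?U x) p * ennreal ((1 - norm x) powr \<alpha>)) \<in> borel_measurable ball_measure"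
          by measurable
      qed
      also have "\<dots> < \<infinity>" using fin by (simp add: superlevel_integral_eq ennreal_mult_less_top)
      finally show ?thesis .
    qed
    then have FB: "F \<in> bergman_space p \<alpha>"
      using hF bergman_norm_finite_iff[of p \<alpha> F] by (simp add: bergman_space_def)
    have "growth_norm t (\<lambda>x. f x - F x) \<le> ennreal (K * \<epsilon>)"
      unfolding growth_norm_def
    proof (rule SUP_least)
      fix x :: 'a assume "x \<in> ball 0 1"
      then have x: "norm x < 1" by simp
      let ?g' = "\<lambda>y. indicator (- ?U) y *\<^sub>R g y"
      have ig': "integrable ball_measure ?g'"
      proof -
        have "?g' = (\<lambda>y. g y - indicator ?U y *\<^sub>R g y)" by (auto simp: indicator_def fun_eq_iff)
        then show ?thesis using Bochner_Integration.integrable_diff[OF ig igU] by simp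
      qed
      have "f x = (LINT y|ball_measure. of_real (rkernel b x y) * g y)"
        unfolding g_def by (rule rkernel_reproducing[OF h ig[unfolded g_def] x, symmetric])
      then have "f x - F x = (LINT y|ball_measure. of_real (rkernel b x y) * g y - of_real (rkernel b x y) * (indicator ?U y *\<^sub>R g y))"
        unfolding F_def
        by (simp only: Bochner_Integration.integral_diff[OF integrable_rkernel_mult[OF ig x] integrable_rkernel_mult[OF igU x]])
      also have "\<dots> = (LINT y|ball_measure. of_real (rkernel b x y) * ?g' y)"
        by (rule Bochner_Integration.integral_cong) (auto simp: indicator_def)
      finally have fF: "f x - F x = (LINT y|ball_measure. of_real (rkernel b x y) * ?g' y)" .
      have km: "(\<lambda>y. ennreal (\<bar>rkernel b x y\<bar> * (1 - norm y) powr (real b - t))) \<in> borel_measurable ball_measure"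
        by (rule measurable_ball_measure) measurable
      have "ennreal (norm (f x - F x)) \<le> (\<integral>\<^sup>+y. ennreal (norm (of_real (rkernel b x y) * ?g' y)) \<partial>ball_measure)"
        unfolding fF by (rule integral_norm_bound_ennreal[OF integrable_rkernel_mult[OF ig' x]])
      also have "\<dots> \<le> (\<integral>\<^sup>+y. ennreal (2 ^ b * \<epsilon>) * ennreal (\<bar>rkernel b x y\<bar> * (1 - norm y) powr (real b - t)) \<partial>ball_measure)"
      proof (rule nn_integral_mono)
        fix y :: 'a assume "y \<in> space ball_measure"
        then have y: "norm y < 1" by simp
        show "ennreal (norm (of_real (rkernel b x y) * ?g' y)) \<le>
            ennreal (2 ^ b * \<epsilon>) * ennreal (\<bar>rkernel b x y\<bar> * (1 - norm y) powr (real b - t))"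
        proof (cases "y \<in> ?U")
          case False
          then have "norm (f y) * (1 - norm y) powr t \<le> \<epsilon>" using y by (simp add: superlevel_def)
          then have "norm (g y) \<le> 2 ^ b * \<epsilon> * (1 - norm y) powr (real b - t)"
            by (intro order_trans[OF gb[OF y]] mult_right_mono mult_left_mono) auto
          then have "\<bar>rkernel b x y\<bar> * norm (g y) \<le> \<bar>rkernel b x y\<bar> * (2 ^ b * \<epsilon> * (1 - norm y) powr (real b - t))"
            by (rule mult_left_mono) simp
          then show ?thesis using False \<epsilon> by (simp add: norm_mult mult_ac ennreal_leI flip: ennreal_mult)
        qed simp
      qed
      also have "\<dots> = ennreal (2 ^ b * \<epsilon>) * (\<integral>\<^sup>+y. ennreal (\<bar>rkernel b x y\<bar> * (1 - norm y) powr (real b - t)) \<partial>ball_measure)"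
        by (rule nn_integral_cmult[OF km])
      also have "\<dots> \<le> ennreal (2 ^ b * \<epsilon>) * ennreal (C * (1 - norm x) powr (real b - t - b))"
        by (intro mult_left_mono C(2) x) simp
      \<comment> \<open>Since (b - t) - b = -t, the kernel estimate leaves exactly the growth
        weight.\<close>
      also have "\<dots> = ennreal (K * \<epsilon> * (1 - norm x) powr (- t))"
        using \<epsilon> C(1) by (simp add: K_def mult_ac flip: ennreal_mult)
      finally have "norm (f x - F x) \<le> K * \<epsilon> * (1 - norm x) powr (- t)"
        using K \<epsilon> by simp
      then have "norm (f x - F x) * (1 - norm x) powr t \<le> K * \<epsilon> * (1 - norm x) powr (- t) * (1 - norm x) powr t"
        by (rule mult_right_mono) simp
      also have "\<dots> = K * \<epsilon>" using x by (simp add: mult.assoc flip: powr_add)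
      finally show "ennreal (norm (f x - F x) * (1 - norm x) powr t) \<le> ennreal (K * \<epsilon>)" by (rule ennreal_leI)
    qed
    with INF_lower[OF FB, of "\<lambda>u. growth_norm t (\<lambda>x. f x - u x)"]
    show ?thesis unfolding dist_to_bergman_def by (rule order_trans)
  qed
  have "dist_to_bergman t p \<alpha> f \<le> ennreal K * critical_level (real b) t p \<alpha> f"
    if f: "f \<in> growth_space t" and p: "1 < p" for f :: "'a \<Rightarrow> complex" and p \<alpha>
  proof -
    \<comment> \<open>With the constant moved to the left, the bound can be tested against each
      admissible level separately before the infimum is taken.\<close>
    have "ennreal (1 / K) * dist_to_bergman t p \<alpha> f \<le> critical_level (real b) t p \<alpha> f"
      unfolding critical_level_def
    proof (rule Inf_greatest)
      fix e assume "e \<in> {ennreal \<epsilon> |\<epsilon>. 0 < \<epsilon> \<and> superlevel_integral (real b) t p \<alpha> \<epsilon> f < \<infinity>}"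
      then obtain \<epsilon> where \<epsilon>: "e = ennreal \<epsilon>" "0 < \<epsilon>" "superlevel_integral (real b) t p \<alpha> \<epsilon> f < \<infinity>" by blast
      have "ennreal (1 / K) * dist_to_bergman t p \<alpha> f \<le> ennreal (1 / K) * ennreal (K * \<epsilon>)"
        by (intro mult_left_mono main[OF f p \<epsilon>(2,3)]) simp
      also have "\<dots> = e" using K \<epsilon>(1,2) by (simp flip: ennreal_mult)
      finally show "ennreal (1 / K) * dist_to_bergman t p \<alpha> f \<le> e" .
    qed
    then have "ennreal K * (ennreal (1 / K) * dist_to_bergman t p \<alpha> f) \<le> ennreal K * critical_level (real b) t p \<alpha> f"
      by (rule mult_left_mono) simp
    moreover have "ennreal K * (ennreal (1 / K) * dist_to_bergman t p \<alpha> f) = dist_to_bergman t p \<alpha> f"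
      using K by (simp add: mult.assoc[symmetric] flip: ennreal_mult)
    ultimately show ?thesis by simp
  qed
  with K show ?thesis by blast
qed

theorem theorem7:
  fixes p \<alpha> t :: real and \<beta> :: nat
  assumes "DIM('a::euclidean_space) \<ge> 2"
    and "p > 1"
    and "\<alpha> > -1"
    and "t = (\<alpha> + real DIM('a)) / p"
    and "real \<beta> > max ((\<alpha> + real DIM('a)) / p - 1) (\<alpha> / p)"
  shows "\<exists>c C :: real. 0 < c \<and> c \<le> C \<and>
           (\<forall>f :: 'a \<Rightarrow> complex. f \<in> growth_space t \<longrightarrow>
              ennreal c * critical_level (real \<beta>) t p \<alpha> f \<le> dist_to_bergman t p \<alpha> f \<and>
              dist_to_bergman t p \<alpha> f \<le> ennreal C * critical_level (real \<beta>) t p \<alpha> f)"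
proof -
  have t: "0 < t" "t < real \<beta> + 1" using assms by auto
  \<comment> \<open>As the dimension is at least 1, the bound t < \<beta> + 1 implies the exponent
    condition of the Schur test.\<close>
  have "(\<alpha> + 1) / p \<le> (\<alpha> + real DIM('a)) / p" using assms by (intro divide_right_mono) auto
  then have b: "(\<alpha> + 1) / p < real \<beta> + 1" using assms(5) by simp
  obtain C where C: "C > 0" "\<And>(f :: 'a \<Rightarrow> complex) p \<alpha>. f \<in> growth_space t \<Longrightarrow> 1 < p \<Longrightarrow>
      dist_to_bergman t p \<alpha> f \<le> ennreal C * critical_level (real \<beta>) t p \<alpha> f"
    using dist_le_critical_level[OF t, where 'a = 'a] by blast
  have lower: "ennreal 1 * critical_level (real \<beta>) t p \<alpha> f \<le> dist_to_bergman t p \<alpha> f" for f :: "'a \<Rightarrow> complex"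
    unfolding dist_to_bergman_def
    by (auto intro!: INF_greatest critical_level_le_growth_norm assms(2,3) b)
  have upper: "dist_to_bergman t p \<alpha> f \<le> ennreal (max 1 C) * critical_level (real \<beta>) t p \<alpha> f"
    if "f \<in> growth_space t" for f :: "'a \<Rightarrow> complex"
    by (rule order_trans[OF C(2)[OF that assms(2)]]) (intro mult_right_mono ennreal_leI, auto)
  \<comment> \<open>The lower constant is 1, and the maximum makes the upper one at least as
    large.\<close>
  show ?thesis
    by (intro exI[of _ 1] exI[of _ "max 1 C"] conjI allI impI lower upper) auto
qed

end
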